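(* Let $\mathcal M$ be a non-empty set of probability mass functions on $\mathcal X$ and let $\mathcal Q$ be a non-empty, bounded, convex set of rate matrices that has separately specified rows, with lower transition rate operator $\underline Q$ (the lower envelope of $\mathcal Q$). Let $L_t^s$ ($0\le t\le s$) be the lower transition operators corresponding to $\underline Q$. Then for any non-empty $u=t_0,\dots,t_n$ in $\mathcal U$ such that $t_0=0$, and any $f\in\mathcal L(\mathcal X_u)$: $$\underline{\mathbb E}^{\mathrm W}_{\mathcal Q,\mathcal M}[f(X_u)]=\underline{\mathbb E}_{\mathcal M}\bigl[L_{t_0}^{t_1}L_{t_1}^{t_2}\cdots L_{t_{n-1}}^{t_n}f\bigr].$$
   Context: State space and operators. $\mathcal X$ is a fixed finite non-empty state space; $\mathcal L(\mathcal X)$ is the set of all $f:\mathcal X\to\mathbb R$, with $\|f\|=\max_x|f(x)|$. A non-negatively homogeneous operator $A:\mathcal L(\mathcal X)\to\mathcal L(\mathcal X)$ has norm $\|A\|=\sup\{\|Af\|:\|f\|=1\}$. Matrices are real, indexed by $\mathcal X\times\mathcal X$, and act by $[Af](x)=\sum_yA(x,y)f(y)$. $I$ is the identity. $\underline{\mathbb E}_{\mathcal M}[f]=\inf\{\sum_{x}p(x)f(x):p\in\mathcal M\}$ for $f\in\mathcal L(\mathcal X)$. A rate matrix is a matrix $Q$ with $\sum_yQ(x,y)=0$ for all $x$ and $Q(x,y)\ge0$ for $x\ne y$; $\mathcal R$ is the set of all of them. $\mathcal Q\subseteq\mathcal R$ is bounded if $\sup_{Q\in\mathcal Q}\|Q\|<\infty$,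 and has separately specified rows if $\mathcal Q=\{Q\in\mathcal R:(\forall x\in\mathcal X)\,Q(x,\cdot)\in\mathcal Q_x\}$ with $\mathcal Q_x=\{Q(x,\cdot):Q\in\mathcal Q\}$. Its lower envelope is $[\underline Qf](x)=\inf\{[Qf](x):Q\in\mathcal Q\}$. A lower transition operator is a map $\underline T:\mathcal L(\mathcal X)\to\mathcal L(\mathcal X)$ with $[\underline Tf](x)\ge\min f$, $\underline T(f+g)\ge\underline Tf+\underline Tg$ and $\underline T(\lambda f)=\lambda\underline Tf$ for $\lambda\ge0$. For $t\le s$, $\mathcal U_{[t,s]}$ is the set of finite sequences $v:\ t=t_0<\dots<t_n=s$; $\Delta_i=t_i-t_{i-1}$, $\sigma(v)=\max_i\Delta_i$ ($0$ if $n=0$), $\Phi_v=(I+\Delta_1\underline Q)\cdots(I+\Delta_n\underline Q)$ ($I$ if $n=0$). $L_t^s$ is the (existing, unique) lower transition operator such that for every $\epsilon>0$ there is $\delta>0$ with $\|L_t^s-\Phi_v\|\le\epsilon$ for all $v\in\mathcal U_{[t,s]}$ with $\sigma(v)\le\delta$. For a non-empty sequence $w=r_0<\dots<r_k$ and $s>r_k$, $L_{r_k}^s$ is applied to $g\in\mathcal L(\mathcal X_{w\cup\{s\}})$ by $[L_{r_k}^sg](x_w)=[L_{r_k}^s\,g(x_w,\cdot)](x_{r_k})$ for $x_w\in\mathcal X_w$, giving a function in $\mathcal L(\mathcal X_w)$. (For $n=0$ the composition in the claim is empty.) Stochastic processes. $\mathcal U$ is the set of all finite (possibly empty) strictly increasing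 sequences in $\mathbb R_{\ge0}$, identified with finite subsets; $\mathcal U_{<t}$ consists of those with all elements $<t$. "$t>u$" means $t$ exceeds every element of $u$ (true if $u=\emptyset$). $\mathcal X_u=\prod_{t\in u}\mathcal X$, elements $x_u=(x_t)_{t\in u}$; $\mathcal L(\mathcal X_u)$ is the set of real functions on $\mathcal X_u$. $\Omega$ is a fixed set of paths $\omega:\mathbb R_{\ge0}\to\mathcal X$ such that for every non-empty $u\in\mathcal U$ and $x_u\in\mathcal X_u$ some $\omega\in\Omega$ satisfies $\omega|_u=x_u$. $(X_t=x)=\{\omega\in\Omega:\omega(t)=x\}$, $(X_u=x_u)=\{\omega\in\Omega:\omega|_u=x_u\}$ ($=\Omega$ if $u=\emptyset$). $\mathcal A_u$ is the algebra of subsets of $\Omega$ generated by the events $(X_t=x)$ with $x\in\mathcal X$ and $t\in u$ or $t>u$. $\mathcal C^{\mathrm{SP}}=\{(A,X_u=x_u):u\in\mathcal U,x_u\in\mathcal X_u,A\in\mathcal A_u\}$. A stochastic process is a map $P:\mathcal C^{\mathrm{SP}}\to\mathbb R$, written $P(A|C)$, that is coherent: for all $n\in\mathbb N$, $(A_i,C_i)\in\mathcal C^{\mathrm{SP}}$, $\lambda_i\in\mathbb R$ ($1\le i\le n$), $\max\{\sum_{i=1}^n\lambda_i\mathbb I_{C_i}(\omega)(P(A_i|C_i)-\mathbb I_{A_i}(\omega)):\omega\in\bigcup_iC_i\}\ge0$. $P(A)=P(A|\Omega)$. For $t\le s$, $u\in\mathcal U_{<t}$, $x_u\in\mathcal X_u$: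 $T_{t,x_u}^s(x,y)=P(X_s=y|X_t=x,X_u=x_u)$. $P$ is well-behaved if for all $t\ge0$, $u\in\mathcal U_{<t}$, $x_u\in\mathcal X_u$: $\limsup_{\Delta\to0^+}\frac1\Delta\|T_{t,x_u}^{t+\Delta}-I\|<\infty$ and, if $t>0$, $\limsup_{\Delta\to0^+}\frac1\Delta\|T_{t-\Delta,x_u}^{t}-I\|<\infty$. The outer partial derivative $\overline\partial T_{t,x_u}^t$ is the set of all $Q\in\mathcal R$ that are limits of $\frac1{\Delta_i}(T_{t,x_u}^{t+\Delta_i}-I)$ or, if $t>0$, of $\frac1{\Delta_i}(T_{t-\Delta_i,x_u}^t-I)$, for some sequence $\Delta_i\to0^+$. $P$ is consistent with $\mathcal Q$ if $\overline\partial T_{t,x_u}^t\subseteq\mathcal Q$ for all $t\ge0$, $u\in\mathcal U_{<t}$, $x_u\in\mathcal X_u$, and consistent with $\mathcal M$ if the mass function $x\mapsto P(X_0=x)$ is in $\mathcal M$. $\mathbb P^{\mathrm W}_{\mathcal Q,\mathcal M}$ is the set of all well-behaved stochastic processes consistent with $\mathcal Q$ and $\mathcal M$, and $\underline{\mathbb E}^{\mathrm W}_{\mathcal Q,\mathcal M}[f(X_u)]=\inf\{\sum_{x_u\in\mathcal X_u}f(x_u)P(X_u=x_u):P\in\mathbb P^{\mathrm W}_{\mathcal Q,\mathcal M}\}$. *)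

theory Defs
  imports "HOL-Analysis.Analysis" "HOL-Probability.Probability_Mass_Function"
begin

text \<open>
  The state space is the universe of a finite type \<open>'x\<close>. Real functions on it are vectors
  in \<open>real^'x\<close>, with the maximum norm \<open>infnorm\<close>, and matrices act on them by \<open>*v\<close>.
\<close>

section \<open>Operators\<close>

type_synonym 'x operator = "real^'x \<Rightarrow> real^'x"

text \<open>Only meaningful if the set is bounded, as it is for all operators below.\<close>

definition op_norm :: "'x::finite operator \<Rightarrow> real" where
  "op_norm A = Sup {infnorm (A f) | f. infnorm f = 1}"

definition rate_matrices :: "(real^'x^'x::finite) set" where
  "rate_matrices = {Q. (\<forall>x. (\<Sum>y\<in>UNIV. Q $ x $ y) = 0) \<and> (\<forall>x y. x \<noteq> y \<longrightarrow> Q $ x $ y \<ge> 0)}"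

definition bounded_rates :: "(real^'x^'x::finite) set \<Rightarrow> bool" where
  "bounded_rates \<Q> \<longleftrightarrow> bdd_above ((\<lambda>Q. op_norm ((*v) Q)) ` \<Q>)"

definition separately_specified_rows :: "(real^'x^'x::finite) set \<Rightarrow> bool" where
  "separately_specified_rows \<Q> \<longleftrightarrow>
     \<Q> = {Q \<in> rate_matrices. \<forall>x. Q $ x \<in> (\<lambda>R. R $ x) ` \<Q>}"

definition lower_rate :: "(real^'x^'x::finite) set \<Rightarrow> 'x operator" where
  "lower_rate \<Q> f = (\<chi> x. INF Q\<in>\<Q>. (Q *v f) $ x)"

definition lower_transition_operator :: "'x::finite operator \<Rightarrow> bool" where
  "lower_transition_operator T \<longleftrightarrow>
     (\<forall>f x. T f $ x \<ge> Min (range (($) f))) \<and>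
     (\<forall>f g x. T (f + g) $ x \<ge> T f $ x + T g $ x) \<and>
     (\<forall>c f. c \<ge> 0 \<longrightarrow> T (c *\<^sub>R f) = c *\<^sub>R T f)"

definition grids :: "real \<Rightarrow> real \<Rightarrow> real list set" where
  "grids t s = {v. v \<noteq> [] \<and> sorted_wrt (<) v \<and> hd v = t \<and> last v = s}"

definition mesh :: "real list \<Rightarrow> real" where
  "mesh v = (if length v \<le> 1 then 0 else Max ((\<lambda>i. v ! Suc i - v ! i) ` {..<length v - 1}))"

fun grid_operator :: "'x::finite operator \<Rightarrow> real list \<Rightarrow> 'x operator" where
  "grid_operator Qlow (t # s # v) =
     (\<lambda>f. f + (s - t) *\<^sub>R Qlow f) \<circ> grid_operator Qlow (s # v)"
| "grid_operator Qlow _ = id"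

text \<open>\<open>L\<^sub>t\<^sup>s\<close>, for a lower transition rate operator \<open>Qlow\<close> and \<open>t \<le> s\<close>\<close>

definition lower_trans :: "'x::finite operator \<Rightarrow> real \<Rightarrow> real \<Rightarrow> 'x operator" where
  "lower_trans Qlow t s = (THE L. lower_transition_operator L \<and>
     (\<forall>\<epsilon>>0. \<exists>\<delta>>0. \<forall>v\<in>grids t s. mesh v \<le> \<delta> \<longrightarrow>
        op_norm (\<lambda>f. L f - grid_operator Qlow v f) \<le> \<epsilon>))"

section \<open>Time sequences and joint states\<close>

text \<open>
  A finite sequence of time points is identified with its set of elements, and an element of
  \<open>\<X>\<^sub>u\<close> is an extensional function on \<open>u\<close>. Functions on \<open>\<X>\<^sub>u\<close> are total HOL functions of
  which only the values on \<open>states u\<close> matter.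
\<close>

definition time_seqs :: "real set set" where
  "time_seqs = {u. finite u \<and> u \<subseteq> {0..}}"

definition time_seqs_before :: "real \<Rightarrow> real set set" where
  "time_seqs_before t = {u \<in> time_seqs. \<forall>r\<in>u. r < t}"

definition states :: "real set \<Rightarrow> (real \<Rightarrow> 'x) set" where
  "states u = u \<rightarrow>\<^sub>E UNIV"

text \<open>
  For a family \<open>L\<close> of operators, \<open>extend_op L w s\<close> maps functions on \<open>states (insert s w)\<close> to
  functions on \<open>states w\<close>, where \<open>s\<close> exceeds all elements of \<open>w\<close>.
\<close>

definition extend_op ::
  "(real \<Rightarrow> real \<Rightarrow> 'x::finite operator) \<Rightarrow> real set \<Rightarrow> real
     \<Rightarrow> ((real \<Rightarrow> 'x) \<Rightarrow> real) \<Rightarrow> (real \<Rightarrow> 'x) \<Rightarrow> real" where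
  "extend_op L w s g = (\<lambda>x. L (Max w) s (\<chi> y. g (x(s := y))) $ x (Max w))"

text \<open>The composition for \<open>t 0 < \<dots> < t n\<close>, a function on \<open>states {t 0}\<close>\<close>

fun compose_ops ::
  "(real \<Rightarrow> real \<Rightarrow> 'x::finite operator) \<Rightarrow> (nat \<Rightarrow> real) \<Rightarrow> nat
     \<Rightarrow> ((real \<Rightarrow> 'x) \<Rightarrow> real) \<Rightarrow> (real \<Rightarrow> 'x) \<Rightarrow> real" where
  "compose_ops L t 0 f = f"
| "compose_ops L t (Suc n) f = compose_ops L t n (extend_op L (t ` {..n}) (t (Suc n)) f)"

section \<open>Stochastic processes\<close>

text \<open>Paths on the non-negative reals are functions on \<open>real\<close> that are extensional on \<open>{0..}\<close>.\<close>

definition path_space :: "(real \<Rightarrow> 'x) set \<Rightarrow> bool" where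
  "path_space \<Omega> \<longleftrightarrow> \<Omega> \<subseteq> {0..} \<rightarrow>\<^sub>E UNIV \<and>
     (\<forall>u\<in>time_seqs. u \<noteq> {} \<longrightarrow> (\<forall>xu\<in>states u. \<exists>\<omega>\<in>\<Omega>. restrict \<omega> u = xu))"

definition state_event :: "(real \<Rightarrow> 'x) set \<Rightarrow> real \<Rightarrow> 'x \<Rightarrow> (real \<Rightarrow> 'x) set" where
  "state_event \<Omega> t x = {\<omega>\<in>\<Omega>. \<omega> t = x}"

definition joint_event :: "(real \<Rightarrow> 'x) set \<Rightarrow> real set \<Rightarrow> (real \<Rightarrow> 'x) \<Rightarrow> (real \<Rightarrow> 'x) set" where
  "joint_event \<Omega> u xu = {\<omega>\<in>\<Omega>. restrict \<omega> u = xu}"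

definition events_from :: "(real \<Rightarrow> 'x) set \<Rightarrow> real set \<Rightarrow> (real \<Rightarrow> 'x) set set" where
  "events_from \<Omega> u = algebra \<Omega> hull
     {state_event \<Omega> t x | t x. t \<ge> 0 \<and> (t \<in> u \<or> (\<forall>r\<in>u. t > r))}"

definition process_domain ::
  "(real \<Rightarrow> 'x) set \<Rightarrow> ((real \<Rightarrow> 'x) set \<times> (real \<Rightarrow> 'x) set) set" where
  "process_domain \<Omega> =
     {(A, joint_event \<Omega> u xu) | A u xu. u \<in> time_seqs \<and> xu \<in> states u \<and> A \<in> events_from \<Omega> u}"

text \<open>
  \<open>P A C\<close> stands for \<open>P(A | C)\<close>; values outside \<open>process_domain \<Omega>\<close> are irrelevant.
  The maximum in the coherence condition is over a finite set, because the sum is a function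
  of finitely many indicators.
\<close>

type_synonym 'x process = "(real \<Rightarrow> 'x) set \<Rightarrow> (real \<Rightarrow> 'x) set \<Rightarrow> real"

definition stochastic_process :: "(real \<Rightarrow> 'x) set \<Rightarrow> 'x process \<Rightarrow> bool" where
  "stochastic_process \<Omega> P \<longleftrightarrow>
     (\<forall>n A C c. n \<ge> 1 \<longrightarrow> (\<forall>i\<in>{1..n::nat}. (A i, C i) \<in> process_domain \<Omega>) \<longrightarrow>
        Max ((\<lambda>\<omega>. \<Sum>i=1..n. c i * indicator (C i) \<omega> * (P (A i) (C i) - indicator (A i) \<omega>))
               ` (\<Union>i\<in>{1..n}. C i)) \<ge> 0)"

definition transition_matrix ::
  "(real \<Rightarrow> 'x::finite) set \<Rightarrow> 'x process \<Rightarrow> real set \<Rightarrow> (real \<Rightarrow> 'x) \<Rightarrow> real \<Rightarrow> real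
     \<Rightarrow> real^'x^'x" where
  "transition_matrix \<Omega> P u xu t s =
     (\<chi> x y. P (state_event \<Omega> s y) (state_event \<Omega> t x \<inter> joint_event \<Omega> u xu))"

definition well_behaved :: "(real \<Rightarrow> 'x::finite) set \<Rightarrow> 'x process \<Rightarrow> bool" where
  "well_behaved \<Omega> P \<longleftrightarrow> (\<forall>t\<ge>0. \<forall>u\<in>time_seqs_before t. \<forall>xu\<in>states u.
     Limsup (at_right 0) (\<lambda>\<Delta>. ereal (1 / \<Delta> *
       op_norm ((*v) (transition_matrix \<Omega> P u xu t (t + \<Delta>) - mat 1)))) < \<infinity> \<and>
     (t > 0 \<longrightarrow> Limsup (at_right 0) (\<lambda>\<Delta>. ereal (1 / \<Delta> *
       op_norm ((*v) (transition_matrix \<Omega> P u xu (t - \<Delta>) t - mat 1)))) < \<infinity>))"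

definition outer_derivative ::
  "(real \<Rightarrow> 'x::finite) set \<Rightarrow> 'x process \<Rightarrow> real set \<Rightarrow> (real \<Rightarrow> 'x) \<Rightarrow> real
     \<Rightarrow> (real^'x^'x) set" where
  "outer_derivative \<Omega> P u xu t = {Q \<in> rate_matrices.
     \<exists>\<Delta>. filterlim \<Delta> (at_right 0) sequentially \<and>
       ((\<lambda>i. (1 / \<Delta> i) *\<^sub>R (transition_matrix \<Omega> P u xu t (t + \<Delta> i) - mat 1)) \<longlonglongrightarrow> Q \<or>
        t > 0 \<and>
        (\<lambda>i. (1 / \<Delta> i) *\<^sub>R (transition_matrix \<Omega> P u xu (t - \<Delta> i) t - mat 1)) \<longlonglongrightarrow> Q)}"

definition consistent_rates ::
  "(real \<Rightarrow> 'x::finite) set \<Rightarrow> (real^'x^'x) set \<Rightarrow> 'x process \<Rightarrow> bool" where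
  "consistent_rates \<Omega> \<Q> P \<longleftrightarrow>
     (\<forall>t\<ge>0. \<forall>u\<in>time_seqs_before t. \<forall>xu\<in>states u. outer_derivative \<Omega> P u xu t \<subseteq> \<Q>)"

definition consistent_initial ::
  "(real \<Rightarrow> 'x) set \<Rightarrow> 'x pmf set \<Rightarrow> 'x process \<Rightarrow> bool" where
  "consistent_initial \<Omega> M P \<longleftrightarrow> (\<lambda>x. P (state_event \<Omega> 0 x) \<Omega>) \<in> pmf ` M"

definition processes_W ::
  "(real \<Rightarrow> 'x::finite) set \<Rightarrow> (real^'x^'x) set \<Rightarrow> 'x pmf set \<Rightarrow> 'x process set" where
  "processes_W \<Omega> \<Q> M = {P. stochastic_process \<Omega> P \<and> well_behaved \<Omega> P \<and>
     consistent_rates \<Omega> \<Q> P \<and> consistent_initial \<Omega> M P}"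

definition lower_expectation_W ::
  "(real \<Rightarrow> 'x::finite) set \<Rightarrow> (real^'x^'x) set \<Rightarrow> 'x pmf set \<Rightarrow> real set
     \<Rightarrow> ((real \<Rightarrow> 'x) \<Rightarrow> real) \<Rightarrow> real" where
  "lower_expectation_W \<Omega> \<Q> M u f =
     (INF P\<in>processes_W \<Omega> \<Q> M. \<Sum>xu\<in>states u. f xu * P (joint_event \<Omega> u xu) \<Omega>)"

definition lower_expectation :: "'x::finite pmf set \<Rightarrow> real^'x \<Rightarrow> real" where
  "lower_expectation M f = (INF p\<in>M. \<Sum>x\<in>UNIV. pmf p x * f $ x)"

end

theory Submission
  imports Defs
begin

text \<open>
  Lower bound: for a process in the set and a history \<open>X\<^sub>u = x\<^sub>u\<close>, the conditional expectation of
  \<open>(L\<^sub>r\<^sup>s g)(X\<^sub>r)\<close> is a continuous function of \<open>r\<close>. Its lower right derivative is non-negative, since the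
  limit points of the difference quotients of the transition matrices lie in \<open>\<Q>\<close>. So it increases from
  \<open>L\<^sub>t\<^sup>s g\<close> to the expectation of \<open>g(X\<^sub>s)\<close>.

  Upper bound: for every \<open>n\<close>, dynamic programming gives a chain with memory and time step \<open>2\<^sup>-\<^sup>n\<close> that
  picks, at each step, an optimal rate matrix from a finite subset of \<open>\<Q>\<close>. Its kernels are mixed with a
  little uniform noise, so that all histories have positive probability and all conditional probabilities
  are defined by Bayes' rule. Tychonoff's theorem gives a limit of these conditional probabilities.
  Coherence passes to the limit, and so does a one-sided estimate of the transition matrices that
  holds whatever the unobserved part of the history. Convexity and separately specified rows then yield
  consistency with \<open>\<Q>\<close>.
\<close>

section \<open>Lower transition operators\<close>

text \<open>The payoff sees several times, so good rates must depend on the past, while consistency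
  constrains the transition matrices under every history, and a history observes only finitely many
  times. A direct construction in continuous time would have to glue processes together. Discrete
  chains avoid this: one inequality per step, valid for every control in the finite set and every
  test function, bounds the conditional expectations from below. Applied to g and to -g, it bounds
  the matrices from both sides, so good behaviour of the limit comes from the same estimate as
  consistency. In the lower bound the difference quotients need not converge. Compactness gives one
  convergent subsequence, hence one good increment at each time, and this is enough to make a
  continuous function grow. The operators \<open>L\<close> are defined as limits over all grids.
  They are obtained here from Euler products with step 2^-n: each level halves the steps of the
  previous one, so the errors are geometric. Arbitrary grids are compared with this limit
  afterwards.\<close>

lemma infnorm_le_iff: "infnorm (f::real^'x::finite) \<le> c \<longleftrightarrow> (\<forall>x. \<bar>f $ x\<bar> \<le> c)"
proof
  assume "infnorm f \<le> c"
  then show "\<forall>x. \<bar>f $ x\<bar> \<le> c" using component_le_infnorm_cart order_trans by blast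
next
  assume "\<forall>x. \<bar>f $ x\<bar> \<le> c"
  then show "infnorm f \<le> c" unfolding infnorm_cart by (intro cSup_least) auto
qed

lemma infnorm_axis: "infnorm (axis x 1 :: real^'x::finite) = 1"
proof (rule antisym)
  show "infnorm (axis x 1 :: real^'x) \<le> 1" unfolding infnorm_le_iff by (auto simp: axis_def)
  show "1 \<le> infnorm (axis x 1 :: real^'x)"
    using component_le_infnorm_cart[of "axis x 1 :: real^'x" x] by (simp add: axis_def)
qed

lemma infnorm_triangle_diff: "infnorm (a - c) \<le> infnorm (a - b) + infnorm (b - c)"
  for a b c :: "real^'x::finite"
  using infnorm_triangle[of "a - b" "b - c"] by simp

lemma infnorm_le_limit:
  fixes X :: "nat \<Rightarrow> real^'x::finite"
  assumes "X \<longlonglongrightarrow> l" "Y \<longlonglongrightarrow> c" "\<forall>\<^sub>F n in sequentially. infnorm (X n) \<le> Y n"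
  shows "infnorm l \<le> c"
  by (rule tendsto_le[OF sequentially_bot assms(2) tendsto_infnorm[OF assms(1)] assms(3)])

lemma op_norm_le:
  fixes A :: "'x::finite operator"
  assumes "\<And>f. infnorm f = 1 \<Longrightarrow> infnorm (A f) \<le> c"
  shows "op_norm A \<le> c"
  unfolding op_norm_def by (rule cSup_least) (use assms infnorm_axis in auto)

text \<open>The uniform bound \<open>c\<close> makes the supremum in \<open>op_norm\<close> one of a
  bounded set, as a supremum of reals requires.\<close>

lemma infnorm_le_op_norm:
  fixes A :: "'x::finite operator"
  assumes "\<And>f. infnorm f = 1 \<Longrightarrow> infnorm (A f) \<le> c" and "infnorm f = 1"
  shows "infnorm (A f) \<le> op_norm A"
  unfolding op_norm_def by (rule cSup_upper) (use assms in \<open>auto intro!: bdd_aboveI[of _ c]\<close>)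

text \<open>Superadditivity for g = f + (g - f), together with T (g - f) \<ge> min (g - f) \<ge> -c.
  The case c = 0 is monotonicity; the case c = infnorm (f - g) makes T nonexpansive, so that local
  errors simply add up in all later estimates.\<close>

lemma lower_transition_le:
  assumes "lower_transition_operator T" and "\<And>y. f $ y \<le> g $ y + c"
  shows "T f $ x \<le> T g $ x + c"
proof -
  have "T (f + (g - f)) $ x \<ge> T f $ x + T (g - f) $ x"
    using assms(1) unfolding lower_transition_operator_def by blast
  moreover have "T (g - f) $ x \<ge> Min (range (($) (g - f)))"
    using assms(1) unfolding lower_transition_operator_def by blast
  moreover have "Min (range (($) (g - f))) \<ge> - c"
  proof (subst Min_ge_iff)
    show "\<forall>a\<in>range (($) (g - f)). - c \<le> a"
    proof safe
      fix y show "- c \<le> (g - f) $ y" using assms(2)[of y] by simp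
    qed
  qed auto
  moreover have "f + (g - f) = g" by simp
  ultimately show ?thesis by (smt (verit))
qed

lemma lower_transition_nonexpansive:
  assumes "lower_transition_operator T"
  shows "infnorm (T f - T g) \<le> infnorm (f - g)"
proof -
  have "T f $ x \<le> T g $ x + infnorm (f - g)" for f g x
  proof (rule lower_transition_le[OF assms])
    fix y
    show "f $ y \<le> g $ y + infnorm (f - g)"
      using component_le_infnorm_cart[of "f - g" y] by simp
  qed
  from this[of f _ g] this[of g _ f] show ?thesis
    unfolding infnorm_le_iff
    by (simp add: abs_le_iff algebra_simps infnorm_sub[of g f])
qed

lemma lower_transition_scale:
  "lower_transition_operator T \<Longrightarrow> c \<ge> 0 \<Longrightarrow> T (c *\<^sub>R f) = c *\<^sub>R T f"
  unfolding lower_transition_operator_def by blast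

lemma lower_transition_zero: "lower_transition_operator T \<Longrightarrow> T 0 = 0"
  using lower_transition_scale[of T 0 0] by simp

lemma lower_transition_infnorm_le:
  "lower_transition_operator T \<Longrightarrow> infnorm (T f) \<le> infnorm f"
  using lower_transition_nonexpansive[of T f 0]
  by (simp add: lower_transition_zero)

lemma lower_transition_abs_le:
  assumes "lower_transition_operator T" and "\<And>y. \<bar>f $ y\<bar> \<le> c"
  shows "\<bar>T f $ x\<bar> \<le> c"
  using lower_transition_infnorm_le[OF assms(1), of f] assms(2)
  by (meson infnorm_le_iff order_trans)

lemma lower_transition_id: "lower_transition_operator id"
  unfolding lower_transition_operator_def by auto

text \<open>Superadditivity is the delicate clause: the outer operator must also be monotone, which
  is \<open>lower_transition_le\<close> with constant 0.\<close>

lemma lower_transition_compose: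
  assumes "lower_transition_operator S" and "lower_transition_operator T"
  shows "lower_transition_operator (S \<circ> T)"
  unfolding lower_transition_operator_def
proof (intro conjI allI impI)
  fix f :: "real^'a" and x
  have "Min (range (($) f)) \<le> Min (range (($) (T f)))"
    using assms(2) unfolding lower_transition_operator_def by (subst Min_ge_iff) auto
  also have "\<dots> \<le> S (T f) $ x" using assms(1) unfolding lower_transition_operator_def by blast
  finally show "Min (range (($) f)) \<le> (S \<circ> T) f $ x" by simp
next
  fix f g :: "real^'a" and x
  have "S (T f) $ x + S (T g) $ x \<le> S (T f + T g) $ x"
    using assms(1) unfolding lower_transition_operator_def by blast
  also have "\<dots> \<le> S (T (f + g)) $ x + 0"
    by (rule lower_transition_le[OF assms(1)])
      (use assms(2) in \<open>simp add: lower_transition_operator_def\<close>)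
  finally show "(S \<circ> T) f $ x + (S \<circ> T) g $ x \<le> (S \<circ> T) (f + g) $ x" by simp
next
  fix c :: real and f :: "real^'a"
  assume "0 \<le> c"
  then show "(S \<circ> T) (c *\<^sub>R f) = c *\<^sub>R (S \<circ> T) f"
    by (simp add: lower_transition_scale assms)
qed

lemma lower_transition_funpow:
  "lower_transition_operator T \<Longrightarrow> lower_transition_operator (T ^^ k)"
  by (induction k) (simp_all add: lower_transition_id lower_transition_compose)

lemma lower_transition_limit:
  assumes T: "\<And>n. lower_transition_operator (T n)"
    and lim: "\<And>f. (\<lambda>n. T n f) \<longlonglongrightarrow> S f"
  shows "lower_transition_operator S"
  unfolding lower_transition_operator_def
proof (intro conjI allI impI)
  have comp: "(\<lambda>n. T n f $ x) \<longlonglongrightarrow> S f $ x" for f x by (intro tendsto_vec_nth lim)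
  fix f g :: "real^'a" and x
  show "Min (range (($) f)) \<le> S f $ x"
    by (rule LIMSEQ_le_const[OF comp]) (use T in \<open>auto simp: lower_transition_operator_def\<close>)
  show "S f $ x + S g $ x \<le> S (f + g) $ x"
    by (rule LIMSEQ_le[OF tendsto_add[OF comp comp] comp])
      (use T in \<open>auto simp: lower_transition_operator_def\<close>)
next
  fix c :: real and f :: "real^'a"
  assume "0 \<le> c"
  have "(\<lambda>n. c *\<^sub>R T n f) \<longlonglongrightarrow> c *\<^sub>R S f" by (intro tendsto_intros lim)
  moreover have "(\<lambda>n. c *\<^sub>R T n f) = (\<lambda>n. T n (c *\<^sub>R f))"
    using T \<open>0 \<le> c\<close> by (simp add: lower_transition_scale)
  ultimately show "S (c *\<^sub>R f) = c *\<^sub>R S f" using lim LIMSEQ_unique by metis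
qed


section \<open>The semigroup generated by a lower transition rate operator\<close>

definition euler :: "'x::finite operator \<Rightarrow> real \<Rightarrow> 'x operator" where
  "euler A d = (\<lambda>f. f + d *\<^sub>R A f)"

text \<open>The number of complete steps of length 2^-n in the interval from 0 to a. It later serves
  as the position of time a in the state list of the n-th chain.\<close>

definition dyadic :: "nat \<Rightarrow> real \<Rightarrow> nat" where
  "dyadic n a = nat \<lfloor>a * 2 ^ n\<rfloor>"

lemma dyadic_bounds:
  assumes "a \<ge> 0"
  shows "real (dyadic n a) / 2 ^ n \<le> a" "a < real (dyadic n a) / 2 ^ n + 1 / 2 ^ n"
proof -
  have *: "real (dyadic n a) = of_int \<lfloor>a * 2 ^ n\<rfloor>" using assms by (simp add: dyadic_def)
  show "real (dyadic n a) / 2 ^ n \<le> a" unfolding * by (simp add: field_simps)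
  have "a * 2 ^ n < of_int \<lfloor>a * 2 ^ n\<rfloor> + 1" by linarith
  then show "a < real (dyadic n a) / 2 ^ n + 1 / 2 ^ n"
    unfolding * by (simp add: field_simps)
qed

lemma tendsto_inverse_two_power: "(\<lambda>n. 1 / 2 ^ n :: real) \<longlonglongrightarrow> 0"
  using LIMSEQ_realpow_zero[of "1/2 :: real"] by (simp add: power_one_over)

lemma dyadic_tendsto:
  assumes "a \<ge> 0"
  shows "(\<lambda>n. real (dyadic n a) / 2 ^ n) \<longlonglongrightarrow> a"
proof (rule tendsto_sandwich)
  show "(\<lambda>n. a - 1 / 2 ^ n) \<longlonglongrightarrow> a"
    using tendsto_diff[OF tendsto_const tendsto_inverse_two_power, of a] by simp
  show "\<forall>\<^sub>F n in sequentially. a - 1 / 2 ^ n \<le> real (dyadic n a) / 2 ^ n"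
    using dyadic_bounds[OF assms] by (intro always_eventually allI) (smt (verit))
  show "\<forall>\<^sub>F n in sequentially. real (dyadic n a) / 2 ^ n \<le> a"
    using dyadic_bounds[OF assms] by simp
qed auto

lemma dyadic_mono: "a \<le> b \<Longrightarrow> dyadic n a \<le> dyadic n b"
  unfolding dyadic_def by (intro nat_mono floor_mono mult_right_mono) auto

text \<open>Rounding loses less than one step in each summand, so the two counts differ by at most
  one. This single Euler step is the rounding error in the estimates below.\<close>

lemma dyadic_add:
  assumes "a \<ge> 0" "b \<ge> 0"
  shows "dyadic n (a + b) = dyadic n a + dyadic n b \<or>
    dyadic n (a + b) = Suc (dyadic n a + dyadic n b)"
proof -
  have "\<lfloor>(a+b) * 2^n\<rfloor> = \<lfloor>a * 2^n\<rfloor> + \<lfloor>b * 2^n\<rfloor> \<or> \<lfloor>(a+b) * 2^n\<rfloor> = \<lfloor>a * 2^n\<rfloor> + \<lfloor>b * 2^n\<rfloor> + 1"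
    unfolding distrib_right by linarith
  moreover have "\<lfloor>a * 2^n\<rfloor> \<ge> 0" "\<lfloor>b * 2^n\<rfloor> \<ge> 0" using assms by auto
  ultimately show ?thesis unfolding dyadic_def by linarith
qed

lemma dyadic_Suc:
  assumes "a \<ge> 0"
  shows "dyadic (Suc n) a = 2 * dyadic n a \<or> dyadic (Suc n) a = Suc (2 * dyadic n a)"
proof -
  have "dyadic (Suc n) a = dyadic n (a + a)" unfolding dyadic_def by (simp add: algebra_simps)
  then show ?thesis using dyadic_add[OF assms assms, of n] by presburger
qed

text \<open>The bound is stated for the action on functions, so that it passes with the same
  \<open>B\<close> to every non-empty subset, in particular to the finite sets of controls.\<close>

locale bounded_rate_set =
  fixes F :: "(real^'x^'x::finite) set" and B :: real
  assumes nonempty: "F \<noteq> {}" and rates: "F \<subseteq> rate_matrices"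
    and bound: "\<And>Q f x. Q \<in> F \<Longrightarrow> \<bar>(Q *v f) $ x\<bar> \<le> B * infnorm f"
begin

section \<open>The lower envelope of a bounded set of rate matrices\<close>

abbreviation "Qlow \<equiv> lower_rate F"

lemma entry_bound: "Q \<in> F \<Longrightarrow> \<bar>Q $ x $ y\<bar> \<le> B"
  using bound[of Q "axis y 1" x]
  by (simp add: matrix_vector_mult_basis column_def infnorm_axis)

lemma B_nonneg: "B \<ge> 0"
proof -
  obtain Q where "Q \<in> F" using nonempty by auto
  from entry_bound[OF this, of undefined undefined] show ?thesis by linarith
qed

lemma Qlow_bdd: "bdd_below ((\<lambda>Q. (Q *v f) $ x) ` F)"
proof (rule bdd_belowI2)
  fix Q assume "Q \<in> F"
  from bound[OF this, of f x] show "- (B * infnorm f) \<le> (Q *v f) $ x" by linarith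
qed

lemma Qlow_le: "Q \<in> F \<Longrightarrow> Qlow f $ x \<le> (Q *v f) $ x"
  unfolding lower_rate_def by (simp add: cINF_lower[OF Qlow_bdd])

lemma Qlow_ge: "(\<And>Q. Q \<in> F \<Longrightarrow> c \<le> (Q *v f) $ x) \<Longrightarrow> c \<le> Qlow f $ x"
  unfolding lower_rate_def by (simp add: cINF_greatest[OF nonempty])

lemma Qlow_lipschitz: "infnorm (Qlow f - Qlow g) \<le> B * infnorm (f - g)"
proof -
  have "Qlow g $ x - B * infnorm (f - g) \<le> Qlow f $ x" for f g x
  proof (rule Qlow_ge)
    fix Q assume Q: "Q \<in> F"
    have "\<bar>(Q *v (f - g)) $ x\<bar> \<le> B * infnorm (f - g)" by (rule bound[OF Q])
    then show "Qlow g $ x - B * infnorm (f - g) \<le> (Q *v f) $ x"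
      using Qlow_le[OF Q, of g x] by (simp add: matrix_vector_mult_diff_distrib)
  qed
  from this[of g _ f] this[of f _ g] show ?thesis
    unfolding infnorm_le_iff by (simp add: abs_le_iff algebra_simps infnorm_sub[of g f])
qed

lemma Qlow_zero: "Qlow 0 = 0"
  unfolding lower_rate_def using nonempty by (simp add: vec_eq_iff)

lemma Qlow_infnorm: "infnorm (Qlow f) \<le> B * infnorm f"
  using Qlow_lipschitz[of f 0] by (simp add: Qlow_zero)

lemma Qlow_scale_le:
  assumes "c \<ge> 0"
  shows "c * Qlow f $ x \<le> Qlow (c *\<^sub>R f) $ x"
proof (rule Qlow_ge)
  fix Q assume "Q \<in> F"
  from Qlow_le[OF this, of f x] assms show "c * Qlow f $ x \<le> (Q *v (c *\<^sub>R f)) $ x"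
    by (simp add: matrix_vector_mult_scaleR mult_left_mono)
qed

lemma Qlow_scale:
  assumes "c \<ge> 0"
  shows "Qlow (c *\<^sub>R f) = c *\<^sub>R Qlow f"
proof (cases "c = 0")
  case True then show ?thesis by (simp add: Qlow_zero)
next
  case False
  have "Qlow (c *\<^sub>R f) $ x = c * Qlow f $ x" for x
  proof (rule antisym)
    have "(1 / c) * Qlow (c *\<^sub>R f) $ x \<le> Qlow ((1/c) *\<^sub>R (c *\<^sub>R f)) $ x"
      by (rule Qlow_scale_le) (use assms in simp)
    then show "Qlow (c *\<^sub>R f) $ x \<le> c * Qlow f $ x" using False assms by (simp add: field_simps)
    show "c * Qlow f $ x \<le> Qlow (c *\<^sub>R f) $ x" using Qlow_scale_le[OF assms] .
  qed
  then show ?thesis by (simp add: vec_eq_iff)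
qed

text \<open>Rows sum to zero, so the constant c may be subtracted from f. The off-diagonal terms are
  then non-negative, and the diagonal entry is at least -B.\<close>

lemma rate_ge_at_lower_bound:
  assumes "Q \<in> F" "\<And>y. c \<le> f $ y"
  shows "- B * (f $ x - c) \<le> (Q *v f) $ x"
proof -
  have Q: "(\<Sum>y\<in>UNIV. Q $ x $ y) = 0" "\<And>y. y \<noteq> x \<Longrightarrow> Q $ x $ y \<ge> 0"
    using assms(1) rates unfolding rate_matrices_def by auto
  have "(Q *v f) $ x = (\<Sum>y\<in>UNIV. Q $ x $ y * (f $ y - c))"
    unfolding matrix_vector_mult_def right_diff_distrib sum_subtractf sum_distrib_right[symmetric] Q
    by simp
  also have "\<dots> = Q $ x $ x * (f $ x - c) + (\<Sum>y\<in>UNIV - {x}. Q $ x $ y * (f $ y - c))"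
    by (simp add: sum.remove)
  finally have "(Q *v f) $ x \<ge> Q $ x $ x * (f $ x - c)"
    using sum_nonneg[of "UNIV - {x}" "\<lambda>y. Q $ x $ y * (f $ y - c)"] Q(2) assms(2) by simp
  moreover have "Q $ x $ x * (f $ x - c) \<ge> - B * (f $ x - c)"
    using entry_bound[OF assms(1), of x x] assms(2)[of x] by (intro mult_right_mono) auto
  ultimately show ?thesis by linarith
qed

text \<open>The condition d * B \<le> 1 keeps an explicit Euler step from undershooting the minimum
  of f: at x the value drops by at most d * B times its distance to that minimum.\<close>

lemma lower_transition_euler:
  assumes "0 \<le> d" "d * B \<le> 1"
  shows "lower_transition_operator (euler Qlow d)"
  unfolding lower_transition_operator_def
proof (intro conjI allI impI)
  fix f :: "real^'x" and x
  let ?c = "Min (range (($) f))"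
  have c: "?c \<le> f $ y" for y by simp
  have "- B * (f $ x - ?c) \<le> Qlow f $ x" by (intro Qlow_ge rate_ge_at_lower_bound c)
  then have "d * (- B * (f $ x - ?c)) \<le> d * Qlow f $ x" using assms(1) by (rule mult_left_mono)
  moreover have "(d * B) * (f $ x - ?c) \<le> 1 * (f $ x - ?c)"
    by (rule mult_right_mono) (use assms(2) c in auto)
  ultimately show "?c \<le> euler Qlow d f $ x" by (simp add: euler_def algebra_simps)
next
  fix f g :: "real^'x" and x
  have "Qlow f $ x + Qlow g $ x \<le> Qlow (f + g) $ x"
  proof (rule Qlow_ge)
    fix Q assume "Q \<in> F"
    from Qlow_le[OF this, of f x] Qlow_le[OF this, of g x]
    show "Qlow f $ x + Qlow g $ x \<le> (Q *v (f + g)) $ x"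
      by (simp add: matrix_vector_right_distrib)
  qed
  from mult_left_mono[OF this assms(1)]
  show "euler Qlow d f $ x + euler Qlow d g $ x \<le> euler Qlow d (f + g) $ x"
    by (simp add: euler_def algebra_simps)
next
  fix c :: real and f :: "real^'x" assume "0 \<le> c"
  then show "euler Qlow d (c *\<^sub>R f) = c *\<^sub>R euler Qlow d f"
    by (simp add: euler_def Qlow_scale algebra_simps)
qed

section \<open>Error estimates for iterated Euler steps\<close>

lemma lower_transition_euler_funpow:
  "0 \<le> d \<Longrightarrow> d * B \<le> 1 \<Longrightarrow> lower_transition_operator (euler Qlow d ^^ k)"
  by (intro lower_transition_funpow lower_transition_euler)

lemma euler_diff:
  assumes "0 \<le> d"
  shows "infnorm (euler Qlow d f - f) \<le> d * B * infnorm f"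
  using mult_left_mono[OF Qlow_infnorm assms, of f] assms
  by (simp add: euler_def infnorm_mul algebra_simps)

lemma euler_funpow_diff:
  assumes d: "0 \<le> d" "d * B \<le> 1"
  shows "infnorm ((euler Qlow d ^^ k) f - f) \<le> real k * d * B * infnorm f"
proof (induction k)
  case 0 then show ?case by (simp add: infnorm_0)
next
  case (Suc k)
  let ?g = "(euler Qlow d ^^ k) f"
  have "infnorm (euler Qlow d ?g - ?g) \<le> d * B * infnorm ?g" by (rule euler_diff[OF d(1)])
  also have "\<dots> \<le> d * B * infnorm f"
    using lower_transition_infnorm_le[OF lower_transition_euler_funpow[OF d]]
      d B_nonneg by (intro mult_left_mono) auto
  finally show ?case using infnorm_triangle_diff[of "euler Qlow d ?g" f ?g] Suc
    by (simp add: algebra_simps)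
qed

text \<open>Each step uses \<open>Qlow\<close> at the current iterate instead of at f; by the
  Lipschitz bound the k-th such replacement costs about k (d B)^2. The sum is estimated by a square,
  through k^2 + k \<le> (k + 1)^2. The bound depends on the elapsed time k * d only and so survives
  the limit d \<rightarrow> 0.\<close>

lemma euler_funpow_approx:
  assumes d: "0 \<le> d" "d * B \<le> 1"
  shows "infnorm ((euler Qlow d ^^ k) f - f - (real k * d) *\<^sub>R Qlow f) \<le> (real k * d * B)\<^sup>2 * infnorm f"
proof (induction k)
  case 0 then show ?case by (simp add: infnorm_0)
next
  case (Suc k)
  let ?g = "(euler Qlow d ^^ k) f"
  have *: "euler Qlow d ?g - f - (real (Suc k) * d) *\<^sub>R Qlow f =
      (?g - f - (real k * d) *\<^sub>R Qlow f) + d *\<^sub>R (Qlow ?g - Qlow f)"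
    by (simp add: euler_def algebra_simps)
  have "infnorm (d *\<^sub>R (Qlow ?g - Qlow f)) \<le> d * (B * infnorm (?g - f))"
    using d Qlow_lipschitz by (simp add: infnorm_mul mult_left_mono)
  also have "\<dots> \<le> d * (B * (real k * d * B * infnorm f))"
    using d B_nonneg euler_funpow_diff[OF d] by (intro mult_left_mono) auto
  finally have "infnorm (euler Qlow d ?g - f - (real (Suc k) * d) *\<^sub>R Qlow f) \<le>
      (real k * d * B)\<^sup>2 * infnorm f + d * (B * (real k * d * B * infnorm f))"
    unfolding * using Suc infnorm_triangle by (smt (verit))
  also have "\<dots> = (real k * real k + real k) * ((d * B)\<^sup>2 * infnorm f)"
    by (simp add: power2_eq_square algebra_simps)
  also have "\<dots> \<le> (real (Suc k) * real (Suc k)) * ((d * B)\<^sup>2 * infnorm f)"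
    by (intro mult_right_mono) (auto simp: infnorm_pos_le algebra_simps)
  also have "\<dots> = (real (Suc k) * d * B)\<^sup>2 * infnorm f"
    by (simp add: power2_eq_square algebra_simps)
  finally show ?case by simp
qed

text \<open>One coarse step differs from two fine steps by the case of two steps in
  \<open>euler_funpow_approx\<close>. Since all operators are nonexpansive, the k local errors
  add.\<close>

lemma euler_refine:
  assumes d: "0 \<le> d" "2 * d * B \<le> 1"
  shows "infnorm ((euler Qlow (2 * d) ^^ k) f - (euler Qlow d ^^ (2 * k)) f) \<le>
    real k * (2 * d * B)\<^sup>2 * infnorm f"
proof (induction k)
  case 0 then show ?case by (simp add: infnorm_0)
next
  case (Suc k)
  let ?S = "euler Qlow (2 * d)" and ?T = "euler Qlow d"
  have d': "d * B \<le> 1" using d B_nonneg mult_nonneg_nonneg[of d B] by simp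
  let ?g = "(?T ^^ (2 * k)) f"
  have "infnorm (?S ((?S ^^ k) f) - ?S ?g) \<le> infnorm ((?S ^^ k) f - ?g)"
    using d by (intro lower_transition_nonexpansive lower_transition_euler) auto
  moreover have "infnorm (?T (?T ?g) - ?S ?g) \<le> (2 * d * B)\<^sup>2 * infnorm f"
  proof -
    have "?T (?T ?g) - ?S ?g = (?T ^^ 2) ?g - ?g - (real 2 * d) *\<^sub>R Qlow ?g"
      by (simp add: numeral_2_eq_2 euler_def[of _ "2 * d"] euler_def[of _ "d * 2"])
    moreover have "infnorm ((?T ^^ 2) ?g - ?g - (real 2 * d) *\<^sub>R Qlow ?g) \<le> (real 2 * d * B)\<^sup>2 * infnorm ?g"
      by (rule euler_funpow_approx[OF d(1) d'])
    moreover have "(2 * d * B)\<^sup>2 * infnorm ?g \<le> (2 * d * B)\<^sup>2 * infnorm f"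
      by (intro mult_left_mono lower_transition_infnorm_le
          lower_transition_euler_funpow d d') auto
    ultimately show ?thesis by simp
  qed
  ultimately have "infnorm (?S ((?S ^^ k) f) - ?T (?T ?g)) \<le>
      real k * (2 * d * B)\<^sup>2 * infnorm f + (2 * d * B)\<^sup>2 * infnorm f"
    using Suc infnorm_triangle_diff[of "?S ((?S ^^ k) f)" "?T (?T ?g)" "?S ?g"]
    by (simp only: infnorm_sub[of "?S ?g" "?T (?T ?g)"])
  then show ?case by (simp add: distrib_right)
qed

section \<open>The dyadic limit of Euler products\<close>

definition dyadic_approx :: "nat \<Rightarrow> real \<Rightarrow> real^'x \<Rightarrow> real^'x" where
  "dyadic_approx n a = euler Qlow (1 / 2 ^ n) ^^ dyadic n a"

text \<open>\<open>lim\<close> has a meaning for a \<ge> 0 by \<open>dyadic_approx_tendsto\<close>;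
  \<open>lower_trans_eq\<close> identifies the result with the operators of the theorem.\<close>

definition semigroup :: "real \<Rightarrow> real^'x \<Rightarrow> real^'x" where
  "semigroup a f = lim (\<lambda>n. dyadic_approx n a f)"

lemma fine_steps: "\<exists>n0. \<forall>n\<ge>n0. 1 / 2 ^ n * B \<le> 1"
proof -
  have "(\<lambda>n. 1 / 2 ^ n * B) \<longlonglongrightarrow> 0" using tendsto_mult_left_zero[OF tendsto_inverse_two_power] .
  then have "\<forall>\<^sub>F n in sequentially. 1 / 2 ^ n * B < 1" by (rule order_tendstoD) simp
  then show ?thesis unfolding eventually_sequentially by (meson less_imp_le)
qed

text \<open>Two sources of error: halving the steps, which costs a * B^2 over the whole interval,
  and the possible extra step caused by rounding, which costs B. Both carry the factor 2^-n, so the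
  sequence is Cauchy.\<close>

lemma dyadic_approx_step:
  assumes "a \<ge> 0" "1 / 2 ^ n * B \<le> 1"
  shows "infnorm (dyadic_approx (Suc n) a f - dyadic_approx n a f) \<le> (a * B\<^sup>2 + B) * infnorm f * (1/2)^n"
proof -
  let ?d = "1 / 2 ^ Suc n :: real" and ?k = "dyadic n a"
  have dB: "2 * ?d * B \<le> 1" "0 \<le> ?d" "?d * B \<le> 1" using assms(2) B_nonneg by (auto simp: field_simps)
  let ?g = "(euler Qlow ?d ^^ (2 * ?k)) f"
  have g: "infnorm ?g \<le> infnorm f"
    by (intro lower_transition_infnorm_le lower_transition_euler_funpow dB)
  have "infnorm (dyadic_approx (Suc n) a f - ?g) \<le> ?d * B * infnorm f"
    using dyadic_Suc[OF assms(1), of n]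
  proof
    assume "dyadic (Suc n) a = 2 * dyadic n a"
    then show ?thesis using B_nonneg
      by (simp add: dyadic_approx_def infnorm_0 infnorm_pos_le)
  next
    assume *: "dyadic (Suc n) a = Suc (2 * dyadic n a)"
    have "infnorm (euler Qlow ?d ?g - ?g) \<le> ?d * B * infnorm ?g" by (rule euler_diff[OF dB(2)])
    also have "\<dots> \<le> ?d * B * infnorm f" by (intro mult_left_mono g) (use B_nonneg in auto)
    finally show ?thesis using * by (simp add: dyadic_approx_def)
  qed
  also have "\<dots> \<le> B * infnorm f * (1/2)^n"
  proof -
    have "B * infnorm f * ?d \<le> B * infnorm f * (1/2)^n"
      by (intro mult_left_mono) (use B_nonneg infnorm_pos_le[of f] in \<open>auto simp: field_simps intro: mult_nonneg_nonneg\<close>)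
    then show ?thesis by (simp add: algebra_simps)
  qed
  finally have 1: "infnorm (dyadic_approx (Suc n) a f - ?g) \<le> B * infnorm f * (1/2)^n" .
  have "infnorm ((euler Qlow (2 * ?d) ^^ ?k) f - ?g) \<le> real ?k * (2 * ?d * B)\<^sup>2 * infnorm f"
    by (rule euler_refine) (use dB in auto)
  also have "\<dots> = (real ?k / 2 ^ n) * (B\<^sup>2 * infnorm f * (1/2)^n)"
    by (simp add: power2_eq_square field_simps)
  also have "\<dots> \<le> a * (B\<^sup>2 * infnorm f * (1/2)^n)"
    by (intro mult_right_mono dyadic_bounds assms) (simp add: infnorm_pos_le)
  finally have 2: "infnorm (?g - dyadic_approx n a f) \<le> a * (B\<^sup>2 * infnorm f * (1/2)^n)"
    by (simp add: dyadic_approx_def infnorm_sub)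
  show ?thesis using infnorm_triangle_diff[of "dyadic_approx (Suc n) a f" "dyadic_approx n a f" ?g] 1 2
    by (simp add: algebra_simps)
qed

lemma dyadic_approx_tendsto:
  assumes "a \<ge> 0"
  shows "(\<lambda>n. dyadic_approx n a f) \<longlonglongrightarrow> semigroup a f"
proof -
  obtain n0 where n0: "\<And>n. n \<ge> n0 \<Longrightarrow> 1 / 2 ^ n * B \<le> 1" using fine_steps by blast
  let ?X = "\<lambda>n. dyadic_approx n a f"
  let ?C = "sqrt (real DIM(real^'x)) * ((a * B\<^sup>2 + B) * infnorm f)"
  have "summable (\<lambda>n. ?X (Suc n) - ?X n)"
  proof (rule summable_comparison_test)
    show "summable (\<lambda>n. ?C * (1/2)^n)" by (intro summable_mult summable_geometric) simp
    show "\<exists>N. \<forall>n\<ge>N. norm (?X (Suc n) - ?X n) \<le> ?C * (1/2)^n"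
    proof (intro exI allI impI)
      fix n assume "n0 \<le> n"
      have "norm (?X (Suc n) - ?X n) \<le> sqrt (real DIM(real^'x)) * infnorm (?X (Suc n) - ?X n)"
        by (rule norm_le_infnorm)
      also have "\<dots> \<le> sqrt (real DIM(real^'x)) * ((a * B\<^sup>2 + B) * infnorm f * (1/2)^n)"
        by (intro mult_left_mono dyadic_approx_step assms n0) (use \<open>n0 \<le> n\<close> in auto)
      finally show "norm (?X (Suc n) - ?X n) \<le> ?C * (1/2)^n" by (simp add: mult.assoc)
    qed
  qed
  then have "convergent (\<lambda>m. \<Sum>n<m. ?X (Suc n) - ?X n)" by (simp add: summable_iff_convergent)
  then have "convergent (\<lambda>m. ?X m - ?X 0)" by (simp add: sum_lessThan_telescope[of ?X])
  then have "convergent (\<lambda>m. (?X m - ?X 0) + ?X 0)" by (intro convergent_add convergent_const)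
  then have "convergent ?X" by simp
  then show ?thesis unfolding semigroup_def by (simp add: convergent_LIMSEQ_iff)
qed

lemma lower_transition_dyadic_approx:
  "1 / 2 ^ n * B \<le> 1 \<Longrightarrow> lower_transition_operator (dyadic_approx n a)"
  unfolding dyadic_approx_def by (intro lower_transition_euler_funpow) auto

lemma lower_transition_semigroup:
  assumes "a \<ge> 0"
  shows "lower_transition_operator (semigroup a)"
proof -
  obtain n0 where n0: "\<And>n. n \<ge> n0 \<Longrightarrow> 1 / 2 ^ n * B \<le> 1" using fine_steps by blast
  show ?thesis
  proof (rule lower_transition_limit[where T = "\<lambda>n. dyadic_approx (n + n0) a"])
    show "(\<lambda>n. dyadic_approx (n + n0) a f) \<longlonglongrightarrow> semigroup a f" for f
      using dyadic_approx_tendsto[OF assms] by (rule LIMSEQ_ignore_initial_segment)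
  qed (intro lower_transition_dyadic_approx n0, simp)
qed

lemma eventually_fine: "\<forall>\<^sub>F n in sequentially. 1 / 2 ^ n * B \<le> 1"
  using fine_steps by (auto simp: eventually_sequentially)

text \<open>The limit of \<open>euler_funpow_approx\<close> for \<open>dyadic n a\<close> steps of
  length 2^-n. It says that \<open>Qlow\<close> is the derivative at 0, with a quadratic
  remainder.\<close>

lemma semigroup_approx:
  assumes "a \<ge> 0"
  shows "infnorm (semigroup a f - f - a *\<^sub>R Qlow f) \<le> (a * B)\<^sup>2 * infnorm f"
proof (rule infnorm_le_limit)
  show "(\<lambda>n. dyadic_approx n a f - f - (real (dyadic n a) / 2 ^ n) *\<^sub>R Qlow f)
    \<longlonglongrightarrow> semigroup a f - f - a *\<^sub>R Qlow f"
    by (intro tendsto_intros dyadic_approx_tendsto dyadic_tendsto assms)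
  show "(\<lambda>n. (real (dyadic n a) / 2 ^ n * B)\<^sup>2 * infnorm f) \<longlonglongrightarrow> (a * B)\<^sup>2 * infnorm f"
    by (intro tendsto_intros dyadic_tendsto assms)
  show "\<forall>\<^sub>F n in sequentially.
      infnorm (dyadic_approx n a f - f - (real (dyadic n a) / 2 ^ n) *\<^sub>R Qlow f)
        \<le> (real (dyadic n a) / 2 ^ n * B)\<^sup>2 * infnorm f"
    using eventually_fine
  proof eventually_elim
    case (elim n)
    then show ?case using euler_funpow_approx[of "1 / 2 ^ n" "dyadic n a" f]
      by (simp add: dyadic_approx_def)
  qed
qed

text \<open>At level n both sides are powers of the same Euler step, up to one step of rounding;
  replacing the inner approximation by its limit costs no more than its distance to it, because the
  outer one is nonexpansive.\<close>

lemma semigroup_add: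
  assumes "a \<ge> 0" "b \<ge> 0"
  shows "semigroup (a + b) f = semigroup a (semigroup b f)"
proof -
  let ?X = "\<lambda>n. dyadic_approx n (a + b) f - dyadic_approx n a (semigroup b f)"
  \<comment> \<open>The right-hand side equals 0; it keeps the shape of the error bound so that the
    limit rules produce it directly.\<close>
  have "infnorm (semigroup (a + b) f - semigroup a (semigroup b f)) \<le> 0 * B * infnorm f + infnorm (semigroup b f - semigroup b f)"
  proof (rule infnorm_le_limit)
    show "?X \<longlonglongrightarrow> semigroup (a + b) f - semigroup a (semigroup b f)"
      by (intro tendsto_intros dyadic_approx_tendsto) (use assms in auto)
    show "(\<lambda>n. 1 / 2 ^ n * B * infnorm f + infnorm (dyadic_approx n b f - semigroup b f))
      \<longlonglongrightarrow> 0 * B * infnorm f + infnorm (semigroup b f - semigroup b f)"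
      by (intro tendsto_intros tendsto_inverse_two_power dyadic_approx_tendsto assms)
    show "\<forall>\<^sub>F n in sequentially. infnorm (?X n) \<le>
        1 / 2 ^ n * B * infnorm f + infnorm (dyadic_approx n b f - semigroup b f)"
      using eventually_fine
    proof eventually_elim
      case (elim n)
      let ?T = "euler Qlow (1 / 2 ^ n)"
      let ?g = "(?T ^^ (dyadic n a + dyadic n b)) f"
      have ag: "?g = dyadic_approx n a (dyadic_approx n b f)"
        by (simp add: dyadic_approx_def funpow_add)
      have g: "infnorm ?g \<le> infnorm f"
        by (intro lower_transition_infnorm_le lower_transition_euler_funpow)
          (use elim in auto)
      have "infnorm (dyadic_approx n (a + b) f - ?g) \<le> 1 / 2 ^ n * B * infnorm f"
        using dyadic_add[OF assms, of n]
      proof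
        assume "dyadic n (a + b) = dyadic n a + dyadic n b"
        then show ?thesis using B_nonneg by (simp add: dyadic_approx_def infnorm_0 infnorm_pos_le)
      next
        assume *: "dyadic n (a + b) = Suc (dyadic n a + dyadic n b)"
        have "infnorm (?T ?g - ?g) \<le> 1 / 2 ^ n * B * infnorm ?g" by (rule euler_diff) auto
        also have "\<dots> \<le> 1 / 2 ^ n * B * infnorm f" by (intro mult_left_mono g) (use B_nonneg in auto)
        finally show ?thesis using * by (simp add: dyadic_approx_def)
      qed
      moreover have "infnorm (?g - dyadic_approx n a (semigroup b f)) \<le> infnorm (dyadic_approx n b f - semigroup b f)"
        unfolding ag by (intro lower_transition_nonexpansive
            lower_transition_dyadic_approx elim)
      ultimately show ?case
        using infnorm_triangle_diff[of "dyadic_approx n (a + b) f" "dyadic_approx n a (semigroup b f)" ?g]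
        by linarith
    qed
  qed
  then show ?thesis by (simp add: infnorm_0 infnorm_le_iff vec_eq_iff)
qed

lemma semigroup_0: "semigroup 0 f = f"
  using semigroup_approx[of 0 f] by (simp add: infnorm_le_iff vec_eq_iff)

text \<open>A cell of length s - t has local error ((s - t) B)^2 \<le> (s - t) d B^2. The operators
  are nonexpansive, so these errors add, and the lengths sum to that of the interval.\<close>

lemma grid_operator_approx:
  assumes "v \<noteq> []" "sorted_wrt (<) v" "successively (\<lambda>r s. s - r \<le> d) v" "d * B \<le> 1"
  shows "infnorm (semigroup (last v - hd v) f - grid_operator Qlow v f)
    \<le> (last v - hd v) * d * B\<^sup>2 * infnorm f"
  using assms
proof (induction Qlow v rule: grid_operator.induct)
  case (1 t s v)
  let ?b = "last (s # v) - s"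
  have ts: "t < s" "s \<le> last (s # v)" "s - t \<le> d" using 1(3,4)
    by (auto simp: less_imp_le)
  have dd: "(s - t) * B \<le> 1" using mult_right_mono[OF ts(3) B_nonneg] 1(5) by simp
  have IH: "infnorm (semigroup ?b f - grid_operator Qlow (s # v) f) \<le> ?b * d * B\<^sup>2 * infnorm f"
    using 1 by auto
  let ?T = "euler Qlow (s - t)"
  let ?g = "semigroup ?b f"
  have g: "infnorm ?g \<le> infnorm f"
    using ts by (intro lower_transition_infnorm_le lower_transition_semigroup) auto
  have sg: "semigroup (last (t # s # v) - hd (t # s # v)) f = semigroup (s - t) ?g"
    using semigroup_add[of "s - t" ?b f] ts by simp
  have go: "grid_operator Qlow (t # s # v) f = ?T (grid_operator Qlow (s # v) f)"
    by (simp add: euler_def)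
  have "infnorm (?T ?g - ?T (grid_operator Qlow (s # v) f)) \<le> infnorm (?g - grid_operator Qlow (s # v) f)"
    using ts dd by (intro lower_transition_nonexpansive lower_transition_euler) auto
  moreover have "infnorm (semigroup (s - t) ?g - ?T ?g) \<le> (s - t) * d * B\<^sup>2 * infnorm f"
  proof -
    have "semigroup (s - t) ?g - ?T ?g = semigroup (s - t) ?g - ?g - (s - t) *\<^sub>R Qlow ?g"
      by (simp add: euler_def)
    then have "infnorm (semigroup (s - t) ?g - ?T ?g) \<le> ((s - t) * B)\<^sup>2 * infnorm ?g"
      using semigroup_approx[of "s - t" ?g] ts(1) by (simp only: diff_ge_0_iff_ge less_imp_le)
    also have "\<dots> = (s - t) * (s - t) * (B\<^sup>2 * infnorm ?g)" by (simp add: power2_eq_square)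
    also have "\<dots> \<le> (s - t) * d * (B\<^sup>2 * infnorm f)"
      using ts g by (intro mult_mono) (auto simp: infnorm_pos_le)
    finally show ?thesis by simp
  qed
  ultimately show ?case unfolding sg go
    using infnorm_triangle_diff[of "semigroup (s - t) ?g" "?T (grid_operator Qlow (s # v) f)" "?T ?g"] IH
    by (simp add: algebra_simps)
qed (auto simp: semigroup_0 infnorm_0)

lemma lower_transition_grid:
  assumes "successively (\<lambda>r s. s - r \<le> d) v" "sorted_wrt (<) v" "d * B \<le> 1"
  shows "lower_transition_operator (grid_operator Qlow v)"
  using assms
proof (induction Qlow v rule: grid_operator.induct)
  case (1 t s v)
  have "(s - t) * B \<le> d * B" using 1 B_nonneg by (intro mult_right_mono) auto
  then have "lower_transition_operator (euler Qlow (s - t))"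
    using 1 by (intro lower_transition_euler) auto
  moreover have "lower_transition_operator (grid_operator Qlow (s # v))" using 1 by auto
  ultimately show ?case using lower_transition_compose unfolding euler_def by fastforce
qed (auto simp: lower_transition_id id_def[symmetric])

lemma mesh_successively:
  assumes "mesh v \<le> d"
  shows "successively (\<lambda>r s. s - r \<le> d) v"
proof (cases "length v \<le> 1")
  case True
  then show ?thesis by (cases v) (auto)
next
  case False
  have "v ! Suc i - v ! i \<le> d" if "Suc i < length v" for i
  proof -
    have "v ! Suc i - v ! i \<le> Max ((\<lambda>i. v ! Suc i - v ! i) ` {..<length v - 1})"
      by (rule Max_ge) (use that in auto)
    then show ?thesis using assms False by (simp add: mesh_def)
  qed
  then show ?thesis
  proof (induction v)
    case (Cons a v)
    have "successively (\<lambda>r s. s - r \<le> d) v" using Cons(1) Cons(2)[of "Suc _"] by auto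
    then show ?case using Cons(2)[of 0] by (cases v) auto
  qed simp
qed

text \<open>Uniqueness of the limit depends on this: if no grid had small mesh, the limit condition
  would be vacuous.\<close>

lemma fine_grid_exists:
  assumes "t \<le> s" "d > 0"
  shows "\<exists>v\<in>grids t s. mesh v \<le> d"
proof (cases "t = s")
  case True
  then show ?thesis using assms by (intro bexI[of _ "[t]"]) (auto simp: grids_def mesh_def)
next
  case False
  then have ts: "t < s" using assms by simp
  obtain m :: nat where m: "(s - t) / d < real m" using reals_Archimedean2 by blast
  then have m0: "m > 0" using ts assms(2)
    by (metis divide_pos_pos diff_gt_0_iff_gt gr0I not_less_iff_gr_or_eq of_nat_0 order_less_trans)
  let ?p = "\<lambda>i. t + real i * ((s - t) / real m)"
  let ?v = "map ?p [0..<Suc m]"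
  have nth: "?v ! i = ?p i" if "i \<le> m" for i using that by (auto simp del: upt_Suc)
  have "sorted_wrt (<) ?v" unfolding sorted_wrt_iff_nth_less using ts m0
    by (auto simp: nth simp del: upt_Suc intro!: divide_strict_right_mono mult_strict_right_mono)
  moreover have "hd ?v = t" by (simp add: hd_map del: upt_Suc)
  moreover have "last ?v = s" using m0 by simp
  ultimately have "?v \<in> grids t s" by (auto simp: grids_def)
  moreover have "mesh ?v \<le> d"
  proof -
    have "(s - t) / real m \<le> d" using m m0 assms(2) by (simp add: field_simps)
    moreover have "?p (Suc i) - ?p i = (s - t) / real m" for i
      unfolding of_nat_Suc distrib_right by simp
    ultimately have "?v ! Suc i - ?v ! i \<le> d" if "i < m" for i
      using that nth[of i] nth[of "Suc i"] by (simp del: upt_Suc)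
    then have "x \<le> d" if "x \<in> (\<lambda>i. ?v ! Suc i - ?v ! i) ` {..<m}" for x using that by blast
    then have "Max ((\<lambda>i. ?v ! Suc i - ?v ! i) ` {..<m}) \<le> d" using m0 by (intro Max.boundedI) blast+
    moreover have "length ?v = Suc m" by simp
    ultimately show ?thesis unfolding mesh_def using assms(2) by (simp only: diff_Suc_1 if_split) simp
  qed
  ultimately show ?thesis by blast
qed

text \<open>Existence is \<open>grid_operator_approx\<close>. For uniqueness, two candidates are
  both close to the operator of one common fine grid.\<close>

lemma lower_trans_eq:
  assumes "t \<le> s"
  shows "lower_trans Qlow t s = semigroup (s - t)"
  unfolding lower_trans_def
proof (rule the_equality)
  let ?lim = "\<lambda>L. \<forall>\<epsilon>>0. \<exists>\<delta>>0. \<forall>v\<in>grids t s. mesh v \<le> \<delta> \<longrightarrow>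
        op_norm (\<lambda>f. L f - grid_operator Qlow v f) \<le> \<epsilon>"
  have S: "lower_transition_operator (semigroup (s - t))"
    using assms by (intro lower_transition_semigroup) simp
  have dB: "d * B \<le> 1" if "d \<le> 1 / (1 + B)" for d
  proof -
    have "d * B \<le> 1 / (1 + B) * B" using that B_nonneg by (rule mult_right_mono)
    also have "\<dots> \<le> 1" using B_nonneg by (simp add: field_simps)
    finally show ?thesis .
  qed
  have slim: "?lim (semigroup (s - t))"
  proof (intro allI impI)
    fix e :: real assume e: "e > 0"
    \<comment> \<open>The first term keeps all Euler steps lower transition operators, the second
      makes the grid error at most e; the added 1 avoids a zero denominator.\<close>
    let ?d = "min (1 / (1 + B)) (e / ((s - t) * B\<^sup>2 + 1))"
    have K: "(s - t) * B\<^sup>2 \<ge> 0" using assms by simp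
    have d: "?d > 0" using e B_nonneg K by auto
    have "op_norm (\<lambda>f. semigroup (s - t) f - grid_operator Qlow v f) \<le> e"
      if v: "v \<in> grids t s" "mesh v \<le> ?d" for v
    proof (rule op_norm_le)
      fix f :: "real^'x" assume f: "infnorm f = 1"
      have "infnorm (semigroup (s - t) f - grid_operator Qlow v f) \<le> (s - t) * ?d * B\<^sup>2 * infnorm f"
        using grid_operator_approx[of v ?d f] v f dB[of ?d] mesh_successively[OF v(2)]
        by (simp add: grids_def)
      also have "\<dots> = ((s - t) * B\<^sup>2) * ?d" using f by simp
      also have "\<dots> \<le> ((s - t) * B\<^sup>2) * (e / ((s - t) * B\<^sup>2 + 1))"
        using K by (intro mult_left_mono) auto
      also have "\<dots> \<le> e" using K e by (simp add: field_simps)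
      finally show "infnorm (semigroup (s - t) f - grid_operator Qlow v f) \<le> e" .
    qed
    then show "\<exists>\<delta>>0. \<forall>v\<in>grids t s. mesh v \<le> \<delta> \<longrightarrow>
        op_norm (\<lambda>f. semigroup (s - t) f - grid_operator Qlow v f) \<le> e" using d by blast
  qed
  show "lower_transition_operator (semigroup (s - t)) \<and> ?lim (semigroup (s - t))" using S slim by blast
  fix L assume L: "lower_transition_operator L \<and> ?lim L"
  \<comment> \<open>To read a pointwise estimate off \<open>op_norm\<close>, its supremum must be
    finite. The difference of two lower transition operators is bounded by 2 on the unit
    sphere.\<close>
  have pt: "infnorm (K f - grid_operator Qlow v f) \<le> e"
    if K: "lower_transition_operator K" and v: "v \<in> grids t s" "mesh v \<le> 1 / (1 + B)"
      and le: "op_norm (\<lambda>f. K f - grid_operator Qlow v f) \<le> e" and f: "infnorm f = 1" for K v e f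
  proof -
    have G: "lower_transition_operator (grid_operator Qlow v)"
      using lower_transition_grid[OF mesh_successively[OF v(2)]] v(1) dB[OF order_refl]
      by (auto simp: grids_def)
    have "infnorm (K f - grid_operator Qlow v f) \<le> op_norm (\<lambda>f. K f - grid_operator Qlow v f)"
    proof (rule infnorm_le_op_norm[OF _ f])
      fix g :: "real^'x" assume "infnorm g = 1"
      then show "infnorm (K g - grid_operator Qlow v g) \<le> 2"
        using lower_transition_infnorm_le[OF K, of g]
          lower_transition_infnorm_le[OF G, of g]
          infnorm_triangle_diff[of "K g" "grid_operator Qlow v g" 0] by (simp add: infnorm_neg)
    qed
    then show ?thesis using le by simp
  qed
  have eq1: "L f = semigroup (s - t) f" if f: "infnorm f = 1" for f
  proof -
    have "infnorm (L f - semigroup (s - t) f) \<le> 0 + e" if e: "e > 0" for e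
    proof -
      have e2: "e / 2 > 0" using e by simp
      obtain d1 where d1: "d1 > 0" "\<And>v. v \<in> grids t s \<Longrightarrow> mesh v \<le> d1 \<Longrightarrow>
          op_norm (\<lambda>f. L f - grid_operator Qlow v f) \<le> e / 2" using L e2 by blast
      obtain d2 where d2: "d2 > 0" "\<And>v. v \<in> grids t s \<Longrightarrow> mesh v \<le> d2 \<Longrightarrow>
          op_norm (\<lambda>f. semigroup (s - t) f - grid_operator Qlow v f) \<le> e / 2" using slim e2 by blast
      obtain v where v: "v \<in> grids t s" "mesh v \<le> min (1 / (1 + B)) (min d1 d2)"
        using fine_grid_exists[OF assms, of "min (1 / (1 + B)) (min d1 d2)"] d1 d2 B_nonneg by auto
      have "infnorm (L f - grid_operator Qlow v f) \<le> e / 2"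
        using v d1 L by (intro pt[OF _ _ _ _ f]) auto
      moreover have "infnorm (semigroup (s - t) f - grid_operator Qlow v f) \<le> e / 2"
        using v d2 S by (intro pt[OF _ _ _ _ f]) auto
      ultimately show ?thesis
        using infnorm_triangle_diff[of "L f" "semigroup (s - t) f" "grid_operator Qlow v f"]
        by (simp add: infnorm_sub)
    qed
    then have "infnorm (L f - semigroup (s - t) f) \<le> 0" by (rule field_le_epsilon)
    then show ?thesis by (simp add: infnorm_le_iff vec_eq_iff)
  qed
  \<comment> \<open>\<open>op_norm\<close> tests unit vectors; non-negative homogeneity extends the
    equality to all f.\<close>
  show "L = semigroup (s - t)"
  proof
    fix f
    show "L f = semigroup (s - t) f"
    proof (cases "f = 0")
      case True then show ?thesis using L S by (simp add: lower_transition_zero)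
    next
      case False
      then have p: "infnorm f > 0" by (simp add: infnorm_pos_lt)
      let ?h = "(1 / infnorm f) *\<^sub>R f"
      have "infnorm ?h = 1" using p by (simp add: infnorm_mul)
      then have "L ?h = semigroup (s - t) ?h" by (rule eq1)
      then show ?thesis using L S p by (simp add: lower_transition_scale)
    qed
  qed
qed

end

section \<open>Coherence\<close>

text \<open>A total gain depends on a path only through the finitely many events that contain it.
  Finiteness of the set of gains is what allows reasoning with \<open>Max\<close>.\<close>

lemma finite_image_indicators:
  assumes "finite I"
    and "\<And>\<omega> \<omega>'. \<lbrakk>\<And>i. i \<in> I \<Longrightarrow> (\<omega> \<in> A i \<longleftrightarrow> \<omega>' \<in> A i) \<and> (\<omega> \<in> C i \<longleftrightarrow> \<omega>' \<in> C i)\<rbrakk> \<Longrightarrow> h \<omega> = h \<omega>'"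
  shows "finite (h ` S)"
proof -
  let ?k = "\<lambda>\<omega>. ({i\<in>I. \<omega> \<in> A i}, {i\<in>I. \<omega> \<in> C i})"
  have "h ` S \<subseteq> (\<lambda>p. h (SOME \<omega>. ?k \<omega> = p)) ` (Pow I \<times> Pow I)"
  proof safe
    fix \<omega>
    let ?w = "SOME \<omega>'. ?k \<omega>' = ?k \<omega>"
    have "?k ?w = ?k \<omega>" by (rule someI[of "\<lambda>\<omega>'. ?k \<omega>' = ?k \<omega>" \<omega>]) simp
    then have "h \<omega> = h ?w" by (intro assms(2)) (auto simp: set_eq_iff)
    then show "h \<omega> \<in> (\<lambda>p. h (SOME \<omega>. ?k \<omega> = p)) ` (Pow I \<times> Pow I)" by (intro image_eqI[of _ _ "?k \<omega>"]) auto
  qed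
  then show ?thesis by (rule finite_subset) (use assms(1) in auto)
qed

text \<open>Any finite index set may replace the interval from 1 to n. Families of bets can then be
  indexed by sum and option types.\<close>

lemma coherent_Max_nonneg:
  assumes P: "stochastic_process \<Omega> P" and I: "finite I" "I \<noteq> {}"
    and dom: "\<And>i. i \<in> I \<Longrightarrow> (A i, C i) \<in> process_domain \<Omega>"
  shows "Max ((\<lambda>\<omega>. \<Sum>i\<in>I. c i * indicator (C i) \<omega> * (P (A i) (C i) - indicator (A i) \<omega>))
    ` (\<Union>i\<in>I. C i)) \<ge> 0"
proof -
  obtain b where b: "bij_betw b {1..card I} I" using ex_bij_betw_nat_finite_1[OF I(1)] by blast
  have "card I \<ge> 1" using I by (simp add: Suc_leI card_gt_0_iff)
  moreover have "\<forall>i\<in>{1..card I}. (A (b i), C (b i)) \<in> process_domain \<Omega>"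
    using dom b by (auto dest: bij_betwE)
  ultimately have "Max ((\<lambda>\<omega>. \<Sum>i=1..card I. c (b i) * indicator (C (b i)) \<omega> *
      (P (A (b i)) (C (b i)) - indicator (A (b i)) \<omega>)) ` (\<Union>i\<in>{1..card I}. C (b i))) \<ge> 0"
    using P[unfolded stochastic_process_def, rule_format, of "card I" "\<lambda>i. A (b i)" "\<lambda>i. C (b i)" "\<lambda>i. c (b i)"]
    by simp
  moreover have "(\<Union>i\<in>{1..card I}. C (b i)) = (\<Union>i\<in>I. C i)"
    using b unfolding bij_betw_def by (metis image_image)
  moreover have "(\<Sum>i=1..card I. c (b i) * indicator (C (b i)) \<omega> * (P (A (b i)) (C (b i)) - indicator (A (b i)) \<omega>))
      = (\<Sum>i\<in>I. c i * indicator (C i) \<omega> * (P (A i) (C i) - indicator (A i) \<omega>))" for \<omega>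
    by (rule sum.reindex_bij_betw[OF b])
  ultimately show ?thesis by simp
qed

text \<open>
  The identities between conditional probabilities below come from combinations of bets whose total
  gain is constant; coherence forces the constant to vanish.
\<close>

lemma coherent_constant_gamble:
  fixes k :: real
  assumes P: "stochastic_process \<Omega> P" and I: "finite I"
    and dom: "\<And>i. i \<in> I \<Longrightarrow> (A i, C i) \<in> process_domain \<Omega>"
    and ne: "(\<Union>i\<in>I. C i) \<noteq> {}"
    and const: "\<And>\<omega>. \<omega> \<in> (\<Union>i\<in>I. C i) \<Longrightarrow>
      (\<Sum>i\<in>I. c i * indicator (C i) \<omega> * (P (A i) (C i) - indicator (A i) \<omega>)) = k"
  shows "k = 0"
proof -
  let ?g = "\<lambda>c \<omega>. \<Sum>i\<in>I. c i * indicator (C i) \<omega> * (P (A i) (C i) - indicator (A i) \<omega>)"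
  have "I \<noteq> {}" using ne by auto
  have ge: "k \<ge> 0" if const: "\<And>\<omega>. \<omega> \<in> (\<Union>i\<in>I. C i) \<Longrightarrow>
      ?g c \<omega> = k" for c and k :: real
  proof -
    have "((?g c)
      ` (\<Union>i\<in>I. C i)) = (\<lambda>_. k) ` (\<Union>i\<in>I. C i)" by (rule image_cong[OF refl that])
    also have "\<dots> = {k}" using ne by auto
    finally show ?thesis
      using coherent_Max_nonneg[where P = P and A = A and C = C and I = I and \<Omega> = \<Omega> and c = c, OF P I \<open>I \<noteq> {}\<close> dom] by simp
  qed
  have "- k \<ge> 0"
  proof (rule ge[of "\<lambda>i. - c i"])
    fix \<omega> assume "\<omega> \<in> (\<Union>i\<in>I. C i)"
    from const[OF this] show "(\<Sum>i\<in>I. - c i * indicator (C i) \<omega> * (P (A i) (C i) - indicator (A i) \<omega>)) = - k"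
      by (simp add: sum_negf)
  qed
  with ge[OF const] show ?thesis by simp
qed

section \<open>Joint states and the algebras of events\<close>

lemma joint_event_empty: "xu \<in> states {} \<Longrightarrow> joint_event \<Omega> {} xu = \<Omega>"
  by (auto simp: joint_event_def states_def)

lemma joint_event_insert:
  assumes "s \<notin> u" "xu \<in> states u"
  shows "joint_event \<Omega> (insert s u) (xu(s := y)) = state_event \<Omega> s y \<inter> joint_event \<Omega> u xu"
proof -
  have "restrict \<omega> (insert s u) = xu(s := y) \<longleftrightarrow> \<omega> s = y \<and> restrict \<omega> u = xu" for \<omega>
    using assms unfolding states_def fun_eq_iff restrict_def PiE_def extensional_def
    by (auto split: if_splits)
  then show ?thesis by (auto simp: joint_event_def state_event_def)
qed

lemma states_fun_upd: "xu \<in> states u \<Longrightarrow> xu(s := y) \<in> states (insert s u)"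
  by (auto simp: states_def PiE_def extensional_def)

lemma finite_states: "finite u \<Longrightarrow> finite (states u :: (real \<Rightarrow> 'x::finite) set)"
  unfolding states_def by (intro finite_PiE) auto

lemma states_restrict: "restrict \<omega> u \<in> states u"
  by (auto simp: states_def)

lemma mem_state_event: "\<omega> \<in> state_event \<Omega> t x \<longleftrightarrow> \<omega> \<in> \<Omega> \<and> \<omega> t = x"
  by (auto simp: state_event_def)

lemma sum_states_insert:
  fixes h :: "(real \<Rightarrow> 'x::finite) \<Rightarrow> real"
  assumes "s \<notin> u"
  shows "(\<Sum>xu\<in>states (insert s u). h xu) = (\<Sum>xu\<in>states u. \<Sum>y\<in>UNIV. h (xu(s := y)))"
proof -
  have "(\<Sum>xu\<in>states u. \<Sum>y\<in>UNIV. h (xu(s := y))) = (\<Sum>(xu, y)\<in>states u \<times> UNIV. h (xu(s := y)))"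
    by (simp add: sum.cartesian_product)
  also have "\<dots> = (\<Sum>xu\<in>states (insert s u). h xu)"
  proof (rule sum.reindex_bij_witness[where i = "\<lambda>x. (restrict x u, x s)" and j = "\<lambda>(x, y). x(s := y)"])
    fix a :: "(real \<Rightarrow> 'x) \<times> 'x" assume a: "a \<in> states u \<times> UNIV"
    have "restrict ((fst a)(s := snd a)) u = restrict (fst a) u" using assms by (auto simp: restrict_def)
    also have "\<dots> = fst a" using a by (auto simp: states_def PiE_restrict)
    finally show "(restrict (case a of (x, y) \<Rightarrow> x(s := y)) u, (case a of (x, y) \<Rightarrow> x(s := y)) s) = a"
      by (simp add: case_prod_beta)
    show "(case a of (x, y) \<Rightarrow> x(s := y)) \<in> states (insert s u)"
      using a by (auto intro: states_fun_upd)
  next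
    fix b :: "real \<Rightarrow> 'x" assume b: "b \<in> states (insert s u)"
    then show "(case (restrict b u, b s) of (x, y) \<Rightarrow> x(s := y)) = b"
      by (auto simp: states_def PiE_def extensional_def restrict_def)
  qed (auto simp: states_restrict)
  finally show ?thesis by simp
qed

lemma time_seqs_insert: "u \<in> time_seqs \<Longrightarrow> t \<ge> 0 \<Longrightarrow> insert t u \<in> time_seqs"
  by (auto simp: time_seqs_def)

lemma algebra_events_from: "algebra \<Omega> (events_from \<Omega> u)"
proof -
  let ?S = "{state_event \<Omega> t x | t x. t \<ge> 0 \<and> (t \<in> u \<or> (\<forall>r\<in>u. t > r))}"
  have sub: "?S \<subseteq> Pow \<Omega>" by (auto simp: state_event_def)
  have "algebra \<Omega> (algebra \<Omega> hull S)" if "S \<subseteq> Pow \<Omega>" for S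
  proof (rule iffD2[OF algebra_iff_Un], intro conjI ballI)
    show "algebra \<Omega> hull S \<subseteq> Pow \<Omega>" by (rule hull_minimal[where S = "algebra \<Omega>" and t = "Pow \<Omega>", OF that algebra_Pow])
  qed (auto simp: hull_def algebra_iff_Un)
  from this[OF sub] show ?thesis unfolding events_from_def .
qed

lemma state_event_in_events_from:
  "t \<ge> 0 \<Longrightarrow> t \<in> u \<or> (\<forall>r\<in>u. r < t) \<Longrightarrow> state_event \<Omega> t x \<in> events_from \<Omega> u"
  unfolding events_from_def by (rule hull_inc) auto

lemma joint_event_in_events_from:
  assumes "finite v" "v \<subseteq> {0..}" "\<And>s. s \<in> v \<Longrightarrow> s \<in> u \<or> (\<forall>r\<in>u. r < s)" "xv \<in> states v"
  shows "joint_event \<Omega> v xv \<in> events_from \<Omega> u"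
  using assms
proof (induction v arbitrary: xv rule: finite_induct)
  case empty
  interpret algebra \<Omega> "events_from \<Omega> u" by (rule algebra_events_from)
  show ?case using empty by (simp add: joint_event_empty top)
next
  case (insert s v)
  interpret algebra \<Omega> "events_from \<Omega> u" by (rule algebra_events_from)
  have "(restrict xv v)(s := xv s) = xv"
    using insert by (auto simp: states_def fun_eq_iff restrict_def PiE_def extensional_def)
  then have "joint_event \<Omega> (insert s v) xv = state_event \<Omega> s (xv s) \<inter> joint_event \<Omega> v (restrict xv v)"
    using joint_event_insert[OF insert(2) states_restrict, of \<Omega> xv "xv s"] by simp
  moreover have "joint_event \<Omega> v (restrict xv v) \<in> events_from \<Omega> u"
    using insert.prems by (intro insert.IH states_restrict) auto
  moreover have "state_event \<Omega> s (xv s) \<in> events_from \<Omega> u"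
    using insert by (intro state_event_in_events_from) auto
  ultimately show ?case by auto
qed

lemma path_space_nonempty:
  assumes "path_space \<Omega>"
  shows "\<Omega> \<noteq> {}"
proof -
  have "{0::real} \<in> time_seqs" by (simp add: time_seqs_def)
  then show ?thesis using assms states_restrict[of undefined "{0}"] unfolding path_space_def by blast
qed

lemma joint_event_nonempty:
  assumes "path_space \<Omega>" "u \<in> time_seqs" "xu \<in> states u"
  shows "joint_event \<Omega> u xu \<noteq> {}"
proof (cases "u = {}")
  case True
  then show ?thesis using assms by (auto simp: joint_event_empty path_space_nonempty)
next
  case False
  then obtain \<omega> where "\<omega> \<in> \<Omega>" "restrict \<omega> u = xu" using assms unfolding path_space_def by blast
  then show ?thesis by (auto simp: joint_event_def)
qed

lemma process_domain_joint:
  "u \<in> time_seqs \<Longrightarrow> xu \<in> states u \<Longrightarrow> A \<in> events_from \<Omega> u \<Longrightarrow> (A, joint_event \<Omega> u xu) \<in> process_domain \<Omega>"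
  unfolding process_domain_def by blast

section \<open>Probability calculus derived from coherence\<close>

locale process =
  fixes \<Omega> :: "(real \<Rightarrow> 'x::finite) set" and P :: "'x process"
  assumes path_space: "path_space \<Omega>" and coherent: "stochastic_process \<Omega> P"
begin

lemma dom_state:
  assumes "u \<in> time_seqs" "xu \<in> states u" "s \<ge> 0" "s \<in> u \<or> (\<forall>r\<in>u. r < s)"
  shows "(state_event \<Omega> s y, joint_event \<Omega> u xu) \<in> process_domain \<Omega>"
  using assms by (intro process_domain_joint state_event_in_events_from)

text \<open>A single bet with coefficient 1 gains at most P A C on C, so this number bounds a
  non-negative maximum from above.\<close>

lemma cond_nonneg:
  assumes "(A, C) \<in> process_domain \<Omega>"
  shows "P A C \<ge> 0"
proof -
  obtain u xu where C: "u \<in> time_seqs" "xu \<in> states u" "C = joint_event \<Omega> u xu"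
    using assms unfolding process_domain_def by blast
  have ne: "C \<noteq> {}" using joint_event_nonempty[OF path_space C(1,2)] C(3) by simp
  let ?h = "\<lambda>\<omega>. indicator C \<omega> * (P A C - indicator A \<omega> :: real)"
  have "0 \<le> Max (?h ` C)"
    using coherent_Max_nonneg[where I = "{()}" and A = "\<lambda>_. A" and C = "\<lambda>_. C" and c = "\<lambda>_. 1", OF coherent] assms by simp
  also have "Max (?h ` C) \<le> P A C"
  proof (subst Max_le_iff)
    show "finite (?h ` C)"
      by (rule finite_image_indicators[where I = "{()}" and A = "\<lambda>_. A" and C = "\<lambda>_. C"]) (auto simp: indicator_def)
  qed (use ne in \<open>auto simp: indicator_def\<close>)
  finally show ?thesis .
qed

lemma cond_eq_1:
  assumes "(A, C) \<in> process_domain \<Omega>" "C \<subseteq> A" "C \<noteq> {}"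
  shows "P A C = 1"
proof -
  have "P A C - 1 = 0"
    by (rule coherent_constant_gamble[where I = "{()}" and A = "\<lambda>_. A" and C = "\<lambda>_. C" and c = "\<lambda>_. 1", OF coherent])
     (use assms in auto)
  then show ?thesis by simp
qed

lemma cond_eq_0:
  assumes "(A, C) \<in> process_domain \<Omega>" "C \<inter> A = {}" "C \<noteq> {}"
  shows "P A C = 0"
  by (rule coherent_constant_gamble[where I = "{()}" and A = "\<lambda>_. A" and C = "\<lambda>_. C" and c = "\<lambda>_. 1", OF coherent])
     (use assms in \<open>auto simp: disjoint_iff\<close>)

lemma cond_state_sum:
  assumes "u \<in> time_seqs" "xu \<in> states u" "s \<ge> 0" "s \<in> u \<or> (\<forall>r\<in>u. r < s)"
  shows "(\<Sum>y\<in>UNIV. P (state_event \<Omega> s y) (joint_event \<Omega> u xu)) = 1"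
proof -
  let ?C = "joint_event \<Omega> u xu"
  have "(\<Sum>y\<in>UNIV. P (state_event \<Omega> s y) ?C) - 1 = 0"
  proof (rule coherent_constant_gamble[where I = "UNIV :: 'x set" and C = "\<lambda>_. ?C" and c = "\<lambda>_. 1", OF coherent])
    show "(state_event \<Omega> s y, ?C) \<in> process_domain \<Omega>" for y by (rule dom_state[OF assms])
    show "(\<Union>i\<in>(UNIV::'x set). ?C) \<noteq> {}" using joint_event_nonempty[OF path_space assms(1,2)] by simp
    fix \<omega> assume "\<omega> \<in> (\<Union>i\<in>(UNIV::'x set). ?C)"
    then have "\<omega> \<in> ?C" "\<omega> \<in> \<Omega>" by (auto simp: joint_event_def)
    then have "(\<Sum>i\<in>UNIV. indicator (state_event \<Omega> s i) \<omega> :: real) = 1"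
      by (simp add: indicator_def mem_state_event)
    then show "(\<Sum>y\<in>UNIV. 1 * indicator ?C \<omega> * (P (state_event \<Omega> s y) ?C - indicator (state_event \<Omega> s y) \<omega>)) =
       (\<Sum>y\<in>UNIV. P (state_event \<Omega> s y) ?C) - 1" using \<open>\<omega> \<in> ?C\<close> by (simp add: sum_subtractf)
  qed auto
  then show ?thesis by simp
qed

text \<open>The law of total probability at an intermediate time r, with the history kept. The
  process need not be Markov, so the second factor still carries that history.\<close>

lemma cond_total:
  assumes u: "u \<in> time_seqs" "xu \<in> states u" and r: "r \<ge> 0" "\<forall>q\<in>u. q < r" and s: "s > r"
  shows "P (state_event \<Omega> s y) (joint_event \<Omega> u xu) =
    (\<Sum>z\<in>UNIV. P (state_event \<Omega> r z) (joint_event \<Omega> u xu) *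
       P (state_event \<Omega> s y) (joint_event \<Omega> (insert r u) (xu(r := z))))"
proof -
  let ?C = "joint_event \<Omega> u xu" and ?D = "\<lambda>z. joint_event \<Omega> (insert r u) (xu(r := z))"
  let ?B = "state_event \<Omega> s y" and ?Z = "state_event \<Omega> r"
  have D: "?D z = ?Z z \<inter> ?C" for z by (rule joint_event_insert) (use u r in auto)
  \<comment> \<open>\<open>Inl None\<close> is the bet on the target given the history,
    \<open>Inl (Some z)\<close> the bet on state z at time r given the history, and
    \<open>Inr z\<close> the bet on the target given both. On a path with state z at time r the
    coefficients cancel the indicators and the term P B (D z), leaving a constant.\<close>
  let ?A' = "case_sum (case_option ?B ?Z) (\<lambda>_. ?B)"
  let ?C' = "case_sum (\<lambda>_. ?C) ?D"
  let ?c = "case_sum (case_option 1 (\<lambda>z. - P ?B (?D z))) (\<lambda>_. -1)"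
  have expand: "(\<Sum>i\<in>UNIV. g i) = (g (Inl None) + (\<Sum>z\<in>UNIV. g (Inl (Some z)))) + (\<Sum>z\<in>UNIV. g (Inr z))"
    for g :: "'x option + 'x \<Rightarrow> real"
    by (simp add: UNIV_Plus_UNIV[symmetric] sum.Plus UNIV_option_conv sum.reindex o_def)
  have "P ?B ?C - (\<Sum>z\<in>UNIV. P (?Z z) ?C * P ?B (?D z)) = 0"
  proof (rule coherent_constant_gamble[where I = "UNIV :: ('x option + 'x) set" and A = ?A' and C = ?C' and c = ?c, OF coherent])
    fix i :: "'x option + 'x"
    show "(?A' i, ?C' i) \<in> process_domain \<Omega>"
      using u r s by (auto split: sum.split option.split intro!: dom_state time_seqs_insert states_fun_upd)
    show "(\<Union>i\<in>(UNIV :: ('x option + 'x) set). ?C' i) \<noteq> {}"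
    proof -
      have "?C' (Inl (None :: 'x option)) \<subseteq> (\<Union>i\<in>(UNIV :: ('x option + 'x) set). ?C' i)"
        by (rule UN_upper[OF UNIV_I])
      then show ?thesis using joint_event_nonempty[OF path_space u] by auto
    qed
    fix \<omega> assume "\<omega> \<in> (\<Union>i\<in>(UNIV :: ('x option + 'x) set). ?C' i)"
    then obtain i :: "'x option + 'x" where "\<omega> \<in> ?C' i" by blast
    then have w: "\<omega> \<in> ?C" by (cases i) (auto simp: D)
    then have w': "\<omega> \<in> \<Omega>" by (auto simp: joint_event_def)
    have *: "indicator (?Z z) \<omega> = (if z = \<omega> r then 1 else 0 :: real)"
      "indicator (?D z) \<omega> = (if z = \<omega> r then 1 else 0 :: real)" for z
      using w w' by (auto simp: D mem_state_event indicator_def)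
    show "(\<Sum>i\<in>UNIV. ?c i * indicator (?C' i) \<omega> * (P (?A' i) (?C' i) - indicator (?A' i) \<omega>)) =
      P ?B ?C - (\<Sum>z\<in>UNIV. P (?Z z) ?C * P ?B (?D z))"
    proof -
      have "(\<Sum>z\<in>UNIV. - P ?B (?D z) * indicator ?C \<omega> * (P (?Z z) ?C - indicator (?Z z) \<omega>)) =
        (\<Sum>z\<in>UNIV. (if z = \<omega> r then P ?B (?D z) else 0) - P (?Z z) ?C * P ?B (?D z))"
        by (rule sum.cong) (use w in \<open>auto simp: * algebra_simps\<close>)
      also have "\<dots> = P ?B (?D (\<omega> r)) - (\<Sum>z\<in>UNIV. P (?Z z) ?C * P ?B (?D z))"
        by (simp add: sum_subtractf)
      finally have 1: "(\<Sum>z\<in>UNIV. - P ?B (?D z) * indicator ?C \<omega> * (P (?Z z) ?C - indicator (?Z z) \<omega>)) =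
        P ?B (?D (\<omega> r)) - (\<Sum>z\<in>UNIV. P (?Z z) ?C * P ?B (?D z))" .
      have "(\<Sum>z\<in>UNIV. - 1 * indicator (?D z) \<omega> * (P ?B (?D z) - indicator ?B \<omega>)) =
        (\<Sum>z\<in>UNIV. if z = \<omega> r then indicator ?B \<omega> - P ?B (?D z) else 0)"
        by (rule sum.cong) (auto simp: *)
      then have 2: "(\<Sum>z\<in>UNIV. - 1 * indicator (?D z) \<omega> * (P ?B (?D z) - indicator ?B \<omega>)) =
        indicator ?B \<omega> - P ?B (?D (\<omega> r))" by simp
      show ?thesis unfolding expand sum.case option.case 1 2 using w by simp
    qed
  qed auto
  then show ?thesis by simp
qed

text \<open>The product rule, again from a family of bets whose total gain is constant on \<Omega>.
  It links the unconditional joint probabilities in the theorem to the transition matrices.\<close>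

lemma cond_chain:
  assumes w: "w \<in> time_seqs" "xw \<in> states w" and s: "s \<ge> 0" "\<forall>q\<in>w. q < s"
  shows "P (joint_event \<Omega> (insert s w) (xw(s := y))) \<Omega> =
    P (joint_event \<Omega> w xw) \<Omega> * P (state_event \<Omega> s y) (joint_event \<Omega> w xw)"
proof -
  let ?C = "joint_event \<Omega> w xw" and ?S = "state_event \<Omega> s y" and ?D = "joint_event \<Omega> (insert s w) (xw(s := y))"
  have D: "?D = ?S \<inter> ?C" by (rule joint_event_insert) (use w s in auto)
  have C: "?C \<subseteq> \<Omega>" by (auto simp: joint_event_def)
  \<comment> \<open>\<open>None\<close> is the bet on the longer joint event,
    \<open>Some True\<close> the bet on the shorter one with its stake scaled by P S C, and
    \<open>Some False\<close> the bet on the new state given the shorter one.\<close>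
  let ?A' = "case_option ?D (\<lambda>b. if b then ?C else ?S)"
  let ?C' = "case_option \<Omega> (\<lambda>b. if b then \<Omega> else ?C)"
  let ?c = "case_option 1 (\<lambda>b. if b then - P ?S ?C else - 1)"
  have e: "{} \<in> time_seqs" "(\<lambda>_. undefined) \<in> states {}" "joint_event \<Omega> {} (\<lambda>_. undefined) = \<Omega>"
    by (auto simp: time_seqs_def states_def joint_event_empty)
  have dom: "joint_event \<Omega> v xv \<in> events_from \<Omega> {}" if "v \<in> time_seqs" "xv \<in> states v" for v xv
    by (rule joint_event_in_events_from) (use that in \<open>auto simp: time_seqs_def\<close>)
  have expand: "(\<Sum>i\<in>UNIV. g i) = g None + (g (Some True) + g (Some False))" for g :: "bool option \<Rightarrow> real"
    by (simp add: UNIV_option_conv sum.reindex o_def UNIV_bool)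
  have "P ?D \<Omega> - P ?C \<Omega> * P ?S ?C = 0"
  proof (rule coherent_constant_gamble[where I = "UNIV :: bool option set" and A = ?A' and C = ?C' and c = ?c, OF coherent])
    fix i :: "bool option"
    show "(?A' i, ?C' i) \<in> process_domain \<Omega>"
      using w s process_domain_joint[OF e(1,2) dom, unfolded e(3)]
      by (auto split: option.split intro!: dom_state states_fun_upd time_seqs_insert)
    show "(\<Union>i\<in>UNIV. ?C' i) \<noteq> {}" using path_space_nonempty[OF path_space] by (auto intro: exI[of _ None])
    fix \<omega> assume "\<omega> \<in> (\<Union>i\<in>UNIV. ?C' i)"
    then have "\<omega> \<in> \<Omega>" using C by (auto split: option.splits if_splits)
    then show "(\<Sum>i\<in>UNIV. ?c i * indicator (?C' i) \<omega> * (P (?A' i) (?C' i) - indicator (?A' i) \<omega>)) =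
       P ?D \<Omega> - P ?C \<Omega> * P ?S ?C"
      unfolding expand option.case by (auto simp: D indicator_def algebra_simps)
  qed auto
  then show ?thesis by simp
qed

lemma transition_matrix_nth:
  assumes "u \<in> time_seqs_before t" "xu \<in> states u"
  shows "transition_matrix \<Omega> P u xu t s $ x $ y = P (state_event \<Omega> s y) (joint_event \<Omega> (insert t u) (xu(t := x)))"
  using assms by (subst joint_event_insert) (auto simp: transition_matrix_def time_seqs_before_def)

lemma history_insert:
  assumes "t \<ge> 0" "u \<in> time_seqs_before t" "xu \<in> states u"
  shows "insert t u \<in> time_seqs" "xu(t := x) \<in> states (insert t u)" "\<forall>r\<in>insert t u. r \<le> t"
  using assms by (auto simp: time_seqs_before_def less_imp_le intro!: time_seqs_insert states_fun_upd)

lemma transition_matrix_nonneg: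
  assumes "t \<ge> 0" "u \<in> time_seqs_before t" "xu \<in> states u" "t < s"
  shows "transition_matrix \<Omega> P u xu t s $ x $ y \<ge> 0"
  unfolding transition_matrix_nth[OF assms(2,3)]
  using history_insert[OF assms(1-3)] assms(1,4) by (intro cond_nonneg dom_state) fastforce+

lemma transition_matrix_row_sum:
  assumes "t \<ge> 0" "u \<in> time_seqs_before t" "xu \<in> states u" "t < s"
  shows "(\<Sum>y\<in>UNIV. transition_matrix \<Omega> P u xu t s $ x $ y) = 1"
  unfolding transition_matrix_nth[OF assms(2,3)]
  using history_insert[OF assms(1-3)] assms(1,4) by (intro cond_state_sum) fastforce+

end

section \<open>The lower bound\<close>

lemma abs_matrix_vector_le:
  fixes A :: "real^'x^'x::finite"
  assumes "\<And>y. \<bar>A $ x $ y\<bar> \<le> c"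
  shows "\<bar>(A *v f) $ x\<bar> \<le> real CARD('x) * c * infnorm f"
proof -
  have "\<bar>(A *v f) $ x\<bar> \<le> (\<Sum>y\<in>UNIV. \<bar>A $ x $ y * f $ y\<bar>)"
    unfolding matrix_vector_mult_def by (simp add: sum_abs)
  also have "\<dots> \<le> (\<Sum>y\<in>(UNIV :: 'x set). c * infnorm f)"
    unfolding abs_mult using assms component_le_infnorm_cart[of f]
    by (intro sum_mono mult_mono) (auto intro: order_trans[OF abs_ge_zero])
  finally show ?thesis by simp
qed

lemma abs_entry_le_op_norm: "\<bar>(A::real^'x^'x::finite) $ x $ y\<bar> \<le> op_norm ((*v) A)"
proof -
  let ?c = "\<Sum>x\<in>UNIV. \<Sum>y\<in>UNIV. \<bar>A $ x $ y\<bar>"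
  have c: "\<bar>A $ x $ y\<bar> \<le> ?c" for x y
    by (rule order_trans[OF member_le_sum[of y UNIV "\<lambda>y. \<bar>A $ x $ y\<bar>"]
          member_le_sum[of x UNIV "\<lambda>x. \<Sum>y\<in>UNIV. \<bar>A $ x $ y\<bar>"]])
      (auto intro: sum_nonneg)
  have "\<bar>A $ x $ y\<bar> = \<bar>(A *v axis y 1) $ x\<bar>" by (simp add: matrix_vector_mult_basis column_def)
  also have "\<dots> \<le> infnorm (A *v axis y 1)" by (rule component_le_infnorm_cart)
  also have "\<dots> \<le> op_norm ((*v) A)"
  proof (rule infnorm_le_op_norm[OF _ infnorm_axis])
    fix f :: "real^'x" assume "infnorm f = 1"
    then show "infnorm (A *v f) \<le> real CARD('x) * ?c * 1"
      using abs_matrix_vector_le[of A _ ?c f] c by (simp add: infnorm_le_iff)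
  qed
  finally show ?thesis .
qed

text \<open>Puts good behaviour in the form used below: an entrywise bound that is linear in h near
  0. It yields continuity of conditional laws and compactness of difference quotients.\<close>

lemma Limsup_op_norm_bound:
  fixes D :: "real \<Rightarrow> real^'x^'x::finite"
  assumes "Limsup (at_right 0) (\<lambda>h. ereal (1 / h * op_norm ((*v) (D h)))) < \<infinity>"
  shows "\<exists>K. \<forall>\<^sub>F h in at_right 0. \<forall>x y. \<bar>D h $ x $ y\<bar> \<le> K * h"
proof -
  obtain K :: nat where "Limsup (at_right 0) (\<lambda>h. ereal (1 / h * op_norm ((*v) (D h)))) < ereal (real K)"
    using assms by (auto simp: less_PInf_Ex_of_nat)
  then have "\<forall>\<^sub>F h in at_right 0. ereal (1 / h * op_norm ((*v) (D h))) < ereal (real K)"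
    by (rule Limsup_lessD)
  then have "\<forall>\<^sub>F h in at_right 0. \<forall>x y. \<bar>D h $ x $ y\<bar> \<le> real K * h"
    using eventually_at_right_less[of "0::real"]
  proof eventually_elim
    case (elim h)
    then have "op_norm ((*v) (D h)) \<le> real K * h" by (simp add: field_simps)
    then show ?case using abs_entry_le_op_norm order_trans by blast
  qed
  then show ?thesis by blast
qed

text \<open>By compactness there is a last point m with \<psi> t \<le> \<psi> m + e (m - t). If m <
  s, an increment of slope at least -e leads to a later point with the same property. One increment
  per point is enough, which is all that a subsequence limit can provide.\<close>

lemma nondecreasing_from_dini:
  fixes \<psi> :: "real \<Rightarrow> real"
  assumes ts: "t \<le> s" and cont: "continuous_on {t..s} \<psi>"
    and dini: "\<And>r e. t \<le> r \<Longrightarrow> r < s \<Longrightarrow> e > 0 \<Longrightarrow> \<exists>h>0. r + h \<le> s \<and> \<psi> (r + h) - \<psi> r \<ge> - e * h"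
  shows "\<psi> t \<le> \<psi> s"
proof -
  have "\<psi> t \<le> \<psi> s + e * (s - t)" if e: "e > 0" for e
  proof (rule ccontr)
    assume neg: "\<not> \<psi> t \<le> \<psi> s + e * (s - t)"
    let ?g = "\<lambda>r. \<psi> r + e * (r - t)"
    let ?S = "{r \<in> {t..s}. \<psi> t \<le> ?g r}"
    have "closed ?S" by (intro continuous_on_closed_Collect_le continuous_intros cont)
    moreover have "bounded ?S" by (rule bounded_subset[of "{t..s}"]) auto
    ultimately have "compact ?S" by (simp add: compact_eq_bounded_closed)
    moreover have "t \<in> ?S" using ts by simp
    ultimately obtain m where m: "m \<in> ?S" "\<And>r. r \<in> ?S \<Longrightarrow> r \<le> m"
      using compact_attains_sup[of ?S] by blast
    have "m \<noteq> s" using m(1) neg by auto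
    then obtain h where h: "h > 0" "m + h \<le> s" "\<psi> (m + h) - \<psi> m \<ge> - e * h"
      using dini[of m e] m(1) e by auto
    then have "m + h \<in> ?S" using m(1) by (auto simp: algebra_simps)
    with m(2) h(1) show False by force
  qed
  note * = this
  show ?thesis
  proof (rule field_le_epsilon)
    fix e :: real assume e: "e > 0"
    have "\<psi> t \<le> \<psi> s + (e / (s - t + 1)) * (s - t)" using e ts by (intro *) auto
    also have "(e / (s - t + 1)) * (s - t) \<le> e" using e ts by (simp add: field_simps)
    finally show "\<psi> t \<le> \<psi> s + e" by simp
  qed
qed

lemma tendsto_matrix_vector_mult:
  fixes A :: "'b \<Rightarrow> real^'x^'x::finite"
  assumes "(A \<longlongrightarrow> a) G" "(f \<longlongrightarrow> l) G"
  shows "((\<lambda>i. A i *v f i) \<longlongrightarrow> a *v l) G"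
  by (rule vec_tendstoI) (simp add: matrix_vector_mult_def, intro tendsto_intros tendsto_vec_nth assms)

lemma norm_matrix_le:
  fixes A :: "real^'x^'x::finite"
  assumes "\<And>x y. \<bar>A $ x $ y\<bar> \<le> c"
  shows "norm A \<le> real CARD('x) * (real CARD('x) * c)"
proof -
  have "norm A \<le> (\<Sum>x\<in>UNIV. norm (A $ x))" unfolding norm_vec_def by (rule L2_set_le_sum) auto
  also have "\<dots> \<le> (\<Sum>x\<in>(UNIV :: 'x set). real CARD('x) * c)"
  proof (rule sum_mono)
    fix x
    have "norm (A $ x) \<le> (\<Sum>y\<in>UNIV. \<bar>A $ x $ y\<bar>)" by (rule norm_le_l1_cart)
    also have "\<dots> \<le> (\<Sum>y\<in>(UNIV :: 'x set). c)" by (intro sum_mono assms)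
    finally show "norm (A $ x) \<le> real CARD('x) * c" by simp
  qed
  finally show ?thesis by simp
qed

section \<open>Regularity of the semigroup in time\<close>

context bounded_rate_set
begin

lemma semigroup_diff:
  assumes "h \<ge> 0"
  shows "infnorm (semigroup h g - g) \<le> h * B * infnorm g"
proof (rule infnorm_le_limit)
  show "(\<lambda>n. dyadic_approx n h g - g) \<longlonglongrightarrow> semigroup h g - g"
    by (intro tendsto_intros dyadic_approx_tendsto assms)
  show "(\<lambda>n. (real (dyadic n h) / 2 ^ n) * B * infnorm g) \<longlonglongrightarrow> h * B * infnorm g"
    by (intro tendsto_intros dyadic_tendsto assms)
  show "\<forall>\<^sub>F n in sequentially. infnorm (dyadic_approx n h g - g) \<le> (real (dyadic n h) / 2 ^ n) * B * infnorm g"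
    using eventually_fine
  proof eventually_elim
    case (elim n)
    then show ?case using euler_funpow_diff[of "1 / 2 ^ n" "dyadic n h" g]
      by (simp add: dyadic_approx_def)
  qed
qed

lemma semigroup_lipschitz:
  assumes "a \<ge> 0" "h \<ge> 0"
  shows "infnorm (semigroup (a + h) g - semigroup a g) \<le> h * B * infnorm g"
proof -
  have "infnorm (semigroup a (semigroup h g) - semigroup a g) \<le> infnorm (semigroup h g - g)"
    by (intro lower_transition_nonexpansive lower_transition_semigroup assms)
  then show ?thesis using semigroup_diff[OF assms(2), of g] by (simp add: semigroup_add[OF assms])
qed

lemma semigroup_abs_diff:
  assumes "a \<ge> 0" "b \<ge> 0"
  shows "infnorm (semigroup a g - semigroup b g) \<le> \<bar>a - b\<bar> * B * infnorm g"
proof (cases "a \<le> b")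
  case True
  then show ?thesis using semigroup_lipschitz[of a "b - a" g] assms by (simp add: infnorm_sub)
next
  case False
  then show ?thesis using semigroup_lipschitz[of b "a - b" g] assms by simp
qed

lemma continuous_on_semigroup: "continuous_on {t..s} (\<lambda>r. semigroup (s - r) g $ z)"
proof -
  have "\<bar>semigroup (s - r) g $ z - semigroup (s - r') g $ z\<bar> \<le> (B * infnorm g) * \<bar>r - r'\<bar>"
    if "r \<le> s" "r' \<le> s" for r r'
    using semigroup_abs_diff[of "s - r" "s - r'" g, unfolded infnorm_le_iff, rule_format, of z] that
    by (simp add: abs_minus_commute mult_ac)
  then have "(B * infnorm g)-lipschitz_on {t..s} (\<lambda>r. semigroup (s - r) g $ z)"
    by (intro lipschitz_onI) (use B_nonneg in \<open>auto simp: dist_real_def infnorm_pos_le\<close>)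
  then show ?thesis by (rule lipschitz_on_continuous_on)
qed

text \<open>With k the value at a - h, the value at a is the semigroup for time h applied to k.
  \<open>semigroup_approx\<close> at k and the Lipschitz bound that moves \<open>Qlow\<close> from k
  to the value at a each cost h B^2 infnorm g, whence the factor 2.\<close>

lemma semigroup_backward_quotient:
  assumes "0 < h" "h \<le> a"
  shows "infnorm ((1 / h) *\<^sub>R (semigroup (a - h) g - semigroup a g) + Qlow (semigroup a g)) \<le> h * (2 * B\<^sup>2 * infnorm g)"
proof -
  let ?k = "semigroup (a - h) g"
  let ?e = "(1 / h) *\<^sub>R (semigroup h ?k - ?k - h *\<^sub>R Qlow ?k)" and ?q = "(1 / h) *\<^sub>R (?k - semigroup a g) + Qlow (semigroup a g)"
  have k: "infnorm ?k \<le> infnorm g"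
    using assms by (intro lower_transition_infnorm_le lower_transition_semigroup) auto
  have a: "semigroup a g = semigroup h ?k" using semigroup_add[of h "a - h" g] assms by simp
  have "?q
    = (Qlow (semigroup a g) - Qlow ?k) - ?e"
    using assms by (simp add: a algebra_simps)
  then have "infnorm ?q \<le>
    infnorm (Qlow (semigroup a g) - Qlow ?k) + infnorm ?e"
    using infnorm_triangle[of "Qlow (semigroup a g) - Qlow ?k" "- ?e"]
    by (simp only: infnorm_neg) simp
  moreover have "infnorm (Qlow (semigroup a g) - Qlow ?k) \<le> B * (h * B * infnorm g)"
    using order_trans[OF Qlow_lipschitz mult_left_mono[OF semigroup_lipschitz[of "a - h" h g] B_nonneg]] assms
    by simp
  moreover have "infnorm ?e \<le> h * (B\<^sup>2 * infnorm g)"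
  proof -
    have "infnorm ?e \<le> (1 / h) * ((h * B)\<^sup>2 * infnorm ?k)"
      using assms semigroup_approx[of h ?k] by (simp add: infnorm_mul divide_right_mono)
    also have "\<dots> = h * (B\<^sup>2 * infnorm ?k)" using assms by (simp add: power2_eq_square)
    also have "\<dots> \<le> h * (B\<^sup>2 * infnorm g)" using assms k by (intro mult_left_mono) auto
    finally show ?thesis .
  qed
  ultimately show ?thesis by (simp add: power2_eq_square algebra_simps)
qed

lemma semigroup_backward_derivative:
  assumes "a > 0" "h \<longlonglongrightarrow> 0" "\<And>i. 0 < h i" "\<And>i. h i \<le> a"
  shows "(\<lambda>i. (1 / h i) *\<^sub>R (semigroup (a - h i) g - semigroup a g)) \<longlonglongrightarrow> - Qlow (semigroup a g)"
    and "(\<lambda>i. semigroup (a - h i) g) \<longlonglongrightarrow> semigroup a g"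
proof -
  show "(\<lambda>i. (1 / h i) *\<^sub>R (semigroup (a - h i) g - semigroup a g)) \<longlonglongrightarrow> - Qlow (semigroup a g)"
  proof (rule vec_tendstoI, rule LIM_zero_cancel, rule Lim_null_comparison)
    fix z
    show "\<forall>\<^sub>F i in sequentially. norm (((1 / h i) *\<^sub>R (semigroup (a - h i) g - semigroup a g)) $ z - (- Qlow (semigroup a g)) $ z)
       \<le> h i * (2 * B\<^sup>2 * infnorm g)"
      using semigroup_backward_quotient[OF assms(3,4), of _ g, unfolded infnorm_le_iff] by simp
    show "(\<lambda>i. h i * (2 * B\<^sup>2 * infnorm g)) \<longlonglongrightarrow> 0" by (rule tendsto_mult_left_zero[OF assms(2)])
  qed
  show "(\<lambda>i. semigroup (a - h i) g) \<longlonglongrightarrow> semigroup a g"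
  proof (rule vec_tendstoI, rule LIM_zero_cancel, rule Lim_null_comparison)
    fix z
    have "infnorm (semigroup a g - semigroup (a - h i) g) \<le> h i * B * infnorm g" for i
      using semigroup_lipschitz[of "a - h i" "h i" g] assms(4)[of i] less_imp_le[OF assms(3)[of i]] by simp
    then show "\<forall>\<^sub>F i in sequentially. norm (semigroup (a - h i) g $ z - semigroup a g $ z)
       \<le> h i * (B * infnorm g)"
      unfolding infnorm_le_iff by (simp add: abs_minus_commute mult.assoc)
    show "(\<lambda>i. h i * (B * infnorm g)) \<longlonglongrightarrow> 0" by (rule tendsto_mult_left_zero[OF assms(2)])
  qed
qed

end

section \<open>Conditional expectations under a consistent process\<close>

locale consistent_process = process \<Omega> P + bounded_rate_set \<Q> B
  for \<Omega> :: "(real \<Rightarrow> 'x::finite) set" and P and \<Q> :: "(real^'x^'x) set" and B +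
  assumes well_behaved: "well_behaved \<Omega> P" and consistent: "consistent_rates \<Omega> \<Q> P"
begin

abbreviation "T \<equiv> transition_matrix \<Omega> P"

lemma right_quotient_bound:
  assumes "t \<ge> 0" "u \<in> time_seqs_before t" "xu \<in> states u"
  obtains K where "\<forall>\<^sub>F h in at_right 0. \<forall>x y. \<bar>(T u xu t (t + h) - mat 1) $ x $ y\<bar> \<le> K * h"
  using Limsup_op_norm_bound[of "\<lambda>h. T u xu t (t + h) - mat 1"] well_behaved assms
  unfolding well_behaved_def by blast

lemma left_quotient_bound:
  assumes "t > 0" "u \<in> time_seqs_before t" "xu \<in> states u"
  obtains K where "\<forall>\<^sub>F h in at_right 0. \<forall>x y. \<bar>(T u xu (t - h) t - mat 1) $ x $ y\<bar> \<le> K * h"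
  using Limsup_op_norm_bound[of "\<lambda>h. T u xu (t - h) t - mat 1"] well_behaved assms
  unfolding well_behaved_def by (meson less_imp_le)

text \<open>Good behaviour bounds the quotients, so a subsequence converges. Its limit inherits zero
  row sums and non-negative off-diagonal entries, hence belongs to the outer derivative, and
  consistency puts it into \<Q>.\<close>

lemma difference_quotient_subsequence:
  assumes t: "t \<ge> 0" "u \<in> time_seqs_before t" "xu \<in> states u"
    and h: "filterlim h (at_right 0) sequentially" "\<And>i. h i > 0"
  obtains R \<sigma> where "R \<in> \<Q>" "strict_mono \<sigma>"
    "(\<lambda>i. (1 / h (\<sigma> i)) *\<^sub>R (T u xu t (t + h (\<sigma> i)) - mat 1)) \<longlonglongrightarrow> R"
proof -
  let ?D = "\<lambda>i. (1 / h i) *\<^sub>R (T u xu t (t + h i) - mat 1)"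
  obtain K where "\<forall>\<^sub>F h in at_right 0. \<forall>x y. \<bar>(T u xu t (t + h) - mat 1) $ x $ y\<bar> \<le> K * h"
    using right_quotient_bound[OF t] .
  then have "\<forall>\<^sub>F i in sequentially. \<forall>x y. \<bar>(T u xu t (t + h i) - mat 1) $ x $ y\<bar> \<le> K * h i"
    by (rule h(1)[unfolded filterlim_iff, rule_format])
  then obtain N where N: "\<And>i x y. i \<ge> N \<Longrightarrow> \<bar>(T u xu t (t + h i) - mat 1) $ x $ y\<bar> \<le> K * h i"
    unfolding eventually_sequentially by blast
  have "\<bar>?D (i + N) $ x $ y\<bar> \<le> K" for i x y
    using N[of "i + N" x y] h(2)[of "i + N"] by (simp add: abs_mult field_simps)
  then have "norm (?D (i + N)) \<le> real CARD('x) * (real CARD('x) * K)" for i by (rule norm_matrix_le)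
  then have "bounded (range (\<lambda>i. ?D (i + N)))" unfolding bounded_iff by blast
  then obtain R \<rho> where \<rho>: "strict_mono \<rho>" "((\<lambda>i. ?D (i + N)) \<circ> \<rho>) \<longlonglongrightarrow> R"
    using bounded_imp_convergent_subsequence by blast
  \<comment> \<open>The shift by N skips the initial indices, for which the linear bound on the
    quotients may fail.\<close>
  define \<sigma> where "\<sigma> i = \<rho> i + N" for i
  have \<sigma>: "strict_mono \<sigma>" using \<rho>(1) by (auto simp: strict_mono_def \<sigma>_def)
  have lim: "(\<lambda>i. ?D (\<sigma> i)) \<longlonglongrightarrow> R" using \<rho>(2) by (simp add: o_def \<sigma>_def)
  have entry: "(\<lambda>i. ?D (\<sigma> i) $ x $ y) \<longlonglongrightarrow> R $ x $ y" for x y by (intro tendsto_vec_nth lim)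
  have "R \<in> rate_matrices"
    unfolding rate_matrices_def
  proof (intro CollectI conjI allI impI)
    fix x
    have "(\<Sum>y\<in>UNIV. ?D (\<sigma> i) $ x $ y) = 0" for i
      using transition_matrix_row_sum[OF t, of "t + h (\<sigma> i)" x] h(2)[of "\<sigma> i"]
      by (simp add: sum_divide_distrib[symmetric] sum_subtractf mat_def)
    moreover have "(\<lambda>i. \<Sum>y\<in>UNIV. ?D (\<sigma> i) $ x $ y) \<longlonglongrightarrow> (\<Sum>y\<in>UNIV. R $ x $ y)"
      by (intro tendsto_sum entry)
    ultimately have "(\<lambda>i. 0) \<longlonglongrightarrow> (\<Sum>y\<in>UNIV. R $ x $ y)" by (simp only:)
    then show "(\<Sum>y\<in>UNIV. R $ x $ y) = 0" by (simp add: LIMSEQ_const_iff)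
    fix y assume "x \<noteq> y"
    show "0 \<le> R $ x $ y"
    proof (rule LIMSEQ_le_const[OF entry], intro exI allI impI)
      fix i :: nat
      show "0 \<le> ?D (\<sigma> i) $ x $ y"
        using transition_matrix_nonneg[OF t, of "t + h (\<sigma> i)" x y] h(2)[of "\<sigma> i"] \<open>x \<noteq> y\<close>
        by (simp add: mat_def)
    qed
  qed
  moreover have "filterlim (\<lambda>i. h (\<sigma> i)) (at_right 0) sequentially"
    by (rule filterlim_compose[OF h(1) filterlim_subseq[OF \<sigma>]])
  ultimately have "R \<in> outer_derivative \<Omega> P u xu t"
    unfolding outer_derivative_def using lim by blast
  then have "R \<in> \<Q>" using consistent t unfolding consistent_rates_def by blast
  then show ?thesis using that \<sigma> lim by blast
qed

text \<open>If every increment were bad, the quotients would stay below -e along h i = a / (i + 1).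
  On a subsequence common to all z they converge to the sum of q z times (R v - Qlow v) at z, where
  v = \<open>semigroup a g\<close> and R \<in> \<Q>; this sum is non-negative.\<close>

lemma dini_step:
  assumes t: "t \<ge> 0" "u \<in> time_seqs_before t" "xu \<in> states u"
    and q: "\<And>z. q z \<ge> 0" and a: "a > 0" and e: "e > 0"
  shows "\<exists>h>0. h \<le> a \<and>
    (\<Sum>z\<in>UNIV. q z * (T u xu t (t + h) *v semigroup (a - h) g) $ z) -
    (\<Sum>z\<in>UNIV. q z * semigroup a g $ z) \<ge> - e * h"
proof (rule ccontr)
  let ?G = "\<lambda>h. (\<Sum>z\<in>UNIV. q z * (T u xu t (t + h) *v semigroup (a - h) g) $ z) -
    (\<Sum>z\<in>UNIV. q z * semigroup a g $ z)"
  assume "\<not> ?thesis"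
  then have neg: "?G h < - e * h" if "0 < h" "h \<le> a" for h using that by force
  define h where "h i = a * inverse (real (Suc i))" for i
  have h: "h \<longlonglongrightarrow> 0" "\<And>i. 0 < h i" "\<And>i. h i \<le> a"
    unfolding h_def using tendsto_mult_right_zero[OF LIMSEQ_inverse_real_of_nat, of a] a
    by (auto simp: field_simps)
  have hr: "filterlim h (at_right 0) sequentially"
    by (rule tendsto_imp_filterlim_at_right[OF h(1)]) (use h(2) in simp)
  obtain R \<sigma> where R: "R \<in> \<Q>" "strict_mono \<sigma>"
    "(\<lambda>i. (1 / h (\<sigma> i)) *\<^sub>R (T u xu t (t + h (\<sigma> i)) - mat 1)) \<longlonglongrightarrow> R"
    using difference_quotient_subsequence[OF t hr h(2)] by blast
  have h': "(\<lambda>i. h (\<sigma> i)) \<longlonglongrightarrow> 0"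
    using LIMSEQ_subseq_LIMSEQ[OF h(1) R(2)] by (simp add: o_def)
  note bwd = semigroup_backward_derivative[OF a h' h(2) h(3), of g]
  let ?Z = "\<lambda>i. \<Sum>z\<in>UNIV. q z * (((1 / h (\<sigma> i)) *\<^sub>R (T u xu t (t + h (\<sigma> i)) - mat 1)) *v semigroup (a - h (\<sigma> i)) g) $ z
       + q z * ((1 / h (\<sigma> i)) *\<^sub>R (semigroup (a - h (\<sigma> i)) g - semigroup a g)) $ z"
  let ?l = "\<Sum>z\<in>UNIV. q z * (R *v semigroup a g) $ z + q z * (- Qlow (semigroup a g)) $ z"
  have "?Z \<longlonglongrightarrow> ?l"
    by (intro tendsto_intros tendsto_vec_nth tendsto_matrix_vector_mult R bwd)
  moreover have "?Z i \<le> - e" for i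
  proof -
    have "?Z i
      = (1 / h (\<sigma> i)) * ?G (h (\<sigma> i))"
      unfolding sum_subtractf[symmetric] sum_distrib_left
      by (rule sum.cong)
        (auto simp: scaleR_matrix_vector_assoc[symmetric] matrix_vector_mult_diff_rdistrib algebra_simps diff_divide_distrib)
    also have "\<dots> \<le> - e" using neg[OF h(2,3), of "\<sigma> i"] h(2)[of "\<sigma> i"] by (simp add: field_simps)
    finally show ?thesis .
  qed
  ultimately have "?l \<le> - e"
    by (intro LIMSEQ_le_const2) auto
  moreover have "?l \<ge> 0"
  proof (rule sum_nonneg)
    fix z
    have "q z * Qlow (semigroup a g) $ z \<le> q z * (R *v semigroup a g) $ z"
      by (intro mult_left_mono Qlow_le R q)
    then show "0 \<le> q z * (R *v semigroup a g) $ z + q z * (- Qlow (semigroup a g)) $ z" by simp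
  qed
  ultimately show False using e by simp
qed

text \<open>With p r the law of the state at r given the history, \<psi> r averages
  \<open>semigroup (s - r) g\<close> over p r. At r = t this is the left side, at r = s the right
  side.\<close>

lemma semigroup_le_transition:
  assumes t: "t \<ge> 0" "u \<in> time_seqs_before t" "xu \<in> states u" and s: "t < s"
  shows "semigroup (s - t) g $ x \<le> (T u xu t s *v g) $ x"
proof -
  define w xw where "w = insert t u" and "xw = xu(t := x)"
  define p where "p r z = P (state_event \<Omega> r z) (joint_event \<Omega> w xw)" for r z
  \<comment> \<open>Transition matrices need a history strictly before their base time. At r = t it
    is u; at later r it also contains t with its state x.\<close>
  define H xH where "H r = (if r = t then u else w)" and "xH r = (if r = t then xu else xw)" for r
  have w: "w \<in> time_seqs" "xw \<in> states w" "\<And>r. r \<in> w \<Longrightarrow> r \<le> t"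
    using history_insert[OF t] unfolding w_def xw_def by auto
  have wr: "w \<in> time_seqs_before r" if "r > t" for r
    using w that by (force simp: time_seqs_before_def)
  have H: "H r \<in> time_seqs_before r" "xH r \<in> states (H r)" if "r \<ge> t" for r
    using w t wr[of r] that by (auto simp: H_def xH_def)
  have mem: "r \<in> w \<or> (\<forall>q\<in>w. q < r)" if "r \<ge> t" for r
    using w(3) that by (cases "r = t") (force simp: w_def)+
  have p0: "p r z \<ge> 0" if "r \<ge> t" for r z
    unfolding p_def using t that by (intro cond_nonneg dom_state w(1,2) mem) auto
  have p1: "(\<Sum>z\<in>UNIV. p r z) = 1" if "r \<ge> t" for r
    unfolding p_def using t that by (intro cond_state_sum w(1,2) mem) auto
  have ple: "p r z \<le> 1" if "r \<ge> t" for r z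
    using member_le_sum[of z UNIV "p r"] p0[OF that] p1[OF that] by simp
  have pt: "p t z = (if z = x then 1 else 0)" for z
  proof -
    have dom: "(state_event \<Omega> t z, joint_event \<Omega> w xw) \<in> process_domain \<Omega>"
      using t by (intro dom_state w(1,2) mem) auto
    have ne: "joint_event \<Omega> w xw \<noteq> {}" by (intro joint_event_nonempty path_space w(1,2))
    have "joint_event \<Omega> w xw = state_event \<Omega> t x \<inter> joint_event \<Omega> u xu"
      unfolding w_def xw_def using t by (intro joint_event_insert) (auto simp: time_seqs_before_def)
    then have "z = x \<Longrightarrow> joint_event \<Omega> w xw \<subseteq> state_event \<Omega> t z"
      "z \<noteq> x \<Longrightarrow> joint_event \<Omega> w xw \<inter> state_event \<Omega> t z = {}" by (auto simp: state_event_def)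
    then show ?thesis unfolding p_def using cond_eq_1[OF dom _ ne] cond_eq_0[OF dom _ ne] by auto
  qed
  \<comment> \<open>For r > t this is \<open>cond_total\<close> with the history kept. At r = t the
    law p t is a point mass at x.\<close>
  have chain: "p r' y = (\<Sum>z\<in>UNIV. p r z * T (H r) (xH r) r r' $ z $ y)" if "t \<le> r" "r < r'" for r r' y
  proof (cases "r = t")
    case True
    have "p r' y = T u xu t r' $ x $ y"
      unfolding transition_matrix_nth[OF t(2,3)] p_def w_def xw_def ..
    then show ?thesis using True by (simp add: pt H_def xH_def if_distrib[of "\<lambda>a. a * _"] cong: if_cong)
  next
    case False
    then have r: "r > t" using that by simp
    have "T (H r) (xH r) r r' $ z $ y = P (state_event \<Omega> r' y) (joint_event \<Omega> (insert r w) (xw(r := z)))" for z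
      using False transition_matrix_nth[OF wr[OF r] w(2)] by (simp add: H_def xH_def)
    then show ?thesis unfolding p_def using r that w t by (subst cond_total[of w xw r r' y]) force+
  qed
  have chain': "p r' y - p r y = (\<Sum>z\<in>UNIV. p r z * (T (H r) (xH r) r r' - mat 1) $ z $ y)"
    if "t \<le> r" "r < r'" for r r' y
    unfolding chain[OF that]
    by (simp add: mat_def right_diff_distrib sum_subtractf if_distrib[of "\<lambda>a. _ * a"] cong: if_cong)
  have diff: "\<bar>p r' y - p r y\<bar> \<le> real CARD('x) * c"
    if "t \<le> r" "r < r'" "\<And>z y. \<bar>(T (H r) (xH r) r r' - mat 1) $ z $ y\<bar> \<le> c" for r r' y c
  proof -
    have "\<bar>p r' y - p r y\<bar> \<le> (\<Sum>z\<in>UNIV. \<bar>p r z * (T (H r) (xH r) r r' - mat 1) $ z $ y\<bar>)"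
      unfolding chain'[OF that(1,2)] by (rule sum_abs)
    also have "\<dots> \<le> (\<Sum>z\<in>(UNIV :: 'x set). 1 * c)"
      unfolding abs_mult using ple p0 that by (intro sum_mono mult_mono) auto
    finally show ?thesis by simp
  qed
  have right: "((\<lambda>r'. p r' y) \<longlongrightarrow> p r y) (at_right r)" if r: "r \<ge> t" for r y
  proof -
    obtain K where K: "\<forall>\<^sub>F h in at_right 0. \<forall>x y. \<bar>(T (H r) (xH r) r (r + h) - mat 1) $ x $ y\<bar> \<le> K * h"
      using right_quotient_bound[OF _ H[OF r]] r t by auto
    show ?thesis
      unfolding filterlim_at_right_to_0[of _ _ r]
    proof (rule LIM_zero_cancel, rule Lim_null_comparison)
    show "\<forall>\<^sub>F h in at_right 0. norm (p (h + r) y - p r y) \<le> real CARD('x) * (K * h)"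
      using K eventually_at_right_less[of "0::real"]
    proof eventually_elim
      case (elim h)
      then show ?case using diff[OF r, of "r + h" "K * h" y] by (simp add: add.commute)
    qed
    show "((\<lambda>h. real CARD('x) * (K * h)) \<longlongrightarrow> 0) (at_right 0)"
      by (rule tendsto_eq_intros | simp)+
    qed
  qed
  \<comment> \<open>The left bound is stated for the history w, which is the one selected by
    \<open>H\<close> at r - h as soon as h < r - t.\<close>
  have left: "((\<lambda>r'. p r' y) \<longlongrightarrow> p r y) (at_left r)" if r: "r > t" for r y
  proof -
    obtain K where K: "\<forall>\<^sub>F h in at_right 0. \<forall>x y. \<bar>(T w xw (r - h) r - mat 1) $ x $ y\<bar> \<le> K * h"
      using left_quotient_bound[OF _ wr[OF r] w(2)] r t by auto
    show ?thesis
      unfolding filterlim_at_left_to_right[of _ _ r] filterlim_at_right_to_0[of _ _ "- r"]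
    proof (rule LIM_zero_cancel, rule Lim_null_comparison)
    have "\<forall>\<^sub>F h in at_right 0. h < r - t"
      using r by (intro order_tendstoD(2)[OF tendsto_ident_at]) simp
    then show "\<forall>\<^sub>F h in at_right 0. norm (p (- (h + - r)) y - p r y) \<le> real CARD('x) * (K * h)"
      using K eventually_at_right_less[of "0::real"]
    proof eventually_elim
      case (elim h)
      then have "\<bar>p r y - p (r - h) y\<bar> \<le> real CARD('x) * (K * h)"
        by (intro diff) (auto simp: H_def xH_def)
      then show ?case by (simp add: abs_minus_commute)
    qed
    show "((\<lambda>h. real CARD('x) * (K * h)) \<longlongrightarrow> 0) (at_right 0)"
      by (rule tendsto_eq_intros | simp)+
    qed
  qed
  have cont: "continuous_on {t..s} (\<lambda>r. p r y)" for y
    unfolding continuous_on_def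
  proof
    fix r assume r: "r \<in> {t..s}"
    show "((\<lambda>r. p r y) \<longlongrightarrow> p r y) (at r within {t..s})"
    proof (cases "r = t")
      case True
      then show ?thesis using right[of t] s by (simp add: at_within_Icc_at_right)
    next
      case False
      then have "((\<lambda>r. p r y) \<longlongrightarrow> p r y) (at r)"
        using right[of r] left[of r] r by (intro filterlim_split_at) auto
      then show ?thesis by (rule tendsto_within_subset) simp
    qed
  qed
  let ?\<psi> = "\<lambda>r. \<Sum>z\<in>UNIV. p r z * semigroup (s - r) g $ z"
  have "?\<psi> t \<le> ?\<psi> s"
  proof (rule nondecreasing_from_dini[where \<psi> = ?\<psi>])
    show "continuous_on {t..s} ?\<psi>" by (intro continuous_intros cont continuous_on_semigroup)
    fix r e :: real assume r: "t \<le> r" "r < s" "e > 0"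
    obtain h where h: "h > 0" "h \<le> s - r"
      "(\<Sum>z\<in>UNIV. p r z * (T (H r) (xH r) r (r + h) *v semigroup (s - r - h) g) $ z) -
        (\<Sum>z\<in>UNIV. p r z * semigroup (s - r) g $ z) \<ge> - e * h"
      using dini_step[OF _ H[OF r(1)], where q = "p r" and a = "s - r" and e = e and g = g] p0[OF r(1)] r t by auto
    have "(\<Sum>z\<in>UNIV. p r z * (T (H r) (xH r) r (r + h) *v semigroup (s - r - h) g) $ z)
      = (\<Sum>z\<in>UNIV. \<Sum>y\<in>UNIV. p r z * T (H r) (xH r) r (r + h) $ z $ y * semigroup (s - r - h) g $ y)"
      by (simp add: matrix_vector_mult_def sum_distrib_left mult.assoc)
    also have "\<dots> = (\<Sum>y\<in>UNIV. p (r + h) y * semigroup (s - r - h) g $ y)"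
      using h(1) chain[OF r(1), of "r + h"] by (subst sum.swap) (simp add: sum_distrib_right)
    finally show "\<exists>h>0. r + h \<le> s \<and> - e * h \<le> ?\<psi> (r + h) - ?\<psi> r"
      using h by (intro exI[of _ h]) (simp add: diff_diff_eq)
  qed (use s in simp)
  moreover have "?\<psi> t = semigroup (s - t) g $ x" by (simp add: pt if_distrib[of "\<lambda>a. a * _"] cong: if_cong)
  moreover have "?\<psi> s = (T u xu t s *v g) $ x"
    by (simp add: semigroup_0 matrix_vector_mult_def transition_matrix_nth[OF t(2,3)] p_def w_def xw_def)
  ultimately show ?thesis by simp
qed

text \<open>\<open>compose_ops\<close> applies the operator of the last interval first, so the
  induction peels off the last time. Joint probabilities are non-negative, which preserves the
  conditional inequality under averaging.\<close>

lemma compose_ops_le_expectation: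
  assumes "strict_mono_on {..n} t" "t 0 = 0"
  shows "(\<Sum>x\<in>UNIV. P (state_event \<Omega> 0 x) \<Omega> * compose_ops (lower_trans Qlow) t n f (\<lambda>_\<in>{t 0}. x))
    \<le> (\<Sum>xu\<in>states (t ` {..n}). f xu * P (joint_event \<Omega> (t ` {..n}) xu) \<Omega>)"
  using assms(1)
proof (induction n arbitrary: f)
  case 0
  have "(\<Sum>xu\<in>states {0}. f xu * P (joint_event \<Omega> {0} xu) \<Omega>) =
    (\<Sum>xu\<in>states {}. \<Sum>x\<in>UNIV. f (xu(0 := x)) * P (joint_event \<Omega> {0} (xu(0 := x))) \<Omega>)"
    by (rule sum_states_insert) simp
  also have "\<dots> = (\<Sum>x\<in>UNIV. f (\<lambda>_\<in>{0}. x) * P (state_event \<Omega> 0 x) \<Omega>)"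
  proof -
    have "joint_event \<Omega> {0} (\<lambda>_\<in>{0}. x) = state_event \<Omega> 0 x" for x
      by (auto simp: joint_event_def state_event_def restrict_def fun_eq_iff)
    moreover have "(\<lambda>_. undefined)(0 := x) = (\<lambda>_\<in>{0 :: real}. x)" for x :: 'x by (auto simp: restrict_def)
    moreover have "states {} = {\<lambda>_. undefined :: 'x}" by (auto simp: states_def)
    ultimately show ?thesis by (simp del: fun_upd_apply)
  qed
  finally show ?case
    by (simp only: compose_ops.simps assms(2) atMost_0 image_insert image_empty mult.commute order_refl)
next
  case (Suc n)
  let ?w = "t ` {..n}" and ?u = "t ` {..<n}" and ?s = "t (Suc n)" and ?r = "t n"
  let ?L = "lower_trans Qlow"
  let ?p = "\<lambda>xw y. P (state_event \<Omega> ?s y) (joint_event \<Omega> ?w xw)" and ?q = "\<lambda>xw. P (joint_event \<Omega> ?w xw) \<Omega>"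
  have mono: "i < j \<Longrightarrow> j \<le> Suc n \<Longrightarrow> t i < t j" for i j
    using Suc.prems by (auto simp: strict_mono_on_def)
  have nonneg: "t i \<ge> 0" if "i \<le> Suc n" for i
    using mono[of 0 i] that assms(2) by (cases i) auto
  have w: "?w \<in> time_seqs" using nonneg by (auto simp: time_seqs_def)
  have u: "?u \<in> time_seqs_before ?r" using nonneg mono by (auto simp: time_seqs_def time_seqs_before_def)
  have ws: "\<forall>q\<in>?w. q < ?s" using mono by auto
  have wu: "?w = insert ?r ?u" by (simp add: lessThan_Suc_atMost[symmetric] lessThan_Suc)
  have Max: "Max ?w = ?r"
    by (rule Max_eqI) (use mono less_imp_le in \<open>auto simp: le_less\<close>)
  have ins: "t ` {..Suc n} = insert ?s ?w" by (simp add: atMost_Suc)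
  have "(\<Sum>x\<in>UNIV. P (state_event \<Omega> 0 x) \<Omega> * compose_ops ?L t (Suc n) f (\<lambda>_\<in>{t 0}. x))
    \<le> (\<Sum>xw\<in>states ?w. extend_op ?L ?w ?s f xw * ?q xw)"
    unfolding compose_ops.simps
    by (rule Suc.IH) (use Suc.prems in \<open>simp add: strict_mono_on_def\<close>)
  also have "\<dots> \<le> (\<Sum>xw\<in>states ?w. (\<Sum>y\<in>UNIV. f (xw(?s := y)) * ?p xw y)
      * ?q xw)"
  proof (rule sum_mono, rule mult_right_mono)
    fix xw :: "real \<Rightarrow> 'x" assume xw: "xw \<in> states ?w"
    let ?g = "\<chi> y. f (xw(?s := y))"
    have ru: "(restrict xw ?u)(?r := xw ?r) = xw"
      using xw mono by (auto simp: wu states_def fun_eq_iff restrict_def PiE_def extensional_def)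
    have "extend_op ?L ?w ?s f xw = semigroup (?s - ?r) ?g $ xw ?r"
      unfolding extend_op_def Max using mono[of n "Suc n"] by (simp add: lower_trans_eq)
    also have "\<dots> \<le> (T ?u (restrict xw ?u) ?r ?s *v ?g) $ xw ?r"
      using mono nonneg by (intro semigroup_le_transition u states_restrict) auto
    also have "\<dots> = (\<Sum>y\<in>UNIV. f (xw(?s := y)) * ?p xw y)"
      by (simp add: matrix_vector_mult_def transition_matrix_nth[OF u states_restrict] ru wu[symmetric] mult.commute)
    finally show "extend_op ?L ?w ?s f xw \<le> \<dots>" .
    have "(joint_event \<Omega> ?w xw, joint_event \<Omega> {} (\<lambda>_. undefined)) \<in> process_domain \<Omega>"
      using w xw by (intro process_domain_joint joint_event_in_events_from) (auto simp: time_seqs_def states_def)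
    then show "0 \<le> ?q xw"
      using cond_nonneg by (simp add: joint_event_empty states_def)
  qed
  also have "\<dots> = (\<Sum>xu\<in>states (t ` {..Suc n}). f xu * P (joint_event \<Omega> (t ` {..Suc n}) xu) \<Omega>)"
    unfolding ins
  proof (subst sum_states_insert)
    show "?s \<notin> ?w" using ws by auto
    show "(\<Sum>xw\<in>states ?w. (\<Sum>y\<in>UNIV. f (xw(?s := y)) * ?p xw y)
      * ?q xw) =
      (\<Sum>xw\<in>states ?w. \<Sum>y\<in>UNIV. f (xw(?s := y)) * P (joint_event \<Omega> (insert ?s ?w) (xw(?s := y))) \<Omega>)"
      unfolding sum_distrib_right
      by (intro sum.cong refl, subst cond_chain[OF w]) (use ws nonneg[of "Suc n"] in auto)
  qed
  finally show ?case .
qed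

end

section \<open>Finite-horizon chains with memory\<close>

text \<open>The conditional expectation of \<phi> at the history reached after j further steps from
  h. Histories list the states with the oldest first: the state at step i has index i, and the
  current state is the last one.\<close>

fun run :: "('x::finite list \<Rightarrow> 'x \<Rightarrow> real) \<Rightarrow> nat \<Rightarrow> ('x list \<Rightarrow> real) \<Rightarrow> 'x list \<Rightarrow> real" where
  "run k 0 \<phi> h = \<phi> h"
| "run k (Suc j) \<phi> h = (\<Sum>y\<in>UNIV. k h y * run k j \<phi> (h @ [y]))"

text \<open>The initial state is already one entry, so after j steps the histories have length Suc
  j.\<close>

definition mean :: "('x::finite \<Rightarrow> real) \<Rightarrow> ('x list \<Rightarrow> 'x \<Rightarrow> real) \<Rightarrow> nat \<Rightarrow> ('x list \<Rightarrow> real) \<Rightarrow> real" where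
  "mean p k j \<phi> = (\<Sum>x\<in>UNIV. p x * run k j \<phi> [x])"

lemma run_cong:
  "(\<And>z. length z = j \<Longrightarrow> \<phi> (h @ z) = \<psi> (h @ z)) \<Longrightarrow> run k j \<phi> h = run k j \<psi> h"
proof (induction j arbitrary: h)
  case 0
  from 0[of "[]"] show ?case by simp
next
  case (Suc j)
  have "run k j \<phi> (h @ [y]) = run k j \<psi> (h @ [y])" for y
    by (rule Suc.IH) (use Suc.prems[of "y # _"] in simp)
  then show ?case by simp
qed

lemma run_plus: "run k (i + j) \<phi> h = run k i (run k j \<phi>) h"
  by (induction i arbitrary: h) simp_all

lemma run_sum: "run k j (\<lambda>h. \<Sum>i\<in>I. c i * \<phi> i h) h = (\<Sum>i\<in>I. c i * run k j (\<phi> i) h)"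
proof (induction j arbitrary: h)
  case (Suc j)
  then show ?case
    by (simp add: sum_distrib_left) (subst sum.swap, simp add: mult.left_commute)
qed simp

lemma run_scale: "run k j (\<lambda>h. c * \<phi> h) h = c * run k j \<phi> h"
  using run_sum[of k j "\<lambda>_. c" "\<lambda>_. \<phi>" "{()}"] by simp

lemma mean_sum: "mean p k j (\<lambda>h. \<Sum>i\<in>I. c i * \<phi> i h) = (\<Sum>i\<in>I. c i * mean p k j (\<phi> i))"
  unfolding mean_def run_sum sum_distrib_left by (subst sum.swap) (simp add: mult.left_commute)

lemma mean_scale: "mean p k j (\<lambda>h. c * \<phi> h) = c * mean p k j \<phi>"
  using mean_sum[of p k j "\<lambda>_. c" "\<lambda>_. \<phi>" "{()}"] by simp

locale positive_kernel =
  fixes k :: "'x::finite list \<Rightarrow> 'x \<Rightarrow> real"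
  assumes kernel_pos: "\<And>h y. h \<noteq> [] \<Longrightarrow> k h y > 0" and kernel_sum: "\<And>h. h \<noteq> [] \<Longrightarrow> (\<Sum>y\<in>UNIV. k h y) = 1"
begin

lemma run_mono:
  "h \<noteq> [] \<Longrightarrow> (\<And>z. length z = j \<Longrightarrow> \<phi> (h @ z) \<le> \<psi> (h @ z)) \<Longrightarrow> run k j \<phi> h \<le> run k j \<psi> h"
proof (induction j arbitrary: h)
  case 0
  from 0(2)[of "[]"] show ?case by simp
next
  case (Suc j)
  have "run k j \<phi> (h @ [y]) \<le> run k j \<psi> (h @ [y])" for y
    by (rule Suc.IH) (use Suc.prems(2)[of "y # _"] in simp_all)
  then show ?case using less_imp_le[OF kernel_pos[OF Suc.prems(1)]] by (auto intro!: sum_mono mult_left_mono)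
qed

lemma run_const: "h \<noteq> [] \<Longrightarrow> (\<And>z. length z = j \<Longrightarrow> \<phi> (h @ z) = c) \<Longrightarrow> run k j \<phi> h = c"
proof (induction j arbitrary: h)
  case 0
  from 0(2)[of "[]"] show ?case by simp
next
  case (Suc j)
  have "run k j \<phi> (h @ [y]) = c" for y
    by (rule Suc.IH) (use Suc.prems(2)[of "y # _"] in simp_all)
  then show ?case using kernel_sum[OF Suc.prems(1)] by (simp add: sum_distrib_right[symmetric])
qed

lemma run_nonneg: "h \<noteq> [] \<Longrightarrow> (\<And>h. \<phi> h \<ge> 0) \<Longrightarrow> run k j \<phi> h \<ge> 0"
  using run_mono[of h j "\<lambda>_. 0" \<phi>] run_const[of h j "\<lambda>_. 0" 0] by simp

text \<open>The one continuation z with positive payoff has positive weight, and the others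
  contribute nothing negative.\<close>

lemma run_pos:
  "h \<noteq> [] \<Longrightarrow> (\<And>h. \<phi> h \<ge> 0) \<Longrightarrow> length z = j \<Longrightarrow> \<phi> (h @ z) > 0 \<Longrightarrow> run k j \<phi> h > 0"
proof (induction j arbitrary: h z)
  case (Suc j)
  then obtain y z' where z: "z = y # z'" "length z' = j" by (cases z) auto
  have "run k j \<phi> (h @ [y]) > 0" by (rule Suc.IH[of _ z']) (use Suc.prems z in auto)
  then have "0 < k h y * run k j \<phi> (h @ [y])" using kernel_pos Suc.prems(1) by simp
  also have "\<dots> \<le> run k (Suc j) \<phi> h"
    unfolding run.simps
    by (rule member_le_sum[of y])
      (use less_imp_le[OF kernel_pos[OF Suc.prems(1)]] run_nonneg[of "h @ [_]" \<phi> j] Suc.prems(2)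
        in \<open>auto intro: mult_nonneg_nonneg\<close>)
  finally show ?case .
qed simp

end

locale positive_chain = positive_kernel k for k :: "'x::finite list \<Rightarrow> 'x \<Rightarrow> real" +
  fixes p :: "'x \<Rightarrow> real"
  assumes initial_pos: "\<And>x. p x > 0" and initial_sum: "(\<Sum>x\<in>UNIV. p x) = 1"
begin

lemma mean_mono:
  assumes "\<And>h. length h = Suc j \<Longrightarrow> \<phi> h \<le> \<psi> h"
  shows "mean p k j \<phi> \<le> mean p k j \<psi>"
  unfolding mean_def
  by (intro sum_mono mult_left_mono run_mono less_imp_le[OF initial_pos]) (auto intro: assms)

lemma mean_cong:
  assumes "\<And>h. length h = Suc j \<Longrightarrow> \<phi> h = \<psi> h"
  shows "mean p k j \<phi> = mean p k j \<psi>"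
  using mean_mono[of j \<phi> \<psi>] mean_mono[of j \<psi> \<phi>] assms by fastforce

lemma mean_const: "(\<And>h. length h = Suc j \<Longrightarrow> \<phi> h = c) \<Longrightarrow> mean p k j \<phi> = c"
  unfolding mean_def using run_const[of "[_]" j \<phi> c] initial_sum
  by (simp add: sum_distrib_right[symmetric])

lemma mean_nonneg: "(\<And>h. \<phi> h \<ge> 0) \<Longrightarrow> mean p k j \<phi> \<ge> 0"
  using mean_mono[of j "\<lambda>_. 0" \<phi>] mean_const[of j "\<lambda>_. 0" 0] by simp

lemma mean_pos:
  assumes "\<And>h. \<phi> h \<ge> 0" "length z = Suc j" "\<phi> z > 0"
  shows "mean p k j \<phi> > 0"
proof -
  obtain x z' where z: "z = x # z'" "length z' = j" using assms(2) by (cases z) auto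
  have "run k j \<phi> [x] > 0" by (rule run_pos[of _ _ z']) (use assms z in auto)
  then have "0 < p x * run k j \<phi> [x]" using initial_pos by simp
  also have "\<dots> \<le> mean p k j \<phi>"
    unfolding mean_def
    by (rule member_le_sum[of x])
      (use less_imp_le[OF initial_pos] run_nonneg[of "[_]" \<phi> j] assms(1) in \<open>auto intro: mult_nonneg_nonneg\<close>)
  finally show ?thesis .
qed

text \<open>
  A bound that holds for each complete history in \<open>V\<close> survives conditioning on \<open>V\<close>, with no knowledge
  of the weights of the individual histories.
\<close>

lemma mean_history_ge:
  assumes jm: "i + m \<le> j"
    and V: "\<And>h. h \<in> V \<Longrightarrow> length h = Suc i"
    and b: "\<And>h. h \<in> V \<Longrightarrow> run k m (\<lambda>h. g (last h)) h \<ge> b"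
  shows "mean p k j (\<lambda>h. indicator V (take (Suc i) h) * g (h ! (i + m)))
    \<ge> b * mean p k j (\<lambda>h. indicator V (take (Suc i) h))"
proof -
  \<comment> \<open>The first i steps decide membership in V and m further steps reach the observed
    time. The payoff is constant over the r remaining ones, so they average out.\<close>
  obtain r where j: "j = i + (m + r)" using jm by (metis le_Suc_ex add.assoc)
  let ?\<phi> = "\<lambda>h. indicator V (take (Suc i) h) * g (h ! (i + m))" and ?\<psi> = "\<lambda>h. b * indicator V (take (Suc i) h)"
  have "run k (m + r) ?\<psi> h \<le> run k (m + r) ?\<phi> h" if h: "length h = Suc i" for h
  proof -
    have h0: "h \<noteq> []" using h by auto
    have 1: "run k (m + r) ?\<psi> h = b * indicator V h"
      by (rule run_const[OF h0]) (use h in simp)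
    have "run k (m + r) ?\<phi> h = run k (m + r) (\<lambda>h'. indicator V h * g (h' ! (i + m))) h"
      by (rule run_cong) (use h in simp)
    also have "\<dots> = indicator V h * run k m (run k r (\<lambda>h'. g (h' ! (i + m)))) h"
      by (simp add: run_scale run_plus)
    also have "run k m (run k r (\<lambda>h'. g (h' ! (i + m)))) h = run k m (\<lambda>h. g (last h)) h"
    proof (rule run_cong)
      fix z :: "'x list" assume z: "length z = m"
      have "h @ z \<noteq> []" "length (h @ z) = Suc (i + m)" using h0 h z by auto
      then show "run k r (\<lambda>h'. g (h' ! (i + m))) (h @ z) = g (last (h @ z))"
        by (intro run_const) (auto simp: last_conv_nth nth_append)
    qed
    finally show ?thesis unfolding 1 using b[of h] by (simp add: indicator_def)
  qed
  then have "mean p k j ?\<psi> \<le> mean p k j ?\<phi>"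
    unfolding mean_def j run_plus[of k i]
    by - (rule sum_mono, rule mult_left_mono, rule run_mono, auto intro: less_imp_le[OF initial_pos])
  then show ?thesis by (simp only: mean_scale)
qed

end

section \<open>Cylinder events\<close>

lemma path_agree:
  fixes g :: "real \<Rightarrow> 'x"
  assumes "path_space \<Omega>" "v \<in> time_seqs"
  obtains \<omega> where "\<omega> \<in> \<Omega>" "\<And>r. r \<in> v \<Longrightarrow> \<omega> r = g r"
proof -
  obtain \<omega> where "\<omega> \<in> joint_event \<Omega> v (restrict g v)"
    using joint_event_nonempty[OF assms states_restrict] by blast
  then have "\<omega> \<in> \<Omega>" "restrict \<omega> v = restrict g v" by (auto simp: joint_event_def)
  then show ?thesis using that by (metis restrict_apply')
qed

text \<open>
  The paths of the approximating chains need not lie in \<open>\<Omega>\<close>. An event depends on finitely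
  many times only, and so has a canonical extension to all paths.
\<close>

definition ext_event :: "(real \<Rightarrow> 'x) set \<Rightarrow> (real \<Rightarrow> 'x) set \<Rightarrow> (real \<Rightarrow> 'x) set" where
  "ext_event \<Omega> A = {g. \<exists>v\<in>time_seqs. \<forall>\<omega>\<in>\<Omega>. (\<forall>r\<in>v. \<omega> r = g r) \<longrightarrow> \<omega> \<in> A}"

definition depends_on :: "(real \<Rightarrow> 'x) set \<Rightarrow> (real \<Rightarrow> 'x) set \<Rightarrow> real set \<Rightarrow> bool" where
  "depends_on \<Omega> A v \<longleftrightarrow> (\<forall>\<omega>\<in>\<Omega>. \<forall>\<omega>'\<in>\<Omega>. (\<forall>r\<in>v. \<omega> r = \<omega>' r) \<longrightarrow> (\<omega> \<in> A \<longleftrightarrow> \<omega>' \<in> A))"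

lemma depends_onI:
  "(\<And>\<omega> \<omega>'. \<lbrakk>\<omega> \<in> \<Omega>; \<omega>' \<in> \<Omega>; \<And>r. r \<in> v \<Longrightarrow> \<omega> r = \<omega>' r\<rbrakk> \<Longrightarrow> \<omega> \<in> A \<longleftrightarrow> \<omega>' \<in> A) \<Longrightarrow> depends_on \<Omega> A v"
  unfolding depends_on_def by blast

lemma depends_onD:
  "\<lbrakk>depends_on \<Omega> A v; \<omega> \<in> \<Omega>; \<omega>' \<in> \<Omega>; \<And>r. r \<in> v \<Longrightarrow> \<omega> r = \<omega>' r\<rbrakk> \<Longrightarrow> \<omega> \<in> A \<longleftrightarrow> \<omega>' \<in> A"
  unfolding depends_on_def by blast

lemma depends_on_mono: "depends_on \<Omega> A v \<Longrightarrow> v \<subseteq> w \<Longrightarrow> depends_on \<Omega> A w"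
  unfolding depends_on_def by blast

text \<open>Two finite sets of times on which membership is decided can be merged, and some path in
  \<Omega> agrees with g on the union. Hence every support gives the same answer.\<close>

lemma ext_event_iff:
  assumes "path_space \<Omega>" "v \<in> time_seqs" "depends_on \<Omega> A v" "\<omega> \<in> \<Omega>" "\<And>r. r \<in> v \<Longrightarrow> \<omega> r = g r"
  shows "g \<in> ext_event \<Omega> A \<longleftrightarrow> \<omega> \<in> A"
proof
  assume "\<omega> \<in> A"
  then have "\<forall>\<omega>'\<in>\<Omega>. (\<forall>r\<in>v. \<omega>' r = g r) \<longrightarrow> \<omega>' \<in> A"
    using assms(3-5) unfolding depends_on_def by metis
  then show "g \<in> ext_event \<Omega> A" unfolding ext_event_def using assms(2) by blast
next
  assume "g \<in> ext_event \<Omega> A"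
  then obtain w where w: "w \<in> time_seqs" "\<And>\<omega>. \<omega> \<in> \<Omega> \<Longrightarrow> (\<forall>r\<in>w. \<omega> r = g r) \<Longrightarrow> \<omega> \<in> A"
    unfolding ext_event_def by blast
  have "w \<union> v \<in> time_seqs" using w(1) assms(2) by (auto simp: time_seqs_def)
  then obtain \<omega>' where \<omega>': "\<omega>' \<in> \<Omega>" "\<And>r. r \<in> w \<union> v \<Longrightarrow> \<omega>' r = g r"
    using path_agree[OF assms(1), of "w \<union> v" g] by blast
  then have "\<omega>' \<in> A" by (intro w) auto
  then show "\<omega> \<in> A" using assms(3-5) \<omega>' unfolding depends_on_def by (metis UnI2)
qed

lemma depends_on_joint_event: "depends_on \<Omega> (joint_event \<Omega> u xu) u"
proof -
  have "(\<forall>r\<in>u. \<omega> r = \<omega>' r) \<Longrightarrow> restrict \<omega> u = restrict \<omega>' u" for \<omega> \<omega>' :: "real \<Rightarrow> 'a"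
    by (rule restrict_ext) simp
  then show ?thesis unfolding depends_on_def joint_event_def by auto
qed

lemma depends_on_state_event: "depends_on \<Omega> (state_event \<Omega> t x) {t}"
  unfolding depends_on_def state_event_def by auto

text \<open>Events with a finite support form an algebra that contains the generators, hence also
  the algebra generated by them.\<close>

lemma events_from_depends_on:
  assumes "A \<in> events_from \<Omega> u"
  shows "\<exists>v\<in>time_seqs. depends_on \<Omega> A v"
proof -
  let ?S = "{state_event \<Omega> t x | t x. t \<ge> 0 \<and> (t \<in> u \<or> (\<forall>r\<in>u. t > r))}"
  let ?K = "{A. A \<subseteq> \<Omega> \<and> (\<exists>v\<in>time_seqs. depends_on \<Omega> A v)}"
  have "state_event \<Omega> t x \<in> ?K" if "t \<ge> 0" for t x
  proof -
    have "{t} \<in> time_seqs" using that by (simp add: time_seqs_def)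
    moreover have "state_event \<Omega> t x \<subseteq> \<Omega>" by (auto simp: state_event_def)
    ultimately show ?thesis using depends_on_state_event[of \<Omega> t x] by auto
  qed
  then have "?S \<subseteq> ?K" by auto
  moreover have "algebra \<Omega> ?K"
  proof (rule iffD2[OF algebra_iff_Un], intro conjI ballI)
    show "{} \<in> ?K" by (auto simp: depends_on_def time_seqs_def)
    fix A assume A: "A \<in> ?K"
    then obtain v where v: "v \<in> time_seqs" "depends_on \<Omega> A v" by auto
    have "depends_on \<Omega> (\<Omega> - A) v"
      by (rule depends_onI) (use depends_onD[OF v(2)] in blast)
    with v(1) show "\<Omega> - A \<in> ?K" by auto
    fix A' assume A': "A' \<in> ?K"
    then obtain v' where v': "v' \<in> time_seqs" "depends_on \<Omega> A' v'" by auto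
    have "depends_on \<Omega> (A \<union> A') (v \<union> v')"
    proof (rule depends_onI)
      fix \<omega> \<omega>' assume w: "\<omega> \<in> \<Omega>" "\<omega>' \<in> \<Omega>" "\<And>r. r \<in> v \<union> v' \<Longrightarrow> \<omega> r = \<omega>' r"
      have "\<omega> \<in> A \<longleftrightarrow> \<omega>' \<in> A" by (rule depends_onD[OF v(2) w(1,2)]) (simp add: w(3))
      moreover have "\<omega> \<in> A' \<longleftrightarrow> \<omega>' \<in> A'" by (rule depends_onD[OF v'(2) w(1,2)]) (simp add: w(3))
      ultimately show "\<omega> \<in> A \<union> A' \<longleftrightarrow> \<omega>' \<in> A \<union> A'" by simp
    qed
    moreover have "v \<union> v' \<in> time_seqs" using v v' by (auto simp: time_seqs_def)
    ultimately show "A \<union> A' \<in> ?K" using A A' by auto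
  qed auto
  ultimately have "algebra \<Omega> hull ?S \<subseteq> ?K" by (rule hull_minimal)
  then show ?thesis using assms unfolding events_from_def by blast
qed

lemma ext_joint_event:
  assumes "path_space \<Omega>" "u \<in> time_seqs"
  shows "g \<in> ext_event \<Omega> (joint_event \<Omega> u xu) \<longleftrightarrow> restrict g u = xu"
proof -
  obtain \<omega> where w: "\<omega> \<in> \<Omega>" "\<And>r. r \<in> u \<Longrightarrow> \<omega> r = g r" using path_agree[OF assms] by blast
  have "restrict \<omega> u = restrict g u" by (rule restrict_ext) (rule w(2))
  then show ?thesis using ext_event_iff[OF assms depends_on_joint_event w] w(1) by (simp add: joint_event_def)
qed

lemma ext_state_event:
  assumes "path_space \<Omega>" "t \<ge> 0"
  shows "g \<in> ext_event \<Omega> (state_event \<Omega> t x) \<longleftrightarrow> g t = x"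
proof -
  have t: "{t} \<in> time_seqs" using assms(2) by (simp add: time_seqs_def)
  obtain \<omega> where w: "\<omega> \<in> \<Omega>" "\<And>r. r \<in> {t} \<Longrightarrow> \<omega> r = g r" using path_agree[OF assms(1) t] by blast
  then show ?thesis using ext_event_iff[OF assms(1) t depends_on_state_event w] by (simp add: state_event_def)
qed

section \<open>Generalized limits\<close>

text \<open>A subsequence does not suffice here, because the index set is uncountable in the application.\<close>

lemma pointwise_limit_along_filter:
  fixes a :: "nat \<Rightarrow> 'i \<Rightarrow> real"
  assumes "\<And>n i. a n i \<in> {0..1}"
  obtains G l where "G \<noteq> bot" "G \<le> sequentially" "\<And>i. ((\<lambda>n. a n i) \<longlongrightarrow> l i) G"
proof -
  let ?X = "PiE UNIV (\<lambda>_::'i. {0..1::real})"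
  have "compactin (product_topology (\<lambda>_::'i. euclidean) UNIV) ?X"
    by (subst compactin_PiE) auto
  then have X: "compact ?X" by (simp add: euclidean_product_topology)
  have "filtermap a sequentially \<noteq> bot" by (simp add: filtermap_bot_iff)
  moreover have "\<forall>\<^sub>F x in filtermap a sequentially. x \<in> ?X"
    using assms by (auto simp: eventually_filtermap PiE_iff intro!: always_eventually)
  ultimately obtain l where l: "inf (nhds l) (filtermap a sequentially) \<noteq> bot"
    using X unfolding compact_filter by blast
  \<comment> \<open>With l a cluster point of the sequence in the compact product, pulling its
    neighbourhoods back to the indices gives a filter along which the sequence converges to l. That
    l is a cluster point makes the filter proper.\<close>
  let ?G = "inf sequentially (filtercomap a (nhds l))"
  have "?G \<noteq> bot"
  proof
    assume "?G = bot"
    then have "eventually (\<lambda>_. False) ?G" by simp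
    then obtain Q R where Q: "eventually Q sequentially" "eventually R (filtercomap a (nhds l))" "\<And>n. Q n \<Longrightarrow> R n \<Longrightarrow> False"
      unfolding eventually_inf by blast
    obtain S where S: "eventually S (nhds l)" "\<And>n. S (a n) \<Longrightarrow> R n"
      using Q(2) unfolding eventually_filtercomap by blast
    have "eventually (\<lambda>x. \<not> S x) (filtermap a sequentially)"
      unfolding eventually_filtermap using Q(1) by eventually_elim (use S Q in blast)
    then have "eventually (\<lambda>_. False) (inf (nhds l) (filtermap a sequentially))"
      unfolding eventually_inf using S(1) by blast
    then show False using l by (simp add: trivial_limit_def)
  qed
  moreover have "((\<lambda>n. a n i) \<longlongrightarrow> l i) ?G" for i
  proof -
    have "filterlim a (nhds l) ?G"
      by (rule filterlim_mono[OF filterlim_filtercomap order_refl inf_le2])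
    moreover have "((\<lambda>x. x i) \<longlongrightarrow> l i) (nhds l)"
    proof (rule topological_tendstoI)
      fix S :: "real set" assume S: "open S" "l i \<in> S"
      have "open ((\<lambda>x. x i) -` S)"
        by (rule open_vimage[OF S(1)]) (rule continuous_on_product_coordinates)
      then show "\<forall>\<^sub>F x in nhds l. x i \<in> S"
        unfolding eventually_nhds using S(2) by (intro exI[of _ "(\<lambda>x. x i) -` S"]) auto
    qed
    ultimately show ?thesis by (rule filterlim_compose[rotated])
  qed
  ultimately show ?thesis using that[of ?G l] by simp
qed

section \<open>Dynamic programming\<close>

text \<open>The Bellman recursion: the value of the history h with j steps to go, when T gives the
  least expectation over one step.\<close>

fun backward :: "'x::finite operator \<Rightarrow> ('x list \<Rightarrow> real) \<Rightarrow> nat \<Rightarrow> 'x list \<Rightarrow> real" where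
  "backward T \<phi> 0 h = \<phi> h"
| "backward T \<phi> (Suc j) h = T (\<chi> y. backward T \<phi> j (h @ [y])) $ last h"

lemma backward_cong:
  "(\<And>z. length z = j \<Longrightarrow> \<phi> (h @ z) = \<psi> (h @ z)) \<Longrightarrow> backward T \<phi> j h = backward T \<psi> j h"
proof (induction j arbitrary: h)
  case 0
  from 0[of "[]"] show ?case by simp
next
  case (Suc j)
  have "backward T \<phi> j (h @ [y]) = backward T \<psi> j (h @ [y])" for y
    by (rule Suc.IH) (use Suc.prems[of "y # _"] in simp)
  then show ?case by simp
qed

lemma backward_plus: "backward T \<phi> (i + j) h = backward T (backward T \<phi> j) i h"
  by (induction i arbitrary: h) simp_all

lemma backward_abs_le:
  assumes "lower_transition_operator T" and "\<And>h. \<bar>\<phi> h\<bar> \<le> c"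
  shows "\<bar>backward T \<phi> j h\<bar> \<le> c"
proof (induction j arbitrary: h)
  case (Suc j)
  show ?case unfolding backward.simps
    by (rule lower_transition_abs_le[OF assms(1)]) (simp add: Suc)
qed (simp add: assms)

lemma backward_last:
  assumes "h \<noteq> []" and "\<And>z. length z = j \<Longrightarrow> \<phi> (h @ z) = g $ last (h @ z)"
  shows "backward T \<phi> j h = (T ^^ j) g $ last h"
  using assms
proof (induction j arbitrary: h)
  case 0
  from 0(2)[of "[]"] show ?case by simp
next
  case (Suc j)
  have "backward T \<phi> j (h @ [y]) = (T ^^ j) g $ y" for y
    using Suc.IH[of "h @ [y]"] Suc.prems(2)[of "y # _"] by simp
  then show ?case by simp
qed

text \<open>Between two consecutive observed times the value depends on the new current state alone,
  the earlier observed states being fixed, so the steps between them collapse into a power of T.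
  Distinct grid positions keep the observed times apart.\<close>

lemma backward_eq_compose_ops:
  assumes "\<And>i j. i < j \<Longrightarrow> j \<le> m \<Longrightarrow> dyadic n (t i) < dyadic n (t j)" and "t 0 = 0"
    and "\<And>i j. i < j \<Longrightarrow> j \<le> m \<Longrightarrow> t i < t j"
  shows "backward T (\<lambda>h. f (\<lambda>r\<in>t ` {..m}. h ! dyadic n r)) (dyadic n (t m)) [x]
    = compose_ops (\<lambda>a b. T ^^ (dyadic n b - dyadic n a)) t m f (\<lambda>_\<in>{t 0}. x)"
  using assms(1,3)
proof (induction m arbitrary: f)
  case 0
  have "dyadic n (t 0) = 0" by (simp add: dyadic_def assms(2))
  moreover have "(\<lambda>r\<in>{t 0}. [x] ! dyadic n r) = (\<lambda>_\<in>{t 0}. x)"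
    by (rule restrict_ext) (simp add: calculation)
  ultimately show ?case by (simp only: backward.simps compose_ops.simps atMost_0 image_insert image_empty)
next
  case (Suc m)
  let ?L = "\<lambda>a b. T ^^ (dyadic n b - dyadic n a)" and ?w = "t ` {..m}" and ?s = "t (Suc m)"
  let ?i = "dyadic n (t m)" and ?j = "dyadic n ?s - dyadic n (t m)"
  let ?\<phi> = "\<lambda>h. f (\<lambda>r\<in>t ` {..Suc m}. h ! dyadic n r)"
  have j: "?j > 0" "dyadic n ?s = ?i + ?j" using Suc.prems(1)[of m "Suc m"] by auto
  have ins: "t ` {..Suc m} = insert ?s ?w" by (simp add: atMost_Suc)
  have sw: "?s \<notin> ?w"
  proof
    assume "?s \<in> ?w"
    then obtain i where "i \<le> m" "t i = ?s" by auto
    then show False using Suc.prems(2)[of i "Suc m"] by simp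
  qed
  have Max: "Max ?w = t m" by (rule Max_eqI) (use Suc.prems(2) less_imp_le in \<open>auto simp: le_less\<close>)
  have le: "dyadic n r \<le> ?i" if "r \<in> ?w" for r using Max_ge[OF _ that] by (simp add: Max dyadic_mono)
  have "backward T ?\<phi> ?j ([x] @ z) = extend_op ?L ?w ?s f (\<lambda>r\<in>?w. ([x] @ z) ! dyadic n r)"
    if z: "length z = ?i" for z
  proof -
    let ?h = "[x] @ z"
    let ?xw = "\<lambda>r\<in>?w. ?h ! dyadic n r"
    have "?\<phi> (?h @ z') = (\<chi> y. f (?xw(?s := y))) $ last (?h @ z')" if z': "length z' = ?j" for z'
    proof -
      have "last (?h @ z') = (?h @ z') ! dyadic n ?s"
        using z z' j by (subst last_conv_nth) auto
      moreover have "(?h @ z') ! dyadic n r = ?h ! dyadic n r" if "r \<in> ?w" for r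
        using le[OF that] z by (simp only: nth_append) simp
      ultimately have "(\<lambda>r\<in>insert ?s ?w. (?h @ z') ! dyadic n r) = ?xw(?s := last (?h @ z'))"
        by (auto simp: restrict_def fun_eq_iff)
      then show ?thesis unfolding ins by simp
    qed
    then have "backward T ?\<phi> ?j ?h = (T ^^ ?j) (\<chi> y. f (?xw(?s := y))) $ last ?h"
      by (intro backward_last) auto
    moreover have "last ?h = ?xw (t m)"
    proof -
      have "last ?h = ?h ! (length ?h - 1)" by (rule last_conv_nth) simp
      also have "length ?h - 1 = ?i" using z by simp
      finally show ?thesis by simp
    qed
    ultimately show ?thesis unfolding extend_op_def Max by simp
  qed
  then have "backward T (backward T ?\<phi> ?j) ?i [x]
    = backward T (\<lambda>h. extend_op ?L ?w ?s f (\<lambda>r\<in>?w. h ! dyadic n r)) ?i [x]"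
    by (intro backward_cong)
  moreover have "backward T ?\<phi> (dyadic n ?s) [x] = backward T (backward T ?\<phi> ?j) ?i [x]"
    using arg_cong[OF j(2), of "\<lambda>N. backward T ?\<phi> N [x]"] by (simp only: backward_plus)
  ultimately have "backward T ?\<phi> (dyadic n ?s) [x]
    = backward T (\<lambda>h. extend_op ?L ?w ?s f (\<lambda>r\<in>?w. h ! dyadic n r)) ?i [x]" by simp
  also have "\<dots> = compose_ops ?L t m (extend_op ?L ?w ?s f) (\<lambda>_\<in>{t 0}. x)"
    by (rule Suc.IH) (use Suc.prems in auto)
  finally show ?case unfolding compose_ops.simps .
qed

text \<open>Peeling off the last operator turns a payoff error b into b + e * c: monotonicity passes
  b on, and exchanging the operator costs e times the payoff bound c, which lower transition
  operators preserve.\<close>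

lemma compose_ops_le:
  assumes "\<And>i j. i < j \<Longrightarrow> j \<le> m \<Longrightarrow> t i < t j"
    and "\<And>i. i < m \<Longrightarrow> lower_transition_operator (L' (t i) (t (Suc i)))"
    and "\<And>i. i < m \<Longrightarrow> lower_transition_operator (L (t i) (t (Suc i)))"
    and "\<And>i g x. i < m \<Longrightarrow> L' (t i) (t (Suc i)) g $ x \<le> L (t i) (t (Suc i)) g $ x + e * infnorm g"
    and "\<And>x. x \<in> states (t ` {..m}) \<Longrightarrow> f x \<le> f' x + b"
    and "\<And>x. x \<in> states (t ` {..m}) \<Longrightarrow> \<bar>f x\<bar> \<le> c"
    and e: "e \<ge> 0" and x0: "x0 \<in> states {t 0}"
  shows "compose_ops L' t m f x0 \<le> compose_ops L t m f' x0 + b + real m * e * c"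
  using assms(1-6)
proof (induction m arbitrary: f f' b)
  case 0
  then show ?case using x0 by simp
next
  case (Suc m)
  let ?w = "t ` {..m}" and ?s = "t (Suc m)"
  have ins: "t ` {..Suc m} = insert ?s ?w" by (simp add: atMost_Suc)
  have Max: "Max ?w = t m" by (rule Max_eqI) (use Suc.prems(1) less_imp_le in \<open>auto simp: le_less\<close>)
  have upd: "x(?s := y) \<in> states (t ` {..Suc m})" if "x \<in> states ?w" for x y
    unfolding ins using that by (rule states_fun_upd)
  have "compose_ops L' t m (extend_op L' ?w ?s f) x0
    \<le> compose_ops L t m (extend_op L ?w ?s f') x0 + (b + e * c) + real m * e * c"
  proof (rule Suc.IH)
    fix x :: "real \<Rightarrow> 'a" assume x: "x \<in> states ?w"
    let ?g = "\<chi> y. f (x(?s := y))" and ?g' = "\<chi> y. f' (x(?s := y))"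
    have g: "\<bar>?g $ y\<bar> \<le> c" for y
      unfolding vec_lambda_beta by (rule Suc.prems(6)[OF upd[OF x]])
    show "\<bar>extend_op L' ?w ?s f x\<bar> \<le> c"
      unfolding extend_op_def Max
      by (rule lower_transition_abs_le[OF Suc.prems(2)[OF lessI] g])
    have "extend_op L' ?w ?s f x \<le> L (t m) ?s ?g $ x (t m) + e * infnorm ?g"
      unfolding extend_op_def Max by (rule Suc.prems(4)[OF lessI])
    also have "e * infnorm ?g \<le> e * c" using g e by (intro mult_left_mono) (simp add: infnorm_le_iff)
    also have "L (t m) ?s ?g $ x (t m) \<le> L (t m) ?s ?g' $ x (t m) + b"
    proof (rule lower_transition_le[OF Suc.prems(3)[OF lessI]])
      show "?g $ y \<le> ?g' $ y + b" for y unfolding vec_lambda_beta by (rule Suc.prems(5)[OF upd[OF x]])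
    qed
    finally show "extend_op L' ?w ?s f x \<le> extend_op L ?w ?s f' x + (b + e * c)"
      unfolding extend_op_def Max by simp
  qed (use Suc.prems in auto)
  then show ?case by (simp add: algebra_simps)
qed

text \<open>
  The uniform component makes every finite history of the chain possible. With \<open>\<eta>\<close> of order \<open>d\<^sup>2\<close> its
  contribution over a bounded time interval vanishes as \<open>d\<close> tends to 0.
\<close>

definition controlled_kernel ::
  "('x::finite list \<Rightarrow> real^'x^'x) \<Rightarrow> real \<Rightarrow> real \<Rightarrow> 'x list \<Rightarrow> 'x \<Rightarrow> real" where
  "controlled_kernel a d \<eta> h y =
    (1 - \<eta>) * (of_bool (y = last h) + d * a h $ last h $ y) + \<eta> / real CARD('x)"

lemma controlled_kernel_sum:
  "(\<Sum>y\<in>UNIV. controlled_kernel a d \<eta> h y * g $ y) =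
    (1 - \<eta>) * (g $ last h + d * (a h *v g) $ last h) + \<eta> * ((\<Sum>y\<in>UNIV. g $ y) / real CARD('x))"
  for g :: "real^'x::finite"
proof -
  have "(\<Sum>y\<in>UNIV. controlled_kernel a d \<eta> h y * g $ y) =
    (\<Sum>y\<in>UNIV. (1 - \<eta>) * ((if y = last h then g $ y else 0) + d * (a h $ last h $ y * g $ y))
      + \<eta> * (g $ y / real CARD('x)))"
    by (rule sum.cong) (auto simp: controlled_kernel_def algebra_simps)
  then show ?thesis
    by (simp add: sum.distrib sum_distrib_left[symmetric] sum_divide_distrib[symmetric] matrix_vector_mult_def)
qed

lemma abs_average_le: "\<bar>(\<Sum>y\<in>UNIV. g $ y) / real CARD('x)\<bar> \<le> infnorm g" for g :: "real^'x::finite"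
proof -
  have "\<bar>\<Sum>y\<in>UNIV. g $ y\<bar> \<le> (\<Sum>y\<in>(UNIV :: 'x set). infnorm g)"
    by (rule order_trans[OF sum_abs]) (intro sum_mono component_le_infnorm_cart)
  then show ?thesis by (simp add: field_simps)
qed

context bounded_rate_set
begin

lemma positive_controlled_kernel:
  assumes a: "\<And>h. a h \<in> F" and d: "0 \<le> d" "d * B \<le> 1" and \<eta>: "0 < \<eta>" "\<eta> \<le> 1"
  shows "positive_kernel (controlled_kernel a d \<eta>)"
proof
  fix h :: "'x list" and y
  have R: "a h \<in> rate_matrices" using a rates by blast
  have "of_bool (y = last h) + d * a h $ last h $ y \<ge> 0"
  proof (cases "y = last h")
    case True
    have "d * (- B) \<le> d * a h $ last h $ y" using d entry_bound[OF a, of h "last h" y] by (intro mult_left_mono) auto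
    then show ?thesis using True d by simp
  next
    case False
    then show ?thesis using R d by (auto simp: rate_matrices_def)
  qed
  then have "(1 - \<eta>) * (of_bool (y = last h) + d * a h $ last h $ y) \<ge> 0" using \<eta> by simp
  then show "controlled_kernel a d \<eta> h y > 0"
    unfolding controlled_kernel_def using \<eta> by (intro add_nonneg_pos) auto
  have "(a h *v 1) $ last h = 0" using R by (simp add: rate_matrices_def matrix_vector_mult_def)
  then show "(\<Sum>y\<in>UNIV. controlled_kernel a d \<eta> h y) = 1"
    using controlled_kernel_sum[of a d \<eta> h 1] by simp
qed

text \<open>The lower half holds for every control and every test function; it will give
  consistency. The upper half concerns the function that the control minimises and will give
  near-optimality. The factor 2 arises because the uniform average and the Euler step are both at
  most infnorm g in absolute value.\<close>

lemma controlled_kernel_bounds: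
  assumes d: "0 \<le> d" "d * B \<le> 1" and \<eta>: "0 < \<eta>" "\<eta> \<le> 1"
  shows "a h \<in> F \<Longrightarrow> (\<Sum>y\<in>UNIV. controlled_kernel a d \<eta> h y * g $ y) \<ge> euler Qlow d g $ last h - 2 * \<eta> * infnorm g"
    and "(a h *v g) $ last h = Qlow g $ last h \<Longrightarrow>
      (\<Sum>y\<in>UNIV. controlled_kernel a d \<eta> h y * g $ y) \<le> euler Qlow d g $ last h + 2 * \<eta> * infnorm g"
proof -
  let ?e = "euler Qlow d g $ last h" and ?m = "(\<Sum>y\<in>UNIV. g $ y) / real CARD('x)"
  have "\<bar>?e\<bar> \<le> infnorm g"
    by (rule lower_transition_abs_le[OF lower_transition_euler[OF d] component_le_infnorm_cart])
  then have "\<bar>\<eta> * (?m - ?e)\<bar> \<le> \<eta> * (2 * infnorm g)"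
    unfolding abs_mult using \<eta> abs_triangle_ineq4[of ?m ?e] abs_average_le[of g]
    by (intro mult_mono) linarith+
  then have *: "\<bar>((1 - \<eta>) * ?e + \<eta> * ?m) - ?e\<bar> \<le> 2 * \<eta> * infnorm g" by (simp add: algebra_simps)
  show "(\<Sum>y\<in>UNIV. controlled_kernel a d \<eta> h y * g $ y) \<ge> ?e - 2 * \<eta> * infnorm g" if "a h \<in> F"
  proof -
    have "?e \<le> g $ last h + d * (a h *v g) $ last h"
      using mult_left_mono[OF Qlow_le[OF that, of g "last h"] d(1)] by (simp add: euler_def)
    then have "(1 - \<eta>) * ?e \<le> (1 - \<eta>) * (g $ last h + d * (a h *v g) $ last h)"
      using \<eta> by (intro mult_left_mono) auto
    then show ?thesis unfolding controlled_kernel_sum using * by linarith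
  qed
  show "(\<Sum>y\<in>UNIV. controlled_kernel a d \<eta> h y * g $ y) \<le> ?e + 2 * \<eta> * infnorm g"
    if "(a h *v g) $ last h = Qlow g $ last h"
  proof -
    have "g $ last h + d * (a h *v g) $ last h = ?e" using that by (simp add: euler_def)
    then show ?thesis unfolding controlled_kernel_sum using * by simp
  qed
qed

lemma optimal_control_exists:
  assumes "finite F"
  shows "\<exists>Q\<in>F. (Q *v g) $ x = Qlow g $ x"
proof -
  have "finite ((\<lambda>Q. (Q *v g) $ x) ` F)" "(\<lambda>Q. (Q *v g) $ x) ` F \<noteq> {}" using assms nonempty by auto
  from cInf_eq_Min[OF this] Min_in[OF this] show ?thesis
    unfolding lower_rate_def by auto
qed

text \<open>The kernel bound is uniform in the history, so it can be iterated although the controls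
  depend on the past. Each step adds one noise error.\<close>

lemma run_ge:
  assumes "positive_kernel k" and d: "0 \<le> d" "d * B \<le> 1" and "\<eta> \<ge> 0"
    and k: "\<And>h g. h \<noteq> [] \<Longrightarrow> (\<Sum>y\<in>UNIV. k h y * g $ y) \<ge> euler Qlow d g $ last h - 2 * \<eta> * infnorm g"
    and "h \<noteq> []"
  shows "run k m (\<lambda>h. g $ last h) h \<ge> (euler Qlow d ^^ m) g $ last h - real m * (2 * \<eta>) * infnorm g"
  using \<open>h \<noteq> []\<close>
proof (induction m arbitrary: h)
  case 0 then show ?case by simp
next
  case (Suc m)
  interpret positive_kernel k by fact
  let ?g = "(euler Qlow d ^^ m) g" and ?c = "real m * (2 * \<eta>) * infnorm g"
  have "euler Qlow d ?g $ last h - 2 * \<eta> * infnorm ?g \<le> (\<Sum>y\<in>UNIV. k h y * ?g $ y)"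
    by (rule k[OF Suc.prems])
  also have "\<dots> = (\<Sum>y\<in>UNIV. k h y * (?g $ y - ?c)) + ?c"
    using kernel_sum[OF Suc.prems]
    by (simp add: right_diff_distrib sum_subtractf sum_distrib_right[symmetric])
  also have "(\<Sum>y\<in>UNIV. k h y * (?g $ y - ?c)) \<le> (\<Sum>y\<in>UNIV. k h y * run k m (\<lambda>h. g $ last h) (h @ [y]))"
    using Suc.IH[of "h @ [_]"] less_imp_le[OF kernel_pos[OF Suc.prems]] by (intro sum_mono mult_left_mono) auto
  finally have "euler Qlow d ?g $ last h - 2 * \<eta> * infnorm ?g \<le> run k (Suc m) (\<lambda>h. g $ last h) h + ?c" by simp
  moreover have "2 * \<eta> * infnorm ?g \<le> 2 * \<eta> * infnorm g"
    by (intro mult_left_mono lower_transition_infnorm_le lower_transition_euler_funpow d)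
      (use \<open>\<eta> \<ge> 0\<close> in simp)
  ultimately show ?case by (simp add: algebra_simps)
qed

text \<open>Optimality of the kernel is required exactly for the value functions met on the way to
  step N. A history of length l has reached step l - 1, so \<open>Suc N\<close> is the invariant
  before a move; after it, j counts the steps still to go, whence \<open>N\<close> in the kernel
  condition.\<close>

lemma run_le_backward:
  assumes "positive_kernel k" and d: "0 \<le> d" "d * B \<le> 1" and "\<eta> \<ge> 0"
    and \<phi>: "\<And>h. \<bar>\<phi> h\<bar> \<le> c"
    and k: "\<And>h j g. h \<noteq> [] \<Longrightarrow> length h + j = N \<Longrightarrow> g = (\<chi> y. backward (euler Qlow d) \<phi> j (h @ [y])) \<Longrightarrow>
      (\<Sum>y\<in>UNIV. k h y * g $ y) \<le> euler Qlow d g $ last h + 2 * \<eta> * infnorm g"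
    and "h \<noteq> []" "length h + j = Suc N"
  shows "run k j \<phi> h \<le> backward (euler Qlow d) \<phi> j h + real j * (2 * \<eta>) * c"
  using assms(7,8)
proof (induction j arbitrary: h)
  case 0 then show ?case by simp
next
  case (Suc j)
  interpret positive_kernel k by fact
  let ?W = "backward (euler Qlow d) \<phi>"
  let ?g = "\<chi> y. ?W j (h @ [y])" and ?c = "real j * (2 * \<eta>) * c"
  have g: "infnorm ?g \<le> c"
    unfolding infnorm_le_iff by (simp add: backward_abs_le[OF lower_transition_euler[OF d] \<phi>])
  have "run k (Suc j) \<phi> h \<le> (\<Sum>y\<in>UNIV. k h y * (?W j (h @ [y]) + ?c))"
    unfolding run.simps using Suc.IH[of "h @ [_]"] Suc.prems less_imp_le[OF kernel_pos[OF Suc.prems(1)]]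
    by (intro sum_mono mult_left_mono) auto
  also have "\<dots> = (\<Sum>y\<in>UNIV. k h y * ?g $ y) + ?c"
    using kernel_sum[OF Suc.prems(1)]
    by (simp add: distrib_left sum.distrib sum_distrib_right[symmetric])
  also have "(\<Sum>y\<in>UNIV. k h y * ?g $ y) \<le> euler Qlow d ?g $ last h + 2 * \<eta> * infnorm ?g"
    by (rule k[OF Suc.prems(1) _ refl]) (use Suc.prems in simp)
  also have "2 * \<eta> * infnorm ?g \<le> 2 * \<eta> * c" using g \<open>\<eta> \<ge> 0\<close> by (intro mult_left_mono) auto
  finally show ?case by (simp add: algebra_simps)
qed

text \<open>Again a sum of local errors: each step differs from the semigroup by (d B)^2, over j
  steps.\<close>

lemma euler_funpow_semigroup:
  assumes d: "0 \<le> d" "d * B \<le> 1"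
  shows "infnorm ((euler Qlow d ^^ j) g - semigroup (real j * d) g) \<le> real j * d * (d * B\<^sup>2) * infnorm g"
proof (induction j)
  case 0 then show ?case by (simp add: semigroup_0 infnorm_0)
next
  case (Suc j)
  let ?T = "euler Qlow d" and ?g = "semigroup (real j * d) g"
  have g: "infnorm ?g \<le> infnorm g"
    using d by (intro lower_transition_infnorm_le lower_transition_semigroup) auto
  have S: "semigroup (real (Suc j) * d) g = semigroup d ?g"
    using semigroup_add[of d "real j * d" g] d by (simp add: algebra_simps)
  have "infnorm (?T ((?T ^^ j) g) - ?T ?g) \<le> infnorm ((?T ^^ j) g - ?g)"
    by (intro lower_transition_nonexpansive lower_transition_euler d)
  moreover have "infnorm (?T ?g - semigroup d ?g) \<le> (d * B)\<^sup>2 * infnorm g"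
  proof -
    have "infnorm (?T ?g - semigroup d ?g) = infnorm (semigroup d ?g - ?g - d *\<^sub>R Qlow ?g)"
      by (subst infnorm_sub) (simp add: euler_def algebra_simps)
    also have "\<dots> \<le> (d * B)\<^sup>2 * infnorm ?g" by (rule semigroup_approx[OF d(1)])
    also have "\<dots> \<le> (d * B)\<^sup>2 * infnorm g" by (intro mult_left_mono g) auto
    finally show ?thesis .
  qed
  ultimately show ?case
    using Suc infnorm_triangle_diff[of "?T ((?T ^^ j) g)" "semigroup d ?g" "?T ?g"]
    unfolding S by (simp add: algebra_simps power2_eq_square)
qed

end

section \<open>The limit of the chains\<close>

lemma dyadic_less_eventually:
  assumes "0 \<le> a" "a < b"
  shows "\<forall>\<^sub>F n in sequentially. dyadic n a < dyadic n b"
proof -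
  have "\<forall>\<^sub>F n in sequentially. real (dyadic n a) / 2 ^ n < (a + b) / 2"
    by (rule order_tendstoD(2)[OF dyadic_tendsto]) (use assms in auto)
  moreover have "\<forall>\<^sub>F n in sequentially. (a + b) / 2 < real (dyadic n b) / 2 ^ n"
    by (rule order_tendstoD(1)[OF dyadic_tendsto]) (use assms in auto)
  ultimately show ?thesis
  proof eventually_elim
    case (elim n)
    then have "real (dyadic n a) / 2 ^ n < real (dyadic n b) / 2 ^ n" by linarith
    then show ?case by (simp add: divide_less_cancel)
  qed
qed

lemma dyadic_inj_eventually:
  assumes "u \<in> time_seqs"
  shows "\<forall>\<^sub>F n in sequentially. inj_on (dyadic n) u"
proof -
  have u: "finite u" "\<And>r. r \<in> u \<Longrightarrow> r \<ge> 0" using assms by (auto simp: time_seqs_def)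
  have "\<forall>\<^sub>F n in sequentially. \<forall>a\<in>u. \<forall>b\<in>u. a < b \<longrightarrow> dyadic n a < dyadic n b"
  proof (intro eventually_ball_finite u ballI)
    fix a b assume "a \<in> u" "b \<in> u"
    then show "\<forall>\<^sub>F n in sequentially. a < b \<longrightarrow> dyadic n a < dyadic n b"
      using dyadic_less_eventually[of a b] u(2) by (cases "a < b") auto
  qed
  then show ?thesis
  proof eventually_elim
    case (elim n)
    show ?case
    proof (rule inj_onI)
      fix a b assume "a \<in> u" "b \<in> u" "dyadic n a = dyadic n b"
      with elim show "a = b" by (metis less_irrefl linorder_neqE)
    qed
  qed
qed

text \<open>The n-th chain makes n * 2^n steps of length 2^-n and so runs up to time n; every fixed
  time is eventually covered.\<close>

lemma dyadic_le_horizon: "r \<le> real n \<Longrightarrow> dyadic n r \<le> n * 2 ^ n"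
proof -
  assume "r \<le> real n"
  then have "dyadic n r \<le> dyadic n (real n)" by (rule dyadic_mono)
  also have "real n * 2 ^ n = real (n * 2 ^ n)" by simp
  then have "dyadic n (real n) = n * 2 ^ n" unfolding dyadic_def by (simp only: floor_of_nat nat_int)
  finally show ?thesis .
qed

lemma eventually_ge_real: "\<forall>\<^sub>F n in sequentially. r \<le> real n"
  using filterlim_real_sequentially by (simp add: filterlim_at_top)

text \<open>The step path of a state list. Beyond the horizon the list access is unspecified, so the
  observed times are first checked to lie below n.\<close>

definition chain_path :: "nat \<Rightarrow> 'x list \<Rightarrow> real \<Rightarrow> 'x" where
  "chain_path n h r = h ! dyadic n r"

text \<open>An interface that forgets the controls: the limit process will inherit its rates from
  \<open>kernel_ge\<close> alone. The noise level 4^-n is the square of the step, so the 2^n steps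
  in a unit of time contribute about 2^-n.\<close>

locale chain_sequence = bounded_rate_set F B for F :: "(real^'x^'x::finite) set" and B +
  fixes \<Omega> :: "(real \<Rightarrow> 'x) set" and p :: "'x \<Rightarrow> real" and k :: "nat \<Rightarrow> 'x list \<Rightarrow> 'x \<Rightarrow> real" and n0 :: nat
  assumes path_space: "path_space \<Omega>"
    and p_nonneg: "\<And>x. p x \<ge> 0" and p_sum: "(\<Sum>x\<in>UNIV. p x) = 1"
    and fine: "\<And>n. n \<ge> n0 \<Longrightarrow> 1 / 2 ^ n * B \<le> 1"
    and kernel: "\<And>n. n \<ge> n0 \<Longrightarrow> positive_kernel (k n)"
    and kernel_ge: "\<And>n h g. n \<ge> n0 \<Longrightarrow> h \<noteq> [] \<Longrightarrow>
      (\<Sum>y\<in>UNIV. k n h y * g $ y) \<ge> euler Qlow (1 / 2 ^ n) g $ last h - 2 * (1 / 4 ^ n) * infnorm g"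
begin

definition init :: "nat \<Rightarrow> 'x \<Rightarrow> real" where
  "init n x = (1 - 1 / 4 ^ n) * p x + (1 / 4 ^ n) / real CARD('x)"

definition expect :: "nat \<Rightarrow> ('x list \<Rightarrow> real) \<Rightarrow> real" where
  "expect n = mean (init n) (k n) (n * 2 ^ n)"

definition prob :: "nat \<Rightarrow> (real \<Rightarrow> 'x) set \<Rightarrow> real" where
  "prob n S = expect n (\<lambda>h. indicator S (chain_path n h))"

text \<open>Bayes' quotient for arbitrary pairs of sets. Division by zero yields 0, so every value
  lies in the unit interval and compactness applies to all pairs at once.\<close>

definition cond :: "nat \<Rightarrow> (real \<Rightarrow> 'x) set \<Rightarrow> (real \<Rightarrow> 'x) set \<Rightarrow> real" where
  "cond n A C = prob n (ext_event \<Omega> A \<inter> ext_event \<Omega> C) / prob n (ext_event \<Omega> C)"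

lemma chain:
  assumes "n \<ge> n0"
  shows "positive_chain (k n) (init n)"
proof -
  interpret positive_kernel "k n" by (rule kernel[OF assms])
  show ?thesis
  proof
    have *: "(1::real) \<le> 4 ^ n" by simp
    show "init n x > 0" for x
      unfolding init_def using p_nonneg[of x] * by (intro add_nonneg_pos mult_nonneg_nonneg) auto
    show "(\<Sum>x\<in>UNIV. init n x) = 1"
      by (simp add: init_def sum.distrib sum_distrib_left[symmetric] p_sum)
  qed
qed

lemma init_tendsto: "(\<lambda>n. init n x) \<longlonglongrightarrow> p x"
proof -
  have "(\<lambda>n. 1 / 4 ^ n :: real) \<longlonglongrightarrow> 0"
    using LIMSEQ_realpow_zero[of "1/4 :: real"] by (simp add: power_one_over)
  then have "(\<lambda>n. init n x) \<longlonglongrightarrow> (1 - 0) * p x + 0 / real CARD('x)"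
    unfolding init_def by (intro tendsto_intros) auto
  then show ?thesis by simp
qed

text \<open>Eventually the times in u occupy distinct grid positions below the horizon. Some state
  list then realises the joint state, and the noise gives it positive probability.\<close>

lemma prob_joint_event_pos:
  assumes "u \<in> time_seqs" "xu \<in> states u"
  shows "\<forall>\<^sub>F n in sequentially. prob n (ext_event \<Omega> (joint_event \<Omega> u xu)) > 0"
proof -
  have "finite u" using assms by (simp add: time_seqs_def)
  then have "\<forall>\<^sub>F n in sequentially. \<forall>r\<in>u. r \<le> real n"
    by (intro eventually_ball_finite ballI eventually_ge_real)
  then show ?thesis using dyadic_inj_eventually[OF assms(1)] eventually_ge_at_top[of n0]
  proof eventually_elim
    case (elim n)
    interpret positive_chain "k n" "init n" by (rule chain) fact
    \<comment> \<open>Each occupied position receives the prescribed state; the entries elsewhere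
      are arbitrary.\<close>
    let ?z = "map (\<lambda>i. xu (the_inv_into u (dyadic n) i)) [0..<Suc (n * 2 ^ n)]"
    have "chain_path n ?z r = xu r" if "r \<in> u" for r
    proof -
      have "dyadic n r \<le> n * 2 ^ n" using elim that by (intro dyadic_le_horizon) auto
      then have "?z ! dyadic n r = xu (the_inv_into u (dyadic n) (dyadic n r))"
        by (simp del: upt_Suc)
      then show ?thesis unfolding chain_path_def using the_inv_into_f_f[OF elim(2) that] by simp
    qed
    then have "restrict (chain_path n ?z) u = restrict xu u" by (rule restrict_ext)
    also have "\<dots> = xu" using assms(2) by (simp add: states_def PiE_restrict)
    finally have "chain_path n ?z \<in> ext_event \<Omega> (joint_event \<Omega> u xu)"
      by (simp only: ext_joint_event[OF path_space assms(1)])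
    then show ?case unfolding prob_def expect_def by (intro mean_pos[of _ ?z]) simp_all
  qed
qed

lemma cond_in_unit: "n \<ge> n0 \<Longrightarrow> cond n A C \<in> {0..1}"
proof -
  assume n: "n \<ge> n0"
  interpret positive_chain "k n" "init n" by (rule chain[OF n])
  have "0 \<le> prob n S" for S unfolding prob_def expect_def by (rule mean_nonneg) simp
  moreover have "prob n (S \<inter> S') \<le> prob n S'" for S S'
    unfolding prob_def expect_def by (rule mean_mono) (simp add: indicator_def)
  ultimately show ?thesis unfolding cond_def by (auto simp: divide_le_eq_1 intro: divide_nonneg_nonneg order_antisym)
qed

lemma joint_event_whole: "joint_event \<Omega> {} (\<lambda>_. undefined) = \<Omega>"
  by (rule joint_event_empty) (simp add: states_def)

lemma cond_whole:
  assumes "n \<ge> n0"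
  shows "cond n A \<Omega> = expect n (\<lambda>h. indicator (ext_event \<Omega> A) (chain_path n h))"
proof -
  interpret positive_chain "k n" "init n" by (rule chain[OF assms])
  have "{} \<in> time_seqs" by (simp add: time_seqs_def)
  then have "g \<in> ext_event \<Omega> \<Omega>" for g
    using ext_joint_event[OF path_space, of "{}" g "\<lambda>_. undefined"] by (simp add: joint_event_whole restrict_def)
  then have "ext_event \<Omega> \<Omega> = UNIV" by blast
  moreover have "prob n UNIV = 1" unfolding prob_def expect_def by (rule mean_const) simp
  ultimately show ?thesis by (simp add: cond_def prob_def)
qed

end

section \<open>Coherence and rates of the limit process\<close>

locale chain_limit = chain_sequence F B \<Omega> p k n0
  for F :: "(real^'x^'x::finite) set" and B \<Omega> p k n0 +
  fixes G :: "nat filter" and P :: "'x process"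
  assumes G: "G \<noteq> bot" "G \<le> sequentially" and limit: "\<And>A C. ((\<lambda>n. cond n A C) \<longlongrightarrow> P A C) G"
begin

abbreviation "T \<equiv> transition_matrix \<Omega> P"

lemma eventually_G: "eventually Q sequentially \<Longrightarrow> eventually Q G"
  using G(2) by (rule filter_leD)

lemma tendsto_G: "(f \<longlongrightarrow> (l::real)) sequentially \<Longrightarrow> (f \<longlongrightarrow> l) G"
  using G(2) by (rule tendsto_mono)

text \<open>If the gain were at most -m < 0 on the union of the conditioning events, then for
  suitable n the gain computed with \<open>cond n\<close> would still be uniformly negative there.
  That union has positive probability in the chain, yet the gain has mean zero by Bayes'
  rule.\<close>

lemma coherent_limit: "stochastic_process \<Omega> P"
  unfolding stochastic_process_def
proof (intro allI impI)
  fix N :: nat and A C :: "nat \<Rightarrow> (real \<Rightarrow> 'x) set" and c :: "nat \<Rightarrow> real"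
  let ?I = "{1..N}"
  assume N: "1 \<le> N" and dom: "\<forall>i\<in>?I. (A i, C i) \<in> process_domain \<Omega>"
  let ?D = "\<lambda>\<omega>. \<Sum>i\<in>?I. c i * indicator (C i) \<omega> * (P (A i) (C i) - indicator (A i) \<omega>)"
  let ?S = "\<Union>i\<in>?I. C i" and ?A = "\<lambda>i. ext_event \<Omega> (A i)" and ?C = "\<lambda>i. ext_event \<Omega> (C i)"
  have C: "\<exists>u xu. u \<in> time_seqs \<and> xu \<in> states u \<and> C i = joint_event \<Omega> u xu" if "i \<in> ?I" for i
    using dom that unfolding process_domain_def by blast
  have supp: "\<exists>v. v \<in> time_seqs \<and> depends_on \<Omega> (A i) v \<and> depends_on \<Omega> (C i) v" if i: "i \<in> ?I" for i
  proof -
    obtain u xu where u: "u \<in> time_seqs" "C i = joint_event \<Omega> u xu" "A i \<in> events_from \<Omega> u"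
      using dom i unfolding process_domain_def by blast
    obtain v where v: "v \<in> time_seqs" "depends_on \<Omega> (A i) v" using events_from_depends_on[OF u(3)] by blast
    have "u \<union> v \<in> time_seqs" using u v by (auto simp: time_seqs_def)
    moreover have "depends_on \<Omega> (A i) (u \<union> v)" using v(2) by (rule depends_on_mono) auto
    moreover have "depends_on \<Omega> (C i) (u \<union> v)"
      unfolding u(2) by (rule depends_on_mono[OF depends_on_joint_event]) auto
    ultimately show ?thesis by blast
  qed
  then obtain v where v: "\<And>i. i \<in> ?I \<Longrightarrow> v i \<in> time_seqs"
    "\<And>i. i \<in> ?I \<Longrightarrow> depends_on \<Omega> (A i) (v i)" "\<And>i. i \<in> ?I \<Longrightarrow> depends_on \<Omega> (C i) (v i)" by metis
  define w where "w = (\<Union>i\<in>?I. v i)"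
  have w: "w \<in> time_seqs" using v(1) by (force simp: time_seqs_def w_def)
  have sub: "v i \<subseteq> w" if "i \<in> ?I" for i unfolding w_def using that by (rule UN_upper)
  note wA = depends_on_mono[OF v(2) sub] and wC = depends_on_mono[OF v(3) sub]
  have fin: "finite (?D ` ?S)"
    by (rule finite_image_indicators[where I = ?I and A = A and C = C]) (auto intro!: sum.cong simp: indicator_def)
  have one: "1 \<in> ?I" using N by simp
  have ne: "?S \<noteq> {}" using C[OF one] joint_event_nonempty[OF path_space] one by blast
  show "0 \<le> Max (?D ` ?S)"
  proof (rule ccontr)
    assume "\<not> 0 \<le> Max (?D ` ?S)"
    define m where "m = - Max (?D ` ?S)"
    have m: "m > 0" using \<open>\<not> 0 \<le> Max (?D ` ?S)\<close> by (simp add: m_def)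
    have D: "?D \<omega> \<le> - m" if "\<omega> \<in> ?S" for \<omega>
      unfolding m_def using Max_ge[OF fin imageI[OF that]] by simp
    \<comment> \<open>This tolerance makes the total perturbation S * e smaller than m; the added 1
      covers the case S = 0.\<close>
    define S e where "S = (\<Sum>i\<in>?I. \<bar>c i\<bar>)" and "e = m / (1 + S)"
    have "S \<ge> 0" by (simp add: S_def sum_nonneg)
    then have "e > 0" "S * e < m" using m by (auto simp: e_def field_simps)
    then have e: "e > 0" "(\<Sum>i\<in>?I. \<bar>c i\<bar>) * e < m" by (simp_all only: S_def)
    have "\<forall>\<^sub>F n in G. \<forall>i\<in>?I. \<bar>cond n (A i) (C i) - P (A i) (C i)\<bar> < e"
      by (intro eventually_ball_finite ballI tendstoD[OF limit e(1), unfolded dist_real_def]) simp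
    moreover have "\<forall>\<^sub>F n in G. \<forall>i\<in>?I. prob n (?C i) > 0"
      by (intro eventually_ball_finite ballI eventually_G) (use C prob_joint_event_pos in fastforce)+
    moreover have "\<forall>\<^sub>F n in G. n0 \<le> n" by (intro eventually_G eventually_ge_at_top)
    ultimately have "\<forall>\<^sub>F n in G. False"
    proof eventually_elim
      case (elim n)
      interpret positive_chain "k n" "init n" by (rule chain) fact
      let ?U = "\<Union>i\<in>?I. ?C i"
      let ?\<chi> = "\<lambda>S h. indicator S (chain_path n h) :: real"
      let ?X = "\<lambda>h. \<Sum>i\<in>?I. c i * (cond n (A i) (C i) * ?\<chi> (?C i) h
        + (-1) * ?\<chi> (?A i \<inter> ?C i) h)"
      have 2: "expect n (\<lambda>h. a * \<phi> h + b * \<psi> h) = a * expect n \<phi> + b * expect n \<psi>" for a b \<phi> \<psi>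
        using mean_sum[of "init n" "k n" "n * 2 ^ n" "\<lambda>i. if i then a else b" "\<lambda>i. if i then \<phi> else \<psi>" UNIV]
        by (simp add: UNIV_bool expect_def add.commute)
      have "expect n ?X = (\<Sum>i\<in>?I. c i * (cond n (A i) (C i) * prob n (?C i)
        + (-1) * prob n (?A i \<inter> ?C i)))"
        unfolding expect_def mean_sum unfolding expect_def[symmetric] 2 prob_def ..
      also have "\<dots> = 0" using elim(2) by (intro sum.neutral) (auto simp: cond_def)
      finally have X0: "expect n ?X = 0" .
      have "?X h \<le> ((\<Sum>i\<in>?I. \<bar>c i\<bar>) * e - m) * ?\<chi> ?U h" for h
      proof -
        let ?g = "chain_path n h"
        \<comment> \<open>The chain path may lie outside \<Omega>. A path in \<Omega> that agrees
          with it on the common support w belongs to the same events, so the bound on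
          \<open>?D\<close> applies.\<close>
        obtain \<omega> where \<omega>: "\<omega> \<in> \<Omega>" "\<And>r. r \<in> w \<Longrightarrow> \<omega> r = ?g r" using path_agree[OF path_space w] by blast
        have iffA: "?g \<in> ?A i \<longleftrightarrow> \<omega> \<in> A i" if "i \<in> ?I" for i
          by (rule ext_event_iff[OF path_space w wA[OF that that] \<omega>])
        have iffC: "?g \<in> ?C i \<longleftrightarrow> \<omega> \<in> C i" if "i \<in> ?I" for i
          by (rule ext_event_iff[OF path_space w wC[OF that that] \<omega>])
        note iff = iffA iffC
        let ?d = "\<lambda>i. c i * indicator (C i) \<omega> * (cond n (A i) (C i) - P (A i) (C i))"
        have "?X h = (\<Sum>i\<in>?I. c i * indicator (C i) \<omega> * (cond n (A i) (C i) - indicator (A i) \<omega>))"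
          by (rule sum.cong) (auto simp: iff indicator_def)
        also have "\<dots> = ?D \<omega> + (\<Sum>i\<in>?I. ?d i)"
          unfolding sum.distrib[symmetric] by (rule sum.cong) (auto simp: algebra_simps)
        finally have X: "?X h = ?D \<omega> + (\<Sum>i\<in>?I. ?d i)" .
        show ?thesis
        proof (cases "\<omega> \<in> ?S")
          case True
          then have "?g \<in> ?U" using iff by blast
          moreover have "(\<Sum>i\<in>?I. ?d i) \<le> (\<Sum>i\<in>?I. \<bar>c i\<bar> * e)"
          proof (rule sum_mono)
            fix i assume i: "i \<in> ?I"
            have "?d i \<le>
              \<bar>c i\<bar> * \<bar>indicator (C i) \<omega>\<bar> * \<bar>cond n (A i) (C i) - P (A i) (C i)\<bar>"
              by (simp only: abs_mult[symmetric] abs_ge_self)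
            also have "\<dots> \<le> \<bar>c i\<bar> * 1 * e" using elim(1) i e(1)
              by (intro mult_mono) (auto simp: indicator_def less_imp_le)
            finally show "?d i \<le> \<bar>c i\<bar> * e" by simp
          qed
          ultimately show ?thesis unfolding X using D[OF True] by (simp add: sum_distrib_right)
        next
          case False
          then have "?g \<notin> ?U" using iff by blast
          moreover have "?X h = 0" unfolding X using False by (simp add: indicator_def)
          ultimately show ?thesis by simp
        qed
      qed
      then have "expect n ?X \<le> ((\<Sum>i\<in>?I. \<bar>c i\<bar>) * e - m) * prob n ?U"
        unfolding expect_def prob_def mean_scale[symmetric] by (rule mean_mono)
      moreover have "prob n ?U > 0"
      proof -
        have "prob n (ext_event \<Omega> (C 1)) \<le> prob n ?U"
          unfolding prob_def expect_def by (rule mean_mono) (use one in \<open>auto simp: indicator_def\<close>)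
        then show ?thesis using elim(2) one by fastforce
      qed
      ultimately show False using X0 e(2) by (simp add: zero_le_mult_iff)
    qed
    then show False using G(1) by (simp add: trivial_limit_def)
  qed
qed

text \<open>For the chain the bound holds after every complete history ending in x at the grid
  position of t, hence also given the observed times alone. The limit keeps it, with constants that
  do not depend on t, u or x.\<close>

lemma transition_ge:
  assumes t: "t \<ge> 0" "u \<in> time_seqs_before t" "xu \<in> states u" and s: "t < s"
  shows "(T u xu t s *v g) $ x \<ge> g $ x + (s - t) * Qlow g $ x - ((s - t) * B)\<^sup>2 * infnorm g"
proof -
  interpret process \<Omega> P by unfold_locales (rule path_space, rule coherent_limit)
  let ?w = "insert t u" and ?xw = "xu(t := x)"
  let ?C = "joint_event \<Omega> ?w ?xw"
  have w: "?w \<in> time_seqs" "?xw \<in> states ?w" "\<And>r. r \<in> ?w \<Longrightarrow> r \<le> t"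
    using history_insert[OF t] by auto
  let ?m = "\<lambda>n. dyadic n s - dyadic n t"
  let ?a = "\<lambda>n. real (dyadic n s) / 2 ^ n - real (dyadic n t) / 2 ^ n"
  \<comment> \<open>\<open>?a n\<close> is the elapsed time on the grid. The last term is the
    accumulated noise: 2 * 4^-n for each of the \<open>?m n\<close> steps.\<close>
  let ?b = "\<lambda>n. g $ x + ?a n * Qlow g $ x - (?a n * B)\<^sup>2 * infnorm g - ?a n * (2 * (1 / 2 ^ n)) * infnorm g"
  have "((\<lambda>n. \<Sum>y\<in>UNIV. cond n (state_event \<Omega> s y) ?C * g $ y) \<longlongrightarrow> (\<Sum>y\<in>UNIV. P (state_event \<Omega> s y) ?C * g $ y)) G"
    by (intro tendsto_intros limit)
  moreover have "(?b \<longlongrightarrow> g $ x + (s - t) * Qlow g $ x - ((s - t) * B)\<^sup>2 * infnorm g - (s - t) * (2 * 0) * infnorm g) G"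
    by (rule tendsto_G, intro tendsto_intros dyadic_tendsto tendsto_inverse_two_power) (use t s in auto)
  moreover have "\<forall>\<^sub>F n in G. (\<Sum>y\<in>UNIV. cond n (state_event \<Omega> s y) ?C * g $ y) \<ge> ?b n"
  proof (rule eventually_G)
    show "\<forall>\<^sub>F n in sequentially. (\<Sum>y\<in>UNIV. cond n (state_event \<Omega> s y) ?C * g $ y) \<ge> ?b n"
      using eventually_ge_real[of s] prob_joint_event_pos[OF w(1,2)] eventually_ge_at_top[of n0]
    proof eventually_elim
      case (elim n)
      interpret positive_chain "k n" "init n" by (rule chain) fact
      let ?i = "dyadic n t" and ?H = "n * 2 ^ n"
      have le: "?i \<le> dyadic n s" using s by (intro dyadic_mono) simp
      have sH: "dyadic n s \<le> ?H" using elim(1) by (rule dyadic_le_horizon)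
      have a: "?a n = real (?m n) * (1 / 2 ^ n)" using le by (simp add: of_nat_diff diff_divide_distrib)
      \<comment> \<open>The complete state lists up to the grid position of t that match the
        observations.\<close>
      let ?V = "{h. length h = Suc ?i \<and> restrict (chain_path n h) ?w = ?xw}"
      let ?\<upsilon> = "\<lambda>h. indicator ?V (take (Suc ?i) h) :: real" and ?E = "mean (init n) (k n) ?H"
      let ?\<iota> = "\<lambda>h y. indicator (ext_event \<Omega> (state_event \<Omega> s y) \<inter> ext_event \<Omega> ?C) (chain_path n h) :: real"
      have bound: "run (k n) (?m n) (\<lambda>h. g $ last h) h \<ge> ?b n" if h: "h \<in> ?V" for h
      proof -
        have h0: "h \<noteq> []" using h by auto
        have "last h = h ! ?i" using h h0 by (simp add: last_conv_nth)
        also have "\<dots> = restrict (chain_path n h) ?w t" by (simp add: chain_path_def)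
        also have "\<dots> = x" using h by simp
        finally have x: "last h = x" .
        have eta: "real (?m n) * (2 * (1 / 4 ^ n)) = ?a n * (2 * (1 / 2 ^ n))"
          unfolding a by (simp add: power_mult_distrib[symmetric])
        have "run (k n) (?m n) (\<lambda>h. g $ last h) h \<ge>
          (euler Qlow (1 / 2 ^ n) ^^ ?m n) g $ last h - real (?m n) * (2 * (1 / 4 ^ n)) * infnorm g"
          by (rule run_ge[OF kernel _ fine _ kernel_ge h0]) (use elim in auto)
        note run_lower = this
        have "infnorm ((euler Qlow (1 / 2 ^ n) ^^ ?m n) g - g - ?a n *\<^sub>R Qlow g) \<le> (?a n * B)\<^sup>2 * infnorm g"
          unfolding a by (rule euler_funpow_approx) (use fine elim in auto)
        then have "\<bar>((euler Qlow (1 / 2 ^ n) ^^ ?m n) g - g - ?a n *\<^sub>R Qlow g) $ x\<bar> \<le> (?a n * B)\<^sup>2 * infnorm g"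
          unfolding infnorm_le_iff by blast
        moreover note run_lower
        ultimately show ?thesis
          unfolding x eta vector_minus_component vector_scaleR_component real_scaleR_def by linarith
      qed
      have ind: "indicator (ext_event \<Omega> ?C) (chain_path n h) = ?\<upsilon> h"
        if h: "length h = Suc ?H" for h
      proof -
        have "restrict (chain_path n h) ?w = restrict (chain_path n (take (Suc ?i) h)) ?w"
        proof (rule restrict_ext)
          fix r assume "r \<in> ?w"
          then have "dyadic n r \<le> ?i" by (intro dyadic_mono w)
          then show "chain_path n h r = chain_path n (take (Suc ?i) h) r" by (simp add: chain_path_def)
        qed
        moreover have "length (take (Suc ?i) h) = Suc ?i" using h le sH by simp
        ultimately show ?thesis by (simp add: indicator_def ext_joint_event[OF path_space w(1)])
      qed
      have "?b n * ?E ?\<upsilon>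
        \<le> ?E (\<lambda>h. ?\<upsilon> h * g $ (h ! (?i + ?m n)))"
      proof (rule mean_history_ge)
        show "?i + ?m n \<le> ?H" using le sH by simp
        show "length h = Suc ?i" if "h \<in> ?V" for h using that by simp
        show "?b n \<le> run (k n) (?m n) (\<lambda>h. g $ last h) h" if "h \<in> ?V" for h by (rule bound[OF that])
      qed
      also have "?E ?\<upsilon> = prob n (ext_event \<Omega> ?C)"
        unfolding prob_def expect_def by (rule mean_cong) (simp add: ind)
      also have "?E (\<lambda>h. ?\<upsilon> h * g $ (h ! (?i + ?m n)))
        = ?E (\<lambda>h. \<Sum>y\<in>UNIV. g $ y *
            ?\<iota> h y)"
      proof (rule mean_cong)
        fix h :: "'x list" assume h: "length h = Suc ?H"
        have "(\<Sum>y\<in>UNIV. g $ y * ?\<iota> h y)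
          = (\<Sum>y\<in>UNIV. if y = h ! dyadic n s then g $ y * indicator (ext_event \<Omega> ?C) (chain_path n h) else 0)"
          using t s by (intro sum.cong) (auto simp: indicator_def ext_state_event[OF path_space] chain_path_def)
        then show "?\<upsilon> h * g $ (h ! (?i + ?m n)) = (\<Sum>y\<in>UNIV. g $ y *
            ?\<iota> h y)"
          using le by (simp add: ind[OF h])
      qed
      also have "\<dots> = (\<Sum>y\<in>UNIV. g $ y * prob n (ext_event \<Omega> (state_event \<Omega> s y) \<inter> ext_event \<Omega> ?C))"
        unfolding mean_sum prob_def expect_def ..
      finally have "?b n \<le> (\<Sum>y\<in>UNIV. g $ y * prob n (ext_event \<Omega> (state_event \<Omega> s y) \<inter> ext_event \<Omega> ?C))
          / prob n (ext_event \<Omega> ?C)"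
        using elim(2) by (simp add: field_simps)
      then show ?case by (simp add: cond_def sum_divide_distrib mult.commute)
    qed
  qed
  ultimately have "g $ x + (s - t) * Qlow g $ x - ((s - t) * B)\<^sup>2 * infnorm g - (s - t) * (2 * 0) * infnorm g
    \<le> (\<Sum>y\<in>UNIV. P (state_event \<Omega> s y) ?C * g $ y)"
    by (intro tendsto_le[OF G(1)])
  then show ?thesis
    by (simp add: matrix_vector_mult_def transition_matrix_nth[OF t(2,3)])
qed

lemma initial_limit: "P (state_event \<Omega> 0 x) \<Omega> = p x"
proof (rule tendsto_unique[OF G(1) limit])
  have "\<forall>\<^sub>F n in sequentially. init n x = cond n (state_event \<Omega> 0 x) \<Omega>"
    using eventually_ge_at_top[of n0]
  proof eventually_elim
    case (elim n)
    interpret positive_chain "k n" "init n" by (rule chain) fact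
    have "run (k n) (n * 2 ^ n) (\<lambda>h. indicator (ext_event \<Omega> (state_event \<Omega> 0 x)) (chain_path n h)) [y]
      = (if y = x then 1 else 0)" for y
      by (rule run_const) (auto simp: indicator_def ext_state_event[OF path_space] chain_path_def dyadic_def)
    then show ?case unfolding cond_whole[OF elim] expect_def mean_def
      by (simp add: if_distrib[of "\<lambda>a. _ * a"] cong: if_cong)
  qed
  then show "((\<lambda>n. cond n (state_event \<Omega> 0 x) \<Omega>) \<longlongrightarrow> p x) G"
    by (intro Lim_transform_eventually[OF tendsto_G[OF init_tendsto]] eventually_G)
qed

lemma expectation_limit:
  assumes "u \<in> time_seqs"
  shows "((\<lambda>n. expect n (\<lambda>h. f (restrict (chain_path n h) u))) \<longlongrightarrow>
    (\<Sum>xu\<in>states u. f xu * P (joint_event \<Omega> u xu) \<Omega>)) G"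
proof -
  have u: "finite (states u :: (real \<Rightarrow> 'x) set)" using assms by (intro finite_states) (simp add: time_seqs_def)
  have "((\<lambda>n. \<Sum>xu\<in>states u. f xu * cond n (joint_event \<Omega> u xu) \<Omega>) \<longlongrightarrow>
    (\<Sum>xu\<in>states u. f xu * P (joint_event \<Omega> u xu) \<Omega>)) G" by (intro tendsto_intros limit)
  moreover have "\<forall>\<^sub>F n in G. (\<Sum>xu\<in>states u. f xu * cond n (joint_event \<Omega> u xu) \<Omega>)
    = expect n (\<lambda>h. f (restrict (chain_path n h) u))"
  proof (rule eventually_G)
    show "\<forall>\<^sub>F n in sequentially. (\<Sum>xu\<in>states u. f xu * cond n (joint_event \<Omega> u xu) \<Omega>)
    = expect n (\<lambda>h. f (restrict (chain_path n h) u))"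
      using eventually_ge_at_top[of n0]
    proof eventually_elim
      case (elim n)
      have "(\<Sum>xu\<in>states u. f xu * indicator (ext_event \<Omega> (joint_event \<Omega> u xu)) (chain_path n h)) =
        (\<Sum>xu\<in>states u. if xu = restrict (chain_path n h) u then f xu else 0)" for h
        by (rule sum.cong) (auto simp: indicator_def ext_joint_event[OF path_space assms])
      then show ?case unfolding cond_whole[OF elim] expect_def mean_sum[symmetric]
        using u by (simp add: states_restrict)
    qed
  qed
  ultimately show ?thesis by (rule Lim_transform_eventually)
qed

text \<open>\<open>transition_ge\<close> for g and for -g bounds the matrix from both sides. For s
  \<le> t + 1 the quadratic remainder is at most linear, which explains B + B^2.\<close>

lemma transition_abs_le:
  assumes t: "t \<ge> 0" "u \<in> time_seqs_before t" "xu \<in> states u" and s: "t < s" "s \<le> t + 1"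
  shows "1 / (s - t) * op_norm ((*v) (T u xu t s - mat 1)) \<le> B + B\<^sup>2"
proof -
  let ?T = "T u xu t s"
  have ge: "((?T - mat 1) *v g) $ x \<ge> - ((s - t) * (B + B\<^sup>2) * infnorm g)" for g x
  proof -
    have "- (B * infnorm g) \<le> Qlow g $ x"
      using component_le_infnorm_cart[of "Qlow g" x] Qlow_infnorm[of g] by linarith
    then have "(s - t) * (- (B * infnorm g)) \<le> (s - t) * Qlow g $ x" using s by (intro mult_left_mono) auto
    moreover have "((s - t) * B)\<^sup>2 * infnorm g \<le> (s - t) * (B\<^sup>2 * infnorm g)"
    proof -
      have "(s - t) * (s - t) \<le> 1 * (s - t)" using s by (intro mult_right_mono) auto
      moreover have "0 \<le> B\<^sup>2 * infnorm g" by (simp add: infnorm_pos_le)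
      ultimately have "(s - t) * (s - t) * (B\<^sup>2 * infnorm g) \<le> 1 * (s - t) * (B\<^sup>2 * infnorm g)"
        by (rule mult_right_mono)
      then show ?thesis by (simp only: power2_eq_square mult_1 mult.assoc mult.left_commute)
    qed
    ultimately show ?thesis using transition_ge[OF t s(1), of g x]
      by (simp add: matrix_vector_mult_diff_rdistrib algebra_simps)
  qed
  have "op_norm ((*v) (?T - mat 1)) \<le> (s - t) * (B + B\<^sup>2)"
  proof (rule op_norm_le)
    fix g :: "real^'x" assume g: "infnorm g = 1"
    have "\<bar>((?T - mat 1) *v g) $ x\<bar> \<le> (s - t) * (B + B\<^sup>2)" for x
      using ge[of g x] ge[of "- g" x] g linear_neg[OF matrix_vector_mul_linear, of "?T - mat 1" g]
      by (simp add: infnorm_neg abs_le_iff)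
    then show "infnorm ((?T - mat 1) *v g) \<le> (s - t) * (B + B\<^sup>2)" by (simp add: infnorm_le_iff)
  qed
  then show ?thesis using s by (simp add: field_simps)
qed

text \<open>The left quotient is based at t - h, so the history must also precede t - h; a finite
  set of times before t leaves room for this.\<close>

lemma before_eventually:
  assumes "t > 0" "u \<in> time_seqs_before t"
  shows "\<forall>\<^sub>F h in at_right 0. 0 < h \<and> h < 1 \<and> h < t \<and> u \<in> time_seqs_before (t - h)"
proof -
  have u: "finite u" using assms by (auto simp: time_seqs_before_def time_seqs_def)
  have "\<forall>\<^sub>F h in at_right 0. \<forall>r\<in>u. h < t - r"
    by (intro eventually_ball_finite u ballI order_tendstoD(2)[OF tendsto_ident_at])
      (use assms in \<open>auto simp: time_seqs_before_def\<close>)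
  moreover have "\<forall>\<^sub>F h in at_right 0. h < (1::real)" "\<forall>\<^sub>F h in at_right 0. h < t"
    by (intro order_tendstoD(2)[OF tendsto_ident_at], use assms in simp)+
  ultimately show ?thesis using eventually_at_right_less[of "0::real"]
  proof eventually_elim
    case (elim h)
    then show ?case using assms by (auto simp: time_seqs_before_def)
  qed
qed

lemma well_behaved_limit: "well_behaved \<Omega> P"
  unfolding well_behaved_def
proof (intro allI impI ballI conjI)
  fix t :: real and u and xu :: "real \<Rightarrow> 'x" assume t: "0 \<le> t" "u \<in> time_seqs_before t" "xu \<in> states u"
  have "\<forall>\<^sub>F h in at_right 0. h < (1::real)" by (intro order_tendstoD(2)[OF tendsto_ident_at]) simp
  then have "\<forall>\<^sub>F h in at_right 0. ereal (1 / h * op_norm ((*v) (T u xu t (t + h) - mat 1))) \<le> ereal (B + B\<^sup>2)"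
    using eventually_at_right_less[of "0::real"]
  proof eventually_elim
    case (elim h)
    then show ?case using transition_abs_le[OF t, of "t + h"] by simp
  qed
  from Limsup_bounded[OF this] show "Limsup (at_right 0) (\<lambda>h. ereal (1 / h *
       op_norm ((*v) (T u xu t (t + h) - mat 1)))) < \<infinity>"
    using ereal_infty_less(1) order_le_less_trans by fastforce
  assume "t > 0"
  from before_eventually[OF this t(2)]
  have "\<forall>\<^sub>F h in at_right 0. ereal (1 / h * op_norm ((*v) (T u xu (t - h) t - mat 1))) \<le> ereal (B + B\<^sup>2)"
  proof eventually_elim
    case (elim h)
    then show ?case using transition_abs_le[of "t - h" u xu t] t by simp
  qed
  from Limsup_bounded[OF this] show "Limsup (at_right 0) (\<lambda>h. ereal (1 / h *
       op_norm ((*v) (T u xu (t - h) t - mat 1)))) < \<infinity>"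
    using ereal_infty_less(1) order_le_less_trans by fastforce
qed

text \<open>Dividing \<open>transition_ge\<close> by h leaves an error of order h. The estimate is
  uniform in the base time, so it serves right quotients at t and left quotients based at t - h
  alike.\<close>

lemma outer_derivative_ge:
  assumes t: "t \<ge> 0" "u \<in> time_seqs_before t" "xu \<in> states u" and R: "R \<in> outer_derivative \<Omega> P u xu t"
  shows "Qlow g $ x \<le> (R *v g) $ x"
proof -
  have quot: "((1 / h) *\<^sub>R (T u xu a (a + h) - mat 1) *v g) $ x \<ge> Qlow g $ x - h * (B\<^sup>2 * infnorm g)"
    if "h > 0" "a \<ge> 0" "u \<in> time_seqs_before a" for h a
  proof -
    let ?T = "T u xu a (a + h)"
    have "h * (Qlow g $ x - h * (B\<^sup>2 * infnorm g)) \<le> ((?T - mat 1) *v g) $ x"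
      using transition_ge[OF that(2,3) t(3), of "a + h" g x] that(1)
      by (simp add: matrix_vector_mult_diff_rdistrib power2_eq_square algebra_simps)
    then have "Qlow g $ x - h * (B\<^sup>2 * infnorm g) \<le> (1 / h) * ((?T - mat 1) *v g) $ x"
      using that(1) by (simp add: field_simps)
    then show ?thesis
      by (simp only: scaleR_matrix_vector_assoc[symmetric] vector_scaleR_component real_scaleR_def)
  qed
  obtain h where h: "filterlim h (at_right 0) sequentially"
    and lim: "(\<lambda>i. (1 / h i) *\<^sub>R (T u xu t (t + h i) - mat 1)) \<longlonglongrightarrow> R \<or>
        t > 0 \<and> (\<lambda>i. (1 / h i) *\<^sub>R (T u xu (t - h i) t - mat 1)) \<longlonglongrightarrow> R"
    using R unfolding outer_derivative_def by blast
  have h0: "h \<longlonglongrightarrow> 0" using h by (rule filterlim_mono) (simp_all add: at_within_def)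
  have low: "(\<lambda>i. Qlow g $ x - h i * (B\<^sup>2 * infnorm g)) \<longlonglongrightarrow> Qlow g $ x - 0 * (B\<^sup>2 * infnorm g)"
    by (intro tendsto_intros h0)
  have conclude: "Qlow g $ x \<le> (R *v g) $ x" if D: "D \<longlonglongrightarrow> R"
    and "\<forall>\<^sub>F i in sequentially. Qlow g $ x - h i * (B\<^sup>2 * infnorm g) \<le> (D i *v g) $ x" for D
    using tendsto_le[OF sequentially_bot tendsto_vec_nth[OF tendsto_matrix_vector_mult[OF D tendsto_const]] low that(2)]
    by simp
  from lim show ?thesis
  proof
    assume *: "(\<lambda>i. (1 / h i) *\<^sub>R (T u xu t (t + h i) - mat 1)) \<longlonglongrightarrow> R"
    have "\<forall>\<^sub>F i in sequentially. h i > 0"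
      using h eventually_at_right_less[of "0::real"] unfolding filterlim_iff by blast
    then show ?thesis
    proof (intro conclude[OF *], eventually_elim)
      case (elim i)
      then show ?case using quot[of "h i" t] t by simp
    qed
  next
    assume *: "t > 0 \<and> (\<lambda>i. (1 / h i) *\<^sub>R (T u xu (t - h i) t - mat 1)) \<longlonglongrightarrow> R"
    have "\<forall>\<^sub>F i in sequentially. 0 < h i \<and> h i < 1 \<and> h i < t \<and> u \<in> time_seqs_before (t - h i)"
      using h before_eventually[OF _ t(2)] * unfolding filterlim_iff by blast
    then show ?thesis
    proof (intro conclude[OF conjunct2[OF *]], eventually_elim)
      case (elim i)
      then show ?case using quot[of "h i" "t - h i"] by simp
    qed
  qed
qed

end

lemma (in chain_sequence) chain_limit_exists: "\<exists>G P. chain_limit F B \<Omega> p k n0 G P"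
proof -
  \<comment> \<open>The unit interval bound is available from \<open>n0\<close> on, so compactness
    is applied to the shifted sequence and the filter is pushed forward along the shift.\<close>
  let ?a = "\<lambda>n i. cond (n + n0) (fst i) (snd i)"
  have "?a n i \<in> {0..1}" for n i by (rule cond_in_unit) simp
  then obtain G l where G: "G \<noteq> bot" "G \<le> sequentially" "\<And>i. ((\<lambda>n. ?a n i) \<longlongrightarrow> l i) G"
    using pointwise_limit_along_filter[of ?a] by blast
  let ?G = "filtermap (\<lambda>n. n + n0) G"
  have "chain_limit F B \<Omega> p k n0 ?G (\<lambda>A C. l (A, C))"
  proof
    show "?G \<noteq> bot" using G(1) by (simp add: filtermap_bot_iff)
    have "?G \<le> filtermap (\<lambda>n. n + n0) sequentially" by (rule filtermap_mono[OF G(2)])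
    also have "\<dots> \<le> sequentially"
      using filterlim_add_const_nat_at_top[of n0] by (simp add: filterlim_def)
    finally show "?G \<le> sequentially" .
    show "((\<lambda>n. cond n A C) \<longlongrightarrow> l (A, C)) ?G" for A C
      using G(3)[of "(A, C)"] by (simp add: filterlim_filtermap)
  qed
  then show ?thesis by blast
qed

section \<open>Near-optimal processes\<close>

lemma bounded_rate_setI:
  fixes \<Q> :: "(real^'x^'x::finite) set"
  assumes "\<Q> \<subseteq> rate_matrices" "\<Q> \<noteq> {}" "bounded_rates \<Q>"
  obtains B where "bounded_rate_set \<Q> B"
proof -
  obtain b where b: "\<And>Q. Q \<in> \<Q> \<Longrightarrow> op_norm ((*v) Q) \<le> b"
    using assms(3) unfolding bounded_rates_def bdd_above_def by auto
  have "\<bar>(Q *v f) $ x\<bar> \<le> (real CARD('x) * b) * infnorm f" if "Q \<in> \<Q>" for Q f x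
    by (rule abs_matrix_vector_le) (rule order_trans[OF abs_entry_le_op_norm b[OF that]])
  then have "bounded_rate_set \<Q> (real CARD('x) * b)" using assms by unfold_locales auto
  then show ?thesis using that by blast
qed

lemma bounded_rate_set_subset:
  assumes "bounded_rate_set \<Q> B" "F \<subseteq> \<Q>" "F \<noteq> {}"
  shows "bounded_rate_set F B"
proof -
  interpret bounded_rate_set \<Q> B by fact
  show ?thesis using assms rates bound by unfold_locales auto
qed

text \<open>
  As \<open>\<Q>\<close> need not be closed, controls from all of \<open>\<Q>\<close> might produce limits outside \<open>\<Q>\<close>. The convex hull
  of a finite set of controls is compact and stays inside.
\<close>

lemma finite_approximation:
  fixes \<Q> :: "(real^'x^'x::finite) set"
  assumes "bounded_rate_set \<Q> B" and e: "e > 0"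
  obtains F where "finite F" "F \<subseteq> \<Q>" "F \<noteq> {}"
    "\<And>g x. lower_rate F g $ x \<le> lower_rate \<Q> g $ x + e * infnorm g"
proof -
  interpret bounded_rate_set \<Q> B by fact
  let ?N = "real CARD('x)"
  have "norm Q \<le> ?N * (?N * B)" if "Q \<in> \<Q>" for Q
    by (rule norm_matrix_le) (rule entry_bound[OF that])
  then have "bounded \<Q>" unfolding bounded_iff by blast
  then have cpt: "compact (closure \<Q>)" by (simp add: compact_closure)
  \<comment> \<open>Balls centred in \<Q> already cover the closure, so a finite subcover has its
    centres in \<Q>. In a row of \<open>CARD('x)\<close> entries, an error of e /
    \<open>CARD('x)\<close> in each changes the image of g by at most e * infnorm g.\<close>
  have cover: "closure \<Q> \<subseteq> (\<Union>Q\<in>\<Q>. ball Q (e / ?N))"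
  proof
    fix R assume "R \<in> closure \<Q>"
    then obtain Q where "Q \<in> \<Q>" "dist Q R < e / ?N"
      unfolding closure_approachable using e by (meson divide_pos_pos of_nat_0_less_iff zero_less_card_finite)
    then show "R \<in> (\<Union>Q\<in>\<Q>. ball Q (e / ?N))" by auto
  qed
  obtain F where F: "F \<subseteq> \<Q>" "finite F" "closure \<Q> \<subseteq> (\<Union>Q\<in>F. ball Q (e / ?N))"
    by (rule compactE_image[OF cpt _ cover]) auto
  have ne: "F \<noteq> {}" using F(3) nonempty closure_subset[of \<Q>] by blast
  interpret F: bounded_rate_set F B by (rule bounded_rate_set_subset) (use F ne assms(1) in auto)
  have "lower_rate F g $ x - e * infnorm g \<le> lower_rate \<Q> g $ x" for g x
  proof (rule Qlow_ge)
    fix Q assume "Q \<in> \<Q>"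
    then have "Q \<in> (\<Union>Q\<in>F. ball Q (e / ?N))" using F(3) closure_subset[of \<Q>] by blast
    then obtain Q' where Q': "Q' \<in> F" "dist Q' Q < e / ?N" by auto
    have "\<bar>(Q' - Q) $ x $ y\<bar> \<le> e / ?N" for y
    proof -
      have "\<bar>(Q' - Q) $ x $ y\<bar> \<le> norm ((Q' - Q) $ x)" by (rule component_le_norm_cart)
      also have "\<dots> \<le> norm (Q' - Q)" by (rule Finite_Cartesian_Product.norm_nth_le)
      finally show ?thesis using Q'(2) by (simp add: dist_norm)
    qed
    then have "\<bar>((Q' - Q) *v g) $ x\<bar> \<le> ?N * (e / ?N) * infnorm g" by (rule abs_matrix_vector_le)
    then show "lower_rate F g $ x - e * infnorm g \<le> (Q *v g) $ x"
      using F.Qlow_le[OF Q'(1), of g x] by (simp add: matrix_vector_mult_diff_rdistrib)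
  qed
  then show ?thesis using that[OF F(2,1) ne] by (simp add: diff_le_eq)
qed

text \<open>Restricting the controls to F costs d * e in each step, hence e per unit of
  time.\<close>

lemma euler_funpow_le:
  assumes "bounded_rate_set F B" "bounded_rate_set \<Q> B" and e: "e \<ge> 0"
    and le: "\<And>g x. lower_rate F g $ x \<le> lower_rate \<Q> g $ x + e * infnorm g"
    and d: "0 \<le> d" "d * B \<le> 1"
  shows "(euler (lower_rate F) d ^^ j) g $ x \<le> (euler (lower_rate \<Q>) d ^^ j) g $ x + real j * d * e * infnorm g"
proof (induction j arbitrary: x)
  case 0 then show ?case by simp
next
  case (Suc j)
  interpret F: bounded_rate_set F B by fact
  interpret Q: bounded_rate_set \<Q> B by fact
  let ?h = "(euler (lower_rate \<Q>) d ^^ j) g"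
  have "euler (lower_rate F) d ((euler (lower_rate F) d ^^ j) g) $ x \<le> euler (lower_rate F) d ?h $ x + real j * d * e * infnorm g"
    by (rule lower_transition_le[OF F.lower_transition_euler[OF d] Suc])
  also have "euler (lower_rate F) d ?h $ x \<le> euler (lower_rate \<Q>) d ?h $ x + d * (e * infnorm ?h)"
    using mult_left_mono[OF le[of ?h x] d(1)] by (simp add: euler_def algebra_simps)
  also have "d * (e * infnorm ?h) \<le> d * (e * infnorm g)"
    using d e by (intro mult_left_mono lower_transition_infnorm_le
        Q.lower_transition_euler_funpow) auto
  finally show ?case by (simp add: algebra_simps)
qed

text \<open>If row x of R were outside the compact hull of the rows of F, a separating functional g
  would put (R g)(x) strictly below the lower envelope of F. So each row of R is a row of some
  matrix in \<Q>, by convexity; separately specified rows allow the rows to come from different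
  matrices.\<close>

lemma rate_matrix_in_hull:
  fixes \<Q> :: "(real^'x^'x::finite) set"
  assumes F: "bounded_rate_set F B" "finite F" "F \<subseteq> \<Q>"
    and Q: "convex \<Q>" "separately_specified_rows \<Q>"
    and R: "R \<in> rate_matrices" "\<And>g x. lower_rate F g $ x \<le> (R *v g) $ x"
  shows "R \<in> \<Q>"
proof -
  interpret bounded_rate_set F B by fact
  have "R $ x \<in> (\<lambda>Q. Q $ x) ` \<Q>" for x
  proof -
    let ?K = "convex hull ((\<lambda>Q. Q $ x) ` F)"
    have "R $ x \<in> ?K"
    proof (rule ccontr)
      assume "R $ x \<notin> ?K"
      moreover have "closed ?K" using F(2) by (intro compact_imp_closed finite_imp_compact_convex_hull) auto
      ultimately obtain g b where gb: "g \<bullet> R $ x < b" "\<And>y. y \<in> ?K \<Longrightarrow> b < g \<bullet> y"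
        using separating_hyperplane_closed_point[OF convex_convex_hull] by blast
      have row: "(Q *v g) $ x = g \<bullet> Q $ x" for Q :: "real^'x^'x"
        by (simp add: matrix_vector_mult_def inner_vec_def mult.commute)
      have "b \<le> lower_rate F g $ x"
        by (rule Qlow_ge) (use gb(2) hull_inc[of _ "(\<lambda>Q. Q $ x) ` F"] in \<open>force simp: row less_imp_le\<close>)
      then show False using R(2)[of g x] gb(1) by (simp add: row)
    qed
    also have "?K \<subseteq> (\<lambda>Q. Q $ x) ` \<Q>"
    proof (rule hull_minimal)
      show "(\<lambda>Q. Q $ x) ` F \<subseteq> (\<lambda>Q. Q $ x) ` \<Q>" using F(3) by auto
      show "convex ((\<lambda>Q. Q $ x) ` \<Q>)"
        by (rule convex_linear_image[OF bounded_linear.linear[OF bounded_linear_vec_nth] Q(1)])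
    qed
    finally show ?thesis .
  qed
  then show ?thesis using R(1) Q(2) unfolding separately_specified_rows_def by blast
qed

lemma dyadic_diff_bounds:
  assumes "0 \<le> a" "a \<le> b"
  shows "\<bar>real (dyadic n b - dyadic n a) / 2 ^ n - (b - a)\<bar> \<le> 1 / 2 ^ n"
proof -
  have "dyadic n a \<le> dyadic n b" by (rule dyadic_mono[OF assms(2)])
  then have "real (dyadic n b - dyadic n a) / 2 ^ n = real (dyadic n b) / 2 ^ n - real (dyadic n a) / 2 ^ n"
    by (simp add: of_nat_diff diff_divide_distrib)
  then show ?thesis using dyadic_bounds[of a n] dyadic_bounds[of b n] assms by linarith
qed

text \<open>The three error terms come from the finite control set, the Euler discretisation and the
  rounding of the interval. The factor c + 2^-n bounds the elapsed time on the grid.\<close>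

lemma euler_le_semigroup:
  assumes F: "bounded_rate_set F B" and Q: "bounded_rate_set \<Q> B" and e: "e \<ge> 0"
    and le: "\<And>g x. lower_rate F g $ x \<le> lower_rate \<Q> g $ x + e * infnorm g"
    and n: "1 / 2 ^ n * B \<le> 1" and ab: "0 \<le> a" "a \<le> b" "b \<le> c"
  shows "(euler (lower_rate F) (1 / 2 ^ n) ^^ (dyadic n b - dyadic n a)) g $ x \<le>
    lower_trans (lower_rate \<Q>) a b g $ x +
      ((c + 1 / 2 ^ n) * e + (c + 1 / 2 ^ n) * (1 / 2 ^ n * B\<^sup>2) + 1 / 2 ^ n * B) * infnorm g"
proof -
  interpret Q: bounded_rate_set \<Q> B by fact
  let ?d = "1 / 2 ^ n :: real" and ?j = "dyadic n b - dyadic n a"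
  let ?s = "real ?j * ?d"
  have dB: "0 \<le> ?d" "?d * B \<le> 1" using n by auto
  have s: "\<bar>?s - (b - a)\<bar> \<le> ?d" using dyadic_diff_bounds[OF ab(1,2), of n] by simp
  then have sc: "?s \<le> c + ?d" using ab by linarith
  have L: "lower_trans (lower_rate \<Q>) a b = Q.semigroup (b - a)" by (rule Q.lower_trans_eq[OF ab(2)])
  have g: "infnorm g \<ge> 0" by (rule infnorm_pos_le)
  have "(euler (lower_rate F) ?d ^^ ?j) g $ x \<le> (euler (lower_rate \<Q>) ?d ^^ ?j) g $ x + ?s * (e * infnorm g)"
    using euler_funpow_le[OF F Q e le dB, of ?j g x] by (simp add: mult.assoc)
  also have "?s * (e * infnorm g) \<le> (c + ?d) * (e * infnorm g)"
    using sc e g by (intro mult_right_mono) auto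
  also have "(euler (lower_rate \<Q>) ?d ^^ ?j) g $ x \<le> Q.semigroup ?s g $ x + ?s * (?d * B\<^sup>2 * infnorm g)"
    using Q.euler_funpow_semigroup[OF dB, of ?j g, unfolded infnorm_le_iff, rule_format, of x] by (simp add: mult.assoc)
  also have "?s * (?d * B\<^sup>2 * infnorm g) \<le> (c + ?d) * (?d * B\<^sup>2 * infnorm g)"
    using sc g by (intro mult_right_mono) auto
  also have "Q.semigroup ?s g $ x \<le> Q.semigroup (b - a) g $ x + ?d * (B * infnorm g)"
  proof -
    have "\<bar>Q.semigroup ?s g $ x - Q.semigroup (b - a) g $ x\<bar> \<le> \<bar>?s - (b - a)\<bar> * (B * infnorm g)"
      using Q.semigroup_abs_diff[of ?s "b - a" g, unfolded infnorm_le_iff, rule_format, of x] ab by (simp add: mult.assoc)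
    also have "\<dots> \<le> ?d * (B * infnorm g)" using s g Q.B_nonneg by (intro mult_right_mono) auto
    finally show ?thesis by linarith
  qed
  finally show ?thesis unfolding L by (simp add: algebra_simps)
qed

text \<open>The finite set F is fixed once, with a tolerance adapted to \<epsilon>; only the step
  and the noise vary with n. After the limit just the loss from F remains.\<close>

lemma near_optimal_process:
  fixes \<Omega> :: "(real \<Rightarrow> 'x::finite) set" and \<Q> :: "(real^'x^'x) set" and f :: "(real \<Rightarrow> 'x) \<Rightarrow> real"
  assumes \<Omega>: "path_space \<Omega>" and Q: "bounded_rate_set \<Q> B" "convex \<Q>" "separately_specified_rows \<Q>"
    and t: "strict_mono_on {..m} t" "t 0 = 0" and q: "q \<in> M" and eps: "\<epsilon> > 0"
  shows "\<exists>P\<in>processes_W \<Omega> \<Q> M.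
    (\<Sum>xu\<in>states (t ` {..m}). f xu * P (joint_event \<Omega> (t ` {..m}) xu) \<Omega>) \<le>
    (\<Sum>x\<in>UNIV. pmf q x * compose_ops (lower_trans (lower_rate \<Q>)) t m f (\<lambda>_\<in>{t 0}. x)) + \<epsilon>"
proof -
  interpret Q: bounded_rate_set \<Q> B by fact
  let ?w = "t ` {..m}" and ?L = "lower_trans (lower_rate \<Q>)"
  let ?comp = "\<lambda>x. compose_ops ?L t m f (\<lambda>_\<in>{t 0}. x)"
  have mono: "t i < t j" if "i < j" "j \<le> m" for i j
    using t(1) that by (auto simp: strict_mono_on_def)
  have t0: "t i \<ge> 0" if "i \<le> m" for i using mono[of 0 i] that t(2) by (cases i) auto
  have tm: "t i \<le> t m" if "i \<le> m" for i using mono[of i m] that by (cases "i = m") auto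
  have w: "?w \<in> time_seqs" using t0 by (auto simp: time_seqs_def)
  define c where "c = (\<Sum>xu\<in>states ?w. \<bar>f xu\<bar>)"
  have fc: "\<bar>f xu\<bar> \<le> c" if "xu \<in> states ?w" for xu
    unfolding c_def by (rule member_le_sum) (use that finite_states[of ?w] in auto)
  have c0: "c \<ge> 0" by (simp add: c_def sum_nonneg)
  \<comment> \<open>There are m operators, each over a time of at most t m, and each loses e per
    unit of time, for a payoff bounded by c. The added 1 avoids a zero denominator.\<close>
  define e where "e = \<epsilon> / (real m * t m * c + 1)"
  have K: "real m * t m * c \<ge> 0" using c0 t0[of m] by simp
  have e: "e > 0" "real m * (t m * e) * c \<le> \<epsilon>" using eps K by (auto simp: e_def field_simps)
  obtain F where F: "finite F" "F \<subseteq> \<Q>" "F \<noteq> {}"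
    and FQ: "\<And>g x. lower_rate F g $ x \<le> lower_rate \<Q> g $ x + e * infnorm g"
    using finite_approximation[OF Q(1) e(1)] by blast
  have FB: "bounded_rate_set F B" by (rule bounded_rate_set_subset[OF Q(1) F(2,3)])
  interpret F: bounded_rate_set F B by fact
  obtain n0 where n0: "\<And>n. n \<ge> n0 \<Longrightarrow> 1 / 2 ^ n * B \<le> 1" using F.fine_steps by blast
  define T where "T n = euler (lower_rate F) (1 / 2 ^ n)" for n :: nat
  define \<phi> where "\<phi> n h = f (\<lambda>r\<in>?w. h ! dyadic n r)" for n and h :: "'x list"
  define N where "N n = dyadic n (t m)" for n
  \<comment> \<open>The value after the next move. For histories longer than \<open>N n\<close> the
    truncated subtraction gives 0, and the control still lies in F, as the lower kernel bound
    requires.\<close>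
  define g where "g n h = (\<chi> y. backward (T n) (\<phi> n) (N n - length h) (h @ [y]))" for n and h :: "'x list"
  define a where "a n h = (SOME Q. Q \<in> F \<and> (Q *v g n h) $ last h = lower_rate F (g n h) $ last h)" for n and h :: "'x list"
  have a: "a n h \<in> F \<and> (a n h *v g n h) $ last h = lower_rate F (g n h) $ last h" for n h
    unfolding a_def by (rule someI_ex) (use F.optimal_control_exists[OF F(1)] in blast)
  define k where "k n = controlled_kernel (a n) (1 / 2 ^ n) (1 / 4 ^ n)" for n :: nat
  have eta: "0 < (1 / 4 ^ n :: real)" "(1 / 4 ^ n :: real) \<le> 1" for n :: nat by auto
  have kpos: "positive_kernel (k n)" if "n \<ge> n0" for n
    unfolding k_def by (rule F.positive_controlled_kernel) (use a n0[OF that] eta in auto)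
  interpret C: chain_sequence F B \<Omega> "pmf q" k n0
  proof (intro chain_sequence.intro chain_sequence_axioms.intro FB)
    show "(\<Sum>y\<in>UNIV. k n h y * g $ y) \<ge> euler (lower_rate F) (1 / 2 ^ n) g $ last h - 2 * (1 / 4 ^ n) * infnorm g"
      if "n \<ge> n0" for n h g
      unfolding k_def by (rule F.controlled_kernel_bounds) (use a n0[OF that] eta in auto)
  qed (use \<Omega> n0 kpos in \<open>auto simp: sum_pmf_eq_1\<close>)
  obtain G P where "chain_limit F B \<Omega> (pmf q) k n0 G P" using C.chain_limit_exists by blast
  then interpret chain_limit F B \<Omega> "pmf q" k n0 G P .
  have "R \<in> \<Q>" if "0 \<le> s" "u \<in> time_seqs_before s" "xu \<in> states u" "R \<in> outer_derivative \<Omega> P u xu s" for s u xu R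
  proof (rule rate_matrix_in_hull[OF FB F(1,2) Q(2,3)])
    show "R \<in> rate_matrices" using that(4) by (simp add: outer_derivative_def)
  qed (rule outer_derivative_ge[OF that])
  then have "consistent_rates \<Omega> \<Q> P" unfolding consistent_rates_def by blast
  moreover have "consistent_initial \<Omega> M P" unfolding consistent_initial_def initial_limit using q by auto
  ultimately have PW: "P \<in> processes_W \<Omega> \<Q> M"
    unfolding processes_W_def using coherent_limit well_behaved_limit by blast
  define E where "E n = (t m + 1 / 2 ^ n) * e + (t m + 1 / 2 ^ n) * (1 / 2 ^ n * B\<^sup>2) + 1 / 2 ^ n * B" for n :: nat
  \<comment> \<open>The noise of \<open>N n\<close> steps, written as grid time multiplied by a
    factor that tends to 0.\<close>
  let ?r = "\<lambda>n. real (N n) / 2 ^ n * (2 * (1 / 2 ^ n)) * c"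
  let ?b = "\<lambda>n x. C.init n x * (?comp x + real m * E n * c + ?r n)"
  have bound: "C.expect n (\<phi> n) \<le> (\<Sum>x\<in>UNIV. ?b n x)"
    if n: "n \<ge> n0" and hor: "t m \<le> real n" and inc: "inj_on (dyadic n) ?w" for n
  proof -
    interpret positive_chain "k n" "C.init n" by (rule C.chain[OF n])
    have d: "(0::real) \<le> 1 / 2 ^ n" "1 / 2 ^ n * B \<le> 1" using n0[OF n] by auto
    have \<phi>c: "\<bar>\<phi> n h\<bar> \<le> c" for h unfolding \<phi>_def by (rule fc[OF states_restrict])
    \<comment> \<open>Injectivity of the rounding on the observed times upgrades its monotonicity to
      a strict one.\<close>
    have dm: "dyadic n (t i) < dyadic n (t j)" if "i < j" "j \<le> m" for i j
      using dyadic_mono[OF less_imp_le[OF mono[OF that]], of n] inj_onD[OF inc, of "t i" "t j"] mono[OF that] that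
      by (metis atMost_iff image_eqI le_neq_implies_less less_imp_le_nat less_irrefl order_trans)
    have NH: "N n \<le> n * 2 ^ n" unfolding N_def by (rule dyadic_le_horizon[OF hor])
    have En: "E n \<ge> 0" unfolding E_def using e t0[of m] F.B_nonneg by (intro add_nonneg_nonneg mult_nonneg_nonneg) auto
    have "run (k n) (n * 2 ^ n) (\<phi> n) [x] \<le> ?comp x + real m * E n * c + ?r n" for x
    proof -
      obtain r where r: "n * 2 ^ n = N n + r" using NH le_Suc_ex by blast
      \<comment> \<open>The payoff does not observe states after t m, so running on to the horizon
        leaves the expectation unchanged.\<close>
      have "run (k n) (n * 2 ^ n) (\<phi> n) [x] = run (k n) (N n) (\<phi> n) [x]"
        unfolding r run_plus
      proof (rule run_cong)
        fix z :: "'x list" assume z: "length z = N n"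
        show "run (k n) r (\<phi> n) ([x] @ z) = \<phi> n ([x] @ z)"
        proof (rule run_const)
          fix z' :: "'x list"
          have "(([x] @ z) @ z') ! dyadic n s = ([x] @ z) ! dyadic n s" if s: "s \<in> ?w" for s
          proof -
            have "s \<le> t m" using s tm by auto
            then have "dyadic n s \<le> N n" unfolding N_def by (rule dyadic_mono)
            then show ?thesis using z by (simp only: nth_append length_append) simp
          qed
          then have "(\<lambda>s\<in>?w. (([x] @ z) @ z') ! dyadic n s) = (\<lambda>s\<in>?w. ([x] @ z) ! dyadic n s)"
            by (rule restrict_ext)
          then show "\<phi> n (([x] @ z) @ z') = \<phi> n ([x] @ z)" unfolding \<phi>_def by simp
        qed simp
      qed
      also have "\<dots> \<le> backward (T n) (\<phi> n) (N n) [x] + real (N n) * (2 * (1 / 4 ^ n)) * c"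
        unfolding T_def
      proof (rule F.run_le_backward[OF kpos[OF n] d _ \<phi>c])
        fix h :: "'x list" and j g'
        assume h: "h \<noteq> []" "length h + j = N n" "g' = (\<chi> y. backward (euler (lower_rate F) (1 / 2 ^ n)) (\<phi> n) j (h @ [y]))"
        then have "j = N n - length h" by simp
        with h(3) have "g' = g n h" by (simp add: g_def T_def)
        then show "(\<Sum>y\<in>UNIV. k n h y * g' $ y) \<le> euler (lower_rate F) (1 / 2 ^ n) g' $ last h + 2 * (1 / 4 ^ n) * infnorm g'"
          unfolding k_def using a[of n h] by (intro F.controlled_kernel_bounds d eta) auto
      qed auto
      also have "real (N n) * (2 * (1 / 4 ^ n)) * c = ?r n" by (simp add: power_mult_distrib[symmetric])
      also have "backward (T n) (\<phi> n) (N n) [x] =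
          compose_ops (\<lambda>a b. T n ^^ (dyadic n b - dyadic n a)) t m f (\<lambda>_\<in>{t 0}. x)"
        unfolding \<phi>_def N_def by (rule backward_eq_compose_ops[where t = t and m = m, OF dm t(2) mono])
      also have "\<dots> \<le> ?comp x + 0 + real m * E n * c"
      proof (rule compose_ops_le)
        show "lower_transition_operator (T n ^^ (dyadic n (t (Suc i)) - dyadic n (t i)))" for i
          unfolding T_def by (rule F.lower_transition_euler_funpow[OF d])
        fix i assume i: "i < m"
        have ti: "t i \<le> t (Suc i)" using mono[of i "Suc i"] i by simp
        show "lower_transition_operator (?L (t i) (t (Suc i)))"
          using ti by (simp add: Q.lower_trans_eq Q.lower_transition_semigroup)
        show "(T n ^^ (dyadic n (t (Suc i)) - dyadic n (t i))) g $ y \<le> ?L (t i) (t (Suc i)) g $ y + E n * infnorm g" for g y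
          unfolding T_def E_def
          by (rule euler_le_semigroup[OF FB Q(1) _ FQ d(2)]) (use i ti t0[of i] tm[of "Suc i"] e in auto)
      qed (use mono fc En states_restrict in auto)
      finally show ?thesis by simp
    qed
    then show ?thesis unfolding C.expect_def mean_def by (intro sum_mono mult_left_mono less_imp_le[OF initial_pos])
  qed
  have "\<phi> n = (\<lambda>h. f (restrict (chain_path n h) ?w))" for n
    by (simp add: fun_eq_iff \<phi>_def chain_path_def[abs_def])
  then have "((\<lambda>n. C.expect n (\<phi> n)) \<longlongrightarrow> (\<Sum>xu\<in>states ?w. f xu * P (joint_event \<Omega> ?w xu) \<Omega>)) G"
    using expectation_limit[OF w, of f] by simp
  moreover have "((\<lambda>n. \<Sum>x\<in>UNIV. ?b n x) \<longlongrightarrow>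
    (\<Sum>x\<in>UNIV. pmf q x * (?comp x + real m * ((t m + 0) * e + (t m + 0) * (0 * B\<^sup>2) + 0 * B) * c + t m * (2 * 0) * c))) G"
    unfolding E_def N_def
    by (rule tendsto_G, intro tendsto_intros tendsto_inverse_two_power dyadic_tendsto C.init_tendsto t0) simp
  moreover have "\<forall>\<^sub>F n in G. C.expect n (\<phi> n) \<le> (\<Sum>x\<in>UNIV. ?b n x)"
  proof (rule eventually_G)
    show "\<forall>\<^sub>F n in sequentially. C.expect n (\<phi> n) \<le> (\<Sum>x\<in>UNIV. ?b n x)"
      using eventually_ge_at_top[of n0] eventually_ge_real[of "t m"] dyadic_inj_eventually[OF w]
      by eventually_elim (rule bound)
  qed
  ultimately have "(\<Sum>xu\<in>states ?w. f xu * P (joint_event \<Omega> ?w xu) \<Omega>) \<le>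
    (\<Sum>x\<in>UNIV. pmf q x * (?comp x + real m * ((t m + 0) * e + (t m + 0) * (0 * B\<^sup>2) + 0 * B) * c + t m * (2 * 0) * c))"
    by (intro tendsto_le[OF G(1)])
  also have "\<dots> = (\<Sum>x\<in>UNIV. pmf q x * ?comp x) + real m * (t m * e) * c"
    by (simp add: distrib_left sum.distrib sum_distrib_right[symmetric] sum_pmf_eq_1)
  finally show ?thesis using PW e(2) by (intro bexI[of _ P]) auto
qed

theorem proposition9p5:
  fixes \<Omega> :: "(real \<Rightarrow> 'x::finite) set"
    and M :: "'x pmf set"
    and \<Q> :: "(real^'x^'x) set"
    and n :: nat
    and t :: "nat \<Rightarrow> real"
    and f :: "(real \<Rightarrow> 'x) \<Rightarrow> real"
  assumes "path_space \<Omega>"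
    and "M \<noteq> {}"
    and "\<Q> \<subseteq> rate_matrices"
    and "\<Q> \<noteq> {}"
    and "bounded_rates \<Q>"
    and "convex \<Q>"
    and "separately_specified_rows \<Q>"
    and "strict_mono_on {..n} t"
    and "t 0 = 0"
  shows "lower_expectation_W \<Omega> \<Q> M (t ` {..n}) f =
    lower_expectation M
      (\<chi> x. compose_ops (lower_trans (lower_rate \<Q>)) t n f (\<lambda>_\<in>{t 0}. x))"
proof -
  obtain B where B: "bounded_rate_set \<Q> B" using bounded_rate_setI[OF assms(3-5)] .
  let ?v = "\<chi> x. compose_ops (lower_trans (lower_rate \<Q>)) t n f (\<lambda>_\<in>{t 0}. x)"
  let ?\<Sigma> = "\<lambda>q. \<Sum>x\<in>UNIV. pmf q x * ?v $ x"
  let ?V = "\<lambda>P. \<Sum>xu\<in>states (t ` {..n}). f xu * P (joint_event \<Omega> (t ` {..n}) xu) \<Omega>"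
  let ?W = "processes_W \<Omega> \<Q> M"
  have "\<exists>P\<in>?W. ?V P \<le> ?\<Sigma> q + \<epsilon>" if "q \<in> M" "\<epsilon> > 0" for q \<epsilon>
    using near_optimal_process[OF assms(1) B assms(6-9) that, of f] by simp
  note near = this
  have lower: "\<exists>q\<in>M. ?\<Sigma> q \<le> ?V P" if P: "P \<in> ?W" for P
  proof -
    interpret consistent_process \<Omega> P \<Q> B
      using B assms(1) P by (simp add: processes_W_def consistent_process_def process_def consistent_process_axioms_def)
    obtain q where q: "q \<in> M" "(\<lambda>x. P (state_event \<Omega> 0 x) \<Omega>) = pmf q"
      using P by (auto simp: processes_W_def consistent_initial_def)
    have "?\<Sigma> q = (\<Sum>x\<in>UNIV. P (state_event \<Omega> 0 x) \<Omega> * compose_ops (lower_trans (lower_rate \<Q>)) t n f (\<lambda>_\<in>{t 0}. x))"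
      by (rule sum.cong) (simp_all add: q(2)[symmetric])
    also have "\<dots> \<le> ?V P" by (rule compose_ops_le_expectation[OF assms(8,9)])
    finally show ?thesis using q(1) by blast
  qed
  have "\<bar>?\<Sigma> q\<bar> \<le> infnorm ?v" for q
  proof -
    have "\<bar>?\<Sigma> q\<bar> \<le> (\<Sum>x\<in>UNIV. pmf q x * infnorm ?v)"
      by (rule order_trans[OF sum_abs], rule sum_mono)
        (simp only: abs_mult abs_of_nonneg[OF pmf_nonneg], rule mult_left_mono[OF component_le_infnorm_cart], simp)
    also have "\<dots> = infnorm ?v" by (simp add: sum_distrib_right[symmetric] sum_pmf_eq_1)
    finally show ?thesis .
  qed
  then have bddM: "bdd_below (?\<Sigma> ` M)" by (intro bdd_belowI2[of _ "- infnorm ?v"]) (simp add: abs_le_iff minus_le_iff)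
  have geM: "Inf (?\<Sigma> ` M) \<le> ?V P" if "P \<in> ?W" for P
    using lower[OF that] cINF_lower[OF bddM] order_trans by blast
  obtain q0 where "q0 \<in> M" using assms(2) by blast
  \<comment> \<open>A near-optimal process with tolerance 1 shows that a consistent process exists;
    otherwise the left side would be the infimum of an empty set of reals.\<close>
  then have ne: "?W \<noteq> {}" using near[of q0 1] by auto
  have bddW: "bdd_below (?V ` ?W)" using geM by (intro bdd_belowI2)
  have "Inf (?V ` ?W) \<le> Inf (?\<Sigma> ` M)"
  proof (rule cINF_greatest[OF assms(2)])
    fix q assume q: "q \<in> M"
    show "Inf (?V ` ?W) \<le> ?\<Sigma> q"
    proof (rule field_le_epsilon)
      fix \<epsilon> :: real assume "\<epsilon> > 0"
      from near[OF q this] show "Inf (?V ` ?W) \<le> ?\<Sigma> q + \<epsilon>" using cINF_lower[OF bddW] order_trans by blast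
    qed
  qed
  moreover have "Inf (?\<Sigma> ` M) \<le> Inf (?V ` ?W)" by (rule cINF_greatest[OF ne geM])
  ultimately show ?thesis unfolding lower_expectation_W_def lower_expectation_def by simp
qed

end
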